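(* For $n\ge 2$ let $R_n$ be the $n\times(n-1)$ rectangle in the square lattice $\mathbb Z^2$, with edge set $E(R_n)$, and consider critical bond percolation on $R_n$, i.e. the uniform measure $\mathbb P_n$ on $\{-1,1\}^{E(R_n)}$. Let $\mathsf{LR}_n:\{-1,1\}^{E(R_n)}\to\{-1,1\}$ be the indicator function of the left-to-right crossing event in $R_n$. Then there is no sparse reconstruction for $\mathsf{LR}_n$; that is, for any sequence $U_n\subseteq E(R_n)$ with $\lim_{n\to\infty}|U_n|/|E(R_n)|=0$, we have $$\lim_{n\to\infty}\mathrm{clue}(\mathsf{LR}_n\mid U_n)=0 .$$
   Context: $R_n$ is the subgraph of $\mathbb Z^2$ induced by the vertex set $\{0,\dots,n-1\}\times\{0,\dots,n-2\}$. A configuration $\omega\in\{-1,1\}^{E(R_n)}$ is a percolation configuration: edge $e$ is open if $\omega_e=1$ and closed if $\omega_e=-1$; under $\mathbb P_n$ each edge is open with probability $1/2$ independently. $\mathsf{LR}_n(\omega)=1$ if there is a path of open edges in $R_n$ connecting a vertex on the left side (first coordinate $0$) with a vertex on the right side (first coordinate $n-1$), and $\mathsf{LR}_n(\omega)=-1$ otherwise. For $U\subseteq E(R_n)$, $\mathcal F_U$ is the $\sigma$-algebra generated by $\{\omega_e:e\in U\}$, and $\mathrm{clue}(f\mid U):=\mathrm{Var}(\mathbb E[f\mid \mathcal F_U])/\mathrm{Var}(f)$. *)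

theory Defs
  imports "HOL-Probability.Probability"
begin

type_synonym vertex = "int \<times> int"
type_synonym edge = "vertex set"

definition Z2_adj :: "vertex \<Rightarrow> vertex \<Rightarrow> bool" where
  "Z2_adj u v \<longleftrightarrow> \<bar>fst u - fst v\<bar> + \<bar>snd u - snd v\<bar> = 1"

definition R_verts :: "nat \<Rightarrow> vertex set" where
  "R_verts n = {0..int n - 1} \<times> {0..int n - 2}"

definition R_edges :: "nat \<Rightarrow> edge set" where
  "R_edges n = {{u, v} | u v. u \<in> R_verts n \<and> v \<in> R_verts n \<and> Z2_adj u v}"

definition configs :: "'e set \<Rightarrow> ('e \<Rightarrow> int) set" where
  "configs E = E \<rightarrow>\<^sub>E {-1, 1}"

definition perc :: "nat \<Rightarrow> (edge \<Rightarrow> int) measure" where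
  "perc n = uniform_count_measure (configs (R_edges n))"

definition open_path :: "nat \<Rightarrow> (edge \<Rightarrow> int) \<Rightarrow> vertex list \<Rightarrow> bool" where
  "open_path n \<omega> p \<longleftrightarrow> p \<noteq> [] \<and> distinct p \<and> set p \<subseteq> R_verts n \<and>
     (\<forall>i. Suc i < length p \<longrightarrow> {p ! i, p ! Suc i} \<in> R_edges n \<and> \<omega> {p ! i, p ! Suc i} = 1)"

definition LR :: "nat \<Rightarrow> (edge \<Rightarrow> int) \<Rightarrow> real" where
  "LR n \<omega> =
     (if \<exists>p. open_path n \<omega> p \<and> fst (hd p) = 0 \<and> fst (last p) = int n - 1 then 1 else -1)"

text \<open>The \<open>\<sigma>\<close>-algebra on the sample space of \<open>M\<close> generated by the coordinates in \<open>U\<close>.\<close>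

definition coord_algebra :: "('e \<Rightarrow> int) measure \<Rightarrow> 'e set \<Rightarrow> ('e \<Rightarrow> int) measure" where
  "coord_algebra M U = sigma (space M) {{\<omega> \<in> space M. \<omega> e \<in> A} | e A. e \<in> U}"

definition clue :: "('e \<Rightarrow> int) measure \<Rightarrow> (('e \<Rightarrow> int) \<Rightarrow> real) \<Rightarrow> 'e set \<Rightarrow> real" where
  "clue M f U =
     prob_space.variance M (real_cond_exp M (coord_algebra M U) f) / prob_space.variance M f"

text \<open>The library's \<^const>\<open>real_cond_exp\<close> is a genuine conditional expectation only on a
  \<open>\<sigma>\<close>-finite subalgebra, and the library's variance is meant for probability spaces; both
  conditions hold here.\<close>

lemma finite_R_edges: "finite (R_edges n)"
proof (rule finite_subset)
  show "R_edges n \<subseteq> Pow (R_verts n)" by (auto simp: R_edges_def)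
qed (simp add: R_verts_def)

lemma prob_space_perc: "prob_space (perc n)"
  unfolding perc_def
proof (rule prob_space_uniform_count_measure)
  show "finite (configs (R_edges n))"
    unfolding configs_def by (intro finite_PiE finite_R_edges) auto
  show "configs (R_edges n) \<noteq> {}"
    by (simp add: configs_def PiE_eq_empty_iff)
qed

lemma subalgebra_coord_algebra_perc: "subalgebra (perc n) (coord_algebra (perc n) U)"
proof -
  have "sigma_sets (space (perc n)) {{\<omega> \<in> space (perc n). \<omega> e \<in> A} | e A. e \<in> U}
          \<subseteq> sets (perc n)"
    by (rule sets.sigma_sets_subset)
      (auto simp: perc_def space_uniform_count_measure sets_uniform_count_measure)
  then show ?thesis
    unfolding subalgebra_def coord_algebra_def
    by (subst sets_measure_of) (auto simp: space_measure_of_conv)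
qed

lemma sigma_finite_subalgebra_coord_algebra_perc:
  "sigma_finite_subalgebra (perc n) (coord_algebra (perc n) U)"
proof -
  interpret prob_space "perc n" by (rule prob_space_perc)
  interpret finite_measure_subalgebra "perc n" "coord_algebra (perc n) U"
    by unfold_locales (rule subalgebra_coord_algebra_perc)
  show ?thesis by unfold_locales
qed

end

theory Submission
  imports Defs
begin

text \<open>Let \<open>f\<close> be the crossing event and \<open>h\<close> its conditional
  expectation given a sparse set \<open>U\<close>, so that the clue is the correlation of
  \<open>f\<close> and \<open>h\<close>. Translate both by all vectors in a square of side
  \<open>k = \<epsilon> n\<close>. On the one hand, the translates of \<open>f\<close> differ from
  each other with probability \<open>O(k/n)\<close>, so every translate of \<open>h\<close> keeps
  the correlation with every translate of \<open>f\<close>. On the other hand, each edge lies in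
  at most \<open>|U|\<close> of the translates of \<open>U\<close>, so Parseval's identity makes
  the sum of the translates of \<open>h\<close> small in mean square. Together the clue is
  \<open>O(k/n + sqrt |U| / k)\<close>.

  For the stability under translation, consider the crossing events of the rectangle shifted by
  \<open>0, k, 2k, \<dots>\<close>. Every time the crossing disappears between two consecutive
  shifts, a dual crossing separates the crossings seen before from those seen later, so many
  changes force many disjoint crossings of a narrower rectangle. The van den Berg--Kesten
  inequality together with the Russo--Seymour--Welsh bound for that rectangle makes the expected
  number of changes bounded, and vertical shifts reduce to horizontal ones by duality.

  All lattices are drawn in the doubled grid of integer sites: vertices have even coordinates,
  faces have odd coordinates, and an edge, like its dual edge, is its midpoint. A configuration is
  the set of its open midpoints.\<close>

section \<open>Walks and their separating potentials\<close>

text \<open>The n by (n-1) rectangle is self-dual, so f has mean 0 and variance 1; then h also has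
  mean 0, which removes the empty Walsh coefficient, and the clue equals E[f h]. Every translate of
  f is paired with every translate of h, so that the sum of all products factors into two sums and
  the one over f can be bounded trivially. Only disappearances of the crossing are counted:
  translates are equally likely to be crossed, so appearances have the same probability. The
  translates in the count share a rectangle about two thirds as wide as the original. A crossing of
  it fails with probability bounded below as soon as its dual can be crossed the long way, so an
  aspect ratio of about 3/2 is all that is asked of Russo-Seymour-Welsh. Planarity is handled
  without simple paths or the Jordan curve theorem. Walks may intersect themselves, since their
  potential is only a parity; existence of a crossing or a dual crossing is a parity count over
  rows; and an explored dual cluster takes the place of an extremal crossing.\<close>

type_synonym site = "int \<times> int"

definition adj :: "site \<Rightarrow> site \<Rightarrow> bool" where
  "adj u v \<longleftrightarrow> fst u = fst v \<and> \<bar>snd u - snd v\<bar> = 2 \<or> snd u = snd v \<and> \<bar>fst u - fst v\<bar> = 2"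

definition mid :: "site \<Rightarrow> site \<Rightarrow> site" where
  "mid u v = ((fst u + fst v) div 2, (snd u + snd v) div 2)"

definition conn :: "site set \<Rightarrow> site set \<Rightarrow> site \<Rightarrow> site \<Rightarrow> bool" where
  "conn V \<omega> = (\<lambda>u v. u \<in> V \<and> v \<in> V \<and> adj u v \<and> mid u v \<in> \<omega>)\<^sup>*\<^sup>*"

text \<open>The index matters only modulo 2: even \<open>i\<close> gives the vertices, odd
  \<open>i\<close> the faces. Keeping it as a parameter proves each fact for the lattice and its
  dual at once.\<close>

definition cls :: "int \<Rightarrow> site set" where
  "cls i = {(x, y). even (x + i) \<and> even (y + i)}"

lemma mem_cls: "u \<in> cls i \<longleftrightarrow> even (fst u + i) \<and> even (snd u + i)"
  by (cases u) (simp add: cls_def)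

lemma adj_sym: "adj u v \<longleftrightarrow> adj v u"
  by (auto simp: adj_def)

lemma mid_sym: "mid u v = mid v u"
  by (simp add: mid_def add.commute)

lemma conn_refl [simp]: "conn V \<omega> u u"
  by (simp add: conn_def)

lemma conn_trans: "conn V \<omega> u v \<Longrightarrow> conn V \<omega> v w \<Longrightarrow> conn V \<omega> u w"
  by (simp add: conn_def)

lemma conn_step: "u \<in> V \<Longrightarrow> v \<in> V \<Longrightarrow> adj u v \<Longrightarrow> mid u v \<in> \<omega> \<Longrightarrow> conn V \<omega> u v"
  by (auto simp: conn_def)

lemma conn_sym: "conn V \<omega> u v \<Longrightarrow> conn V \<omega> v u"
  unfolding conn_def
  by (rule sympD [OF symp_rtranclp]) (auto simp: symp_def adj_sym mid_sym)

lemma conn_mono: "conn V \<omega> u v \<Longrightarrow> V \<subseteq> V' \<Longrightarrow> \<omega> \<subseteq> \<omega>' \<Longrightarrow> conn V' \<omega>' u v"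
  unfolding conn_def by (erule rtranclp_mono [THEN predicate2D, rotated]) auto

lemma conn_in: "conn V \<omega> u v \<Longrightarrow> u \<in> V \<Longrightarrow> v \<in> V"
  unfolding conn_def by (induction rule: rtranclp_induct) auto

lemma conn_induct [consumes 1, case_names refl step]:
  assumes "conn V \<omega> u v" "P u"
    and "\<And>v w. conn V \<omega> u v \<Longrightarrow> v \<in> V \<Longrightarrow> w \<in> V \<Longrightarrow> adj v w \<Longrightarrow> mid v w \<in> \<omega> \<Longrightarrow> P v \<Longrightarrow> P w"
  shows "P v"
  using assms(1) unfolding conn_def
  by (induction rule: rtranclp_induct) (use assms(2,3) in \<open>auto simp: conn_def\<close>)

text \<open>A walk never leaves the cluster of its start. This allows a walk to be replaced by that
  cluster and its open edges, so that walks with no common vertex become disjoint sets.\<close>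

lemma conn_edges:
  assumes "conn V \<omega> u v"
  shows "conn {w. conn V \<omega> u w} (\<omega> \<inter> {mid a b | a b. a \<in> V \<and> b \<in> V \<and> adj a b \<and> conn V \<omega> u a \<and>
      conn V \<omega> u b}) u v"
  using assms
proof (induction rule: conn_induct)
  case (step v w)
  have "conn V \<omega> u w" using step(1-5) by (meson conn_trans conn_step)
  then show ?case
    using step by (intro conn_trans [OF step(6) conn_step]) blast+
qed auto

lemma adj_cases:
  assumes "adj u v"
  obtains "v = (fst u, snd u + 2)" "mid u v = (fst u, snd u + 1)"
    | "v = (fst u, snd u - 2)" "mid u v = (fst u, snd u - 1)"
    | "v = (fst u + 2, snd u)" "mid u v = (fst u + 1, snd u)"
    | "v = (fst u - 2, snd u)" "mid u v = (fst u - 1, snd u)"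
proof -
  have "v = (fst u, snd u + 2) \<or> v = (fst u, snd u - 2) \<or> v = (fst u + 2, snd u) \<or>
      v = (fst u - 2, snd u)"
    using assms by (cases u; cases v) (auto simp: adj_def)
  then show thesis using that by (elim disjE) (auto simp: mid_def)
qed

text \<open>The potential of a walk from \<open>s\<close> to \<open>t\<close> at a face is the parity of the number of
  its vertical edges on the horizontal ray going left from the face.\<close>

lemma conn_potential:
  assumes "conn V \<omega> s t" "V \<subseteq> cls i" "s \<in> V"
  shows "\<exists>C \<psi>. C \<subseteq> \<omega> \<and> (\<forall>e\<in>C. \<exists>u\<in>V. \<exists>v\<in>V. adj u v \<and> mid u v = e) \<and>
    (\<forall>x y. (x, y) \<in> cls (i + 1) \<longrightarrow> (\<psi> (x, y) \<noteq> \<psi> (x + 2, y)) = ((x + 1, y) \<in> C)) \<and>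
    (\<forall>x y. (x, y) \<in> cls (i + 1) \<longrightarrow> (\<psi> (x, y) \<noteq> \<psi> (x, y + 2)) =
       (((x, y + 1) \<in> C) \<noteq> ((snd s = y + 1 \<and> fst s < x) \<noteq> (snd t = y + 1 \<and> fst t < x)))) \<and>
    (\<forall>x y. (\<forall>w\<in>V. x < fst w) \<longrightarrow> \<not> \<psi> (x, y)) \<and>
    (\<forall>x y. (x, y) \<in> cls (i + 1) \<longrightarrow> (\<forall>w\<in>V. fst w < x) \<longrightarrow> \<psi> (x, y) = ((snd s < y) \<noteq> (snd t < y)))"
  using assms(1)
proof (induction rule: conn_induct)
  case refl
  show ?case by (intro exI [of _ "{}"] exI [of _ "\<lambda>_. False"]) auto
next
  case (step v w)
  from step(6) obtain C \<psi> where
    C: "C \<subseteq> \<omega>" "\<forall>e\<in>C. \<exists>u\<in>V. \<exists>v\<in>V. adj u v \<and> mid u v = e" and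
    h: "\<And>x y. (x, y) \<in> cls (i + 1) \<Longrightarrow> (\<psi> (x, y) \<noteq> \<psi> (x + 2, y)) = ((x + 1, y) \<in> C)" and
    ve: "\<And>x y. (x, y) \<in> cls (i + 1) \<Longrightarrow> (\<psi> (x, y) \<noteq> \<psi> (x, y + 2)) =
       (((x, y + 1) \<in> C) \<noteq> ((snd s = y + 1 \<and> fst s < x) \<noteq> (snd v = y + 1 \<and> fst v < x)))" and
    l: "\<And>x y. (\<forall>w\<in>V. x < fst w) \<Longrightarrow> \<not> \<psi> (x, y)" and
    r: "\<And>x y. (x, y) \<in> cls (i + 1) \<Longrightarrow> (\<forall>w\<in>V. fst w < x) \<Longrightarrow> \<psi> (x, y) = ((snd s < y) \<noteq> (snd v < y))"
    by blast
  have vc: "even (fst v + i)" "even (snd v + i)"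
    using step(2) assms(2) by (auto simp: cls_def)
  define e where "e = mid v w"
  \<comment> \<open>Walking an edge a second time cancels it: \<open>C'\<close> consists of the
    edges walked an odd number of times.\<close>
  define C' where "C' = (if e \<in> C then C - {e} else insert e C)"
  have C': "x \<in> C' \<longleftrightarrow> ((x \<in> C) \<noteq> (x = e))" for x by (auto simp: C'_def)
  have sub: "C' \<subseteq> \<omega>" "\<forall>e\<in>C'. \<exists>u\<in>V. \<exists>v\<in>V. adj u v \<and> mid u v = e"
    using C step(2-5) by (auto simp: C'_def e_def split: if_splits)
  \<comment> \<open>A vertical step flips the faces to its right in its row. The ray to the right of
    the end point, which is the exception in the rule for vertically adjacent faces, moves from
    \<open>v\<close> to \<open>w\<close>.\<close>
  define \<psi>' where "\<psi>' = (\<lambda>f. \<psi> f \<noteq> (fst v = fst w \<and> snd f = snd e \<and> fst v < fst f))"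
  have par: "snd e \<noteq> y" if "fst v \<noteq> fst w" "(x, y) \<in> cls (i + 1)" for x y
    using step(4) that vc by (elim adj_cases) (auto simp: cls_def e_def)
  show ?case
  proof (intro exI [of _ C'] exI [of _ \<psi>'] conjI sub allI impI)
    fix x y assume xy: "(x, y) \<in> cls (i + 1)"
    have p: "odd (x + i)" "odd (y + i)" using xy by (auto simp: cls_def)
    show "(\<psi>' (x, y) \<noteq> \<psi>' (x + 2, y)) = ((x + 1, y) \<in> C')"
      by (insert h [OF xy] p vc, rule adj_cases [OF step(4)]; simp add: C' \<psi>'_def e_def;
          smt (verit) even_add even_diff odd_one dvd_refl)
    show "(\<psi>' (x, y) \<noteq> \<psi>' (x, y + 2)) =
       (((x, y + 1) \<in> C') \<noteq> ((snd s = y + 1 \<and> fst s < x) \<noteq> (snd w = y + 1 \<and> fst w < x)))"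
      by (insert ve [OF xy] p vc, rule adj_cases [OF step(4)]; simp add: C' \<psi>'_def e_def;
          smt (verit) even_add even_diff odd_one dvd_refl)
    assume a: "\<forall>w\<in>V. fst w < x"
    have q: "fst v < x" "fst w < x" using a step(2,3) by auto
    show "\<psi>' (x, y) = ((snd s < y) \<noteq> (snd w < y))"
      by (insert r [OF xy a] p vc q, rule adj_cases [OF step(4)]; simp add: \<psi>'_def e_def;
          smt (verit) even_add even_diff odd_one dvd_refl)
  next
    fix x y assume a: "\<forall>w\<in>V. x < fst w"
    then have "x < fst v" using step(2) by blast
    then show "\<not> \<psi>' (x, y)" using l [OF a] by (auto simp: \<psi>'_def)
  qed
qed


section \<open>Separation by walks, and crossings that must meet\<close>

text \<open>The potential also jumps across the horizontal rays to the right of the two end points.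
  Strictly between the rows of \<open>s\<close> and \<open>t\<close> these rays are never met, and
  the potential jumps exactly across the walk.\<close>

definition band :: "site \<Rightarrow> site \<Rightarrow> site set" where
  "band s t = {f. snd s < snd f \<and> snd f < snd t}"

lemma cls_adj: "u \<in> cls i \<Longrightarrow> adj u v \<Longrightarrow> v \<in> cls i"
  by (elim adj_cases) (auto simp: cls_def)

lemma mid_eq_cases:
  assumes "adj u v" "u \<in> cls i" "x \<in> cls i" "mid u v = (fst x + a, snd x + b)" "\<bar>a\<bar> + \<bar>b\<bar> = 1"
  shows "u = x \<or> v = x"
proof -
  have "even (fst u + i)" "even (snd u + i)" "even (fst x + i)" "even (snd x + i)"
    using assms(2,3) by (auto simp: cls_def)
  then show ?thesis
    using assms(4,5)
    by (insert assms(1), cases x, cases u, elim adj_cases; simp;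
        smt (verit) even_add even_diff odd_one dvd_refl)
qed

text \<open>Inside the band the potential changes only across edges of the walk. A vertex off the
  walk therefore sees one value at its four surrounding faces, which carries the potential over from
  faces to vertices; the last two conclusions say that it tells left from right.\<close>

lemma walk_separation:
  assumes "conn V \<omega> s t" "V \<subseteq> cls i" "s \<in> V" "snd s < snd t"
  obtains \<psi> where
    "\<And>f g. f \<in> cls (i + 1) \<Longrightarrow> f \<in> band s t \<Longrightarrow> g \<in> band s t \<Longrightarrow> adj f g \<Longrightarrow>
       mid f g \<notin> \<omega> \<or> (\<forall>u\<in>V. \<forall>v\<in>V. adj u v \<longrightarrow> mid u v \<noteq> mid f g) \<Longrightarrow> \<psi> f = \<psi> g"
    "\<And>x a b. x \<in> cls i \<Longrightarrow> x \<notin> V \<Longrightarrow> x \<in> band s t \<Longrightarrow> \<bar>a\<bar> = 1 \<Longrightarrow> \<bar>b\<bar> = 1 \<Longrightarrow>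
       \<psi> (fst x + a, snd x + b) = \<psi> (fst x + 1, snd x + 1)"
    "\<And>W \<omega>' x y. conn W \<omega>' x y \<Longrightarrow> W \<subseteq> (cls i - V) \<inter> band s t \<Longrightarrow>
       \<psi> (fst x + 1, snd x + 1) = \<psi> (fst y + 1, snd y + 1)"
    "\<And>f. (\<forall>w\<in>V. fst f < fst w) \<Longrightarrow> \<not> \<psi> f"
    "\<And>f. f \<in> cls (i + 1) \<Longrightarrow> f \<in> band s t \<Longrightarrow> (\<forall>w\<in>V. fst w < fst f) \<Longrightarrow> \<psi> f"
proof -
  obtain C \<psi> where C: "C \<subseteq> \<omega>" "\<forall>e\<in>C. \<exists>u\<in>V. \<exists>v\<in>V. adj u v \<and> mid u v = e" and
    h: "\<And>x y. (x, y) \<in> cls (i + 1) \<Longrightarrow> (\<psi> (x, y) \<noteq> \<psi> (x + 2, y)) = ((x + 1, y) \<in> C)" and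
    ve: "\<And>x y. (x, y) \<in> cls (i + 1) \<Longrightarrow> (\<psi> (x, y) \<noteq> \<psi> (x, y + 2)) =
       (((x, y + 1) \<in> C) \<noteq> ((snd s = y + 1 \<and> fst s < x) \<noteq> (snd t = y + 1 \<and> fst t < x)))" and
    l: "\<And>x y. (\<forall>w\<in>V. x < fst w) \<Longrightarrow> \<not> \<psi> (x, y)" and
    r: "\<And>x y. (x, y) \<in> cls (i + 1) \<Longrightarrow> (\<forall>w\<in>V. fst w < x) \<Longrightarrow> \<psi> (x, y) = ((snd s < y) \<noteq> (snd t < y))"
    using conn_potential [OF assms(1-3)] by blast
  have 1: "\<psi> f = \<psi> g" if fg: "f \<in> cls (i + 1)" "f \<in> band s t" "g \<in> band s t" "adj f g"
    and ne: "mid f g \<notin> \<omega> \<or> (\<forall>u\<in>V. \<forall>v\<in>V. adj u v \<longrightarrow> mid u v \<noteq> mid f g)" for f g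
  proof -
    have nC: "mid f g \<notin> C" using ne C by blast
    have g: "g \<in> cls (i + 1)" using fg(1,4) by (rule cls_adj)
    show ?thesis
      using fg(4)
    proof (cases rule: adj_cases)
      case 1
      then show ?thesis using ve [of "fst f" "snd f"] nC fg(1-3) by (auto simp: band_def)
    next
      case 2
      then show ?thesis using ve [of "fst g" "snd g"] nC fg(1-3) g by (auto simp: band_def)
    next
      case 3
      then show ?thesis using h [of "fst f" "snd f"] nC fg(1) by auto
    next
      case 4
      then show ?thesis using h [of "fst g" "snd g"] nC g by auto
    qed
  qed
  have s: "even (fst s + i)" "even (snd s + i)" "even (fst t + i)" "even (snd t + i)"
    using assms(2,3) conn_in [OF assms(1,3)] by (auto simp: cls_def)
  \<comment> \<open>The rows of \<open>x\<close>, \<open>s\<close> and \<open>t\<close> have the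
    same parity, so strict inequalities are gaps of at least 2 and the corner faces stay in the
    band.\<close>
  have corner: "(fst x + a, snd x + b) \<in> cls (i + 1) \<inter> band s t"
    if "x \<in> cls i" "x \<in> band s t" "\<bar>a\<bar> = 1" "\<bar>b\<bar> = 1" for x a b
  proof -
    have ab: "a = 1 \<or> a = -1" "b = 1 \<or> b = -1" using that(3,4) by linarith+
    have x: "even (fst x + i)" "even (snd x + i)" using that(1) by (auto simp: cls_def)
    have "snd s + 2 \<le> snd x" "snd x + 2 \<le> snd t"
      using that(2) x(2) s(2,4) unfolding band_def mem_Collect_eq by presburger+
    moreover have "even (fst x + a + (i + 1))" "even (snd x + b + (i + 1))"
      using ab x by auto
    ultimately show ?thesis
      using ab by (auto simp: cls_def band_def)
  qed
  have noinc: "\<forall>u\<in>V. \<forall>v\<in>V. adj u v \<longrightarrow> mid u v \<noteq> (fst x + a, snd x + b)"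
    if "x \<in> cls i" "x \<notin> V" "\<bar>a\<bar> + \<bar>b\<bar> = 1" for x a b
  proof (intro ballI impI notI)
    fix u v assume "u \<in> V" "v \<in> V" "adj u v" "mid u v = (fst x + a, snd x + b)"
    then have "u = x \<or> v = x" using mid_eq_cases [of u v i x a b] that assms(2) by blast
    with \<open>u \<in> V\<close> \<open>v \<in> V\<close> that(2) show False by blast
  qed
  have 2: "\<psi> (fst x + a, snd x + b) = \<psi> (fst x + 1, snd x + 1)"
    if x: "x \<in> cls i" "x \<notin> V" "x \<in> band s t" and ab: "\<bar>a\<bar> = 1" "\<bar>b\<bar> = 1" for x a b
  proof -
    have A: "\<psi> (fst x - 1, snd x + b) = \<psi> (fst x + 1, snd x + b)" if "\<bar>b\<bar> = 1" for b
    proof (rule 1)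
      show "(fst x - 1, snd x + b) \<in> cls (i + 1)" "(fst x - 1, snd x + b) \<in> band s t"
        using corner [of x "-1" b] x that by auto
      show "(fst x + 1, snd x + b) \<in> band s t"
        using corner [of x "1" b] x that by auto
      show "adj (fst x - 1, snd x + b) (fst x + 1, snd x + b)" by (simp add: adj_def)
      have "mid (fst x - 1, snd x + b) (fst x + 1, snd x + b) = (fst x + 0, snd x + b)"
        by (simp add: mid_def)
      then show "mid (fst x - 1, snd x + b) (fst x + 1, snd x + b) \<notin> \<omega> \<or>
        (\<forall>u\<in>V. \<forall>v\<in>V. adj u v \<longrightarrow> mid u v \<noteq> mid (fst x - 1, snd x + b) (fst x + 1, snd x + b))"
        using noinc [of x 0 b] x that by simp
    qed
    have B: "\<psi> (fst x + 1, snd x - 1) = \<psi> (fst x + 1, snd x + 1)"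
    proof (rule 1)
      show "(fst x + 1, snd x - 1) \<in> cls (i + 1)" "(fst x + 1, snd x - 1) \<in> band s t"
        using corner [of x "1" "-1"] x by auto
      show "(fst x + 1, snd x + 1) \<in> band s t"
        using corner [of x "1" 1] x by auto
      show "adj (fst x + 1, snd x - 1) (fst x + 1, snd x + 1)" by (simp add: adj_def)
      have "mid (fst x + 1, snd x - 1) (fst x + 1, snd x + 1) = (fst x + 1, snd x + 0)"
        by (simp add: mid_def)
      then show "mid (fst x + 1, snd x - 1) (fst x + 1, snd x + 1) \<notin> \<omega> \<or>
        (\<forall>u\<in>V. \<forall>v\<in>V. adj u v \<longrightarrow> mid u v \<noteq> mid (fst x + 1, snd x - 1) (fst x + 1, snd x + 1))"
        using noinc [of x 1 0] x by simp
    qed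
    have "a = 1 \<or> a = -1" "b = 1 \<or> b = -1" using ab by linarith+
    then show ?thesis using A [of 1] A [of "-1"] B by auto
  qed
  have 3: "\<psi> (fst x + 1, snd x + 1) = \<psi> (fst y + 1, snd y + 1)"
    if "conn W \<omega>' x y" "W \<subseteq> (cls i - V) \<inter> band s t" for W \<omega>' x y
    using that(1)
  proof (induction rule: conn_induct)
    case (step v w)
    have v: "v \<in> cls i" "v \<notin> V" "v \<in> band s t" and w: "w \<in> cls i" "w \<notin> V" "w \<in> band s t"
      using step(2,3) that(2) by auto
    have "\<psi> (fst v + 1, snd v + 1) = \<psi> (fst w + 1, snd w + 1)"
      using step(4) 2 [OF v, of "-1" 1] 2 [OF w, of "-1" 1] 2 [OF v, of 1 "-1"] 2 [OF w, of 1 "-1"]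
      by (elim adj_cases) (simp_all add: algebra_simps)
    then show ?case using step(6) by simp
  qed simp
  show thesis
  proof (rule that [of \<psi>])
    show "\<not> \<psi> f" if "\<forall>w\<in>V. fst f < fst w" for f
      using l [of "fst f" "snd f"] that by simp
    show "\<psi> f" if "f \<in> cls (i + 1)" "f \<in> band s t" "\<forall>w\<in>V. fst w < fst f" for f
      using r [of "fst f" "snd f"] that by (simp add: band_def)
  qed (fact 1 2 3)+
qed

text \<open>The potential of the open walk is constant along a walk of faces through closed edges,
  but it is false to the left of \<open>V\<close> and true to the right.\<close>

lemma no_dual_crossing:
  assumes "conn V \<omega> s t" "V \<subseteq> cls i" "s \<in> V" "snd s < snd t"
    and "conn W (- \<omega>) f g" "W \<subseteq> cls (i + 1) \<inter> band s t" "f \<in> W"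
    and "\<And>w. w \<in> V \<Longrightarrow> fst f < fst w" "\<And>w. w \<in> V \<Longrightarrow> fst w < fst g"
  shows False
proof (rule walk_separation [OF assms(1-4)])
  fix \<psi>
  assume 1: "\<And>f g. f \<in> cls (i + 1) \<Longrightarrow> f \<in> band s t \<Longrightarrow> g \<in> band s t \<Longrightarrow> adj f g \<Longrightarrow>
       mid f g \<notin> \<omega> \<or> (\<forall>u\<in>V. \<forall>v\<in>V. adj u v \<longrightarrow> mid u v \<noteq> mid f g) \<Longrightarrow> \<psi> f = \<psi> g"
    and l: "\<And>f. (\<forall>w\<in>V. fst f < fst w) \<Longrightarrow> \<not> \<psi> f"
    and r: "\<And>f. f \<in> cls (i + 1) \<Longrightarrow> f \<in> band s t \<Longrightarrow> (\<forall>w\<in>V. fst w < fst f) \<Longrightarrow> \<psi> f"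
  have "\<psi> f = \<psi> g"
    using assms(5)
  proof (induction rule: conn_induct)
    case (step v w)
    have "\<psi> v = \<psi> w" by (rule 1) (use step assms(6) in auto)
    with step(6) show ?case by simp
  qed simp
  moreover have "g \<in> W" using assms(5,7) by (rule conn_in)
  ultimately show False using l [of f] r [of g] assms(6-9) by blast
qed

text \<open>If the clusters of \<open>s\<close> and \<open>x\<close> were disjoint, the potential of
  the first, read off at vertices, would be constant along the second, although that one leads from
  the left of the first to its right.\<close>

lemma crossings_meet:
  assumes "conn V \<omega> s t" "V \<subseteq> cls i" "s \<in> V" "snd s \<le> snd t"
    and "conn W \<omega>' x y" "W \<subseteq> cls i" "x \<in> W"
    and "\<And>w. w \<in> W \<Longrightarrow> snd s \<le> snd w \<and> snd w \<le> snd t"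
    and "\<And>w. w \<in> V \<Longrightarrow> fst x \<le> fst w" "\<And>w. w \<in> V \<Longrightarrow> fst w \<le> fst y"
  shows "\<exists>w. conn V \<omega> s w \<and> conn W \<omega>' x w"
proof (rule ccontr)
  assume no: "\<nexists>w. conn V \<omega> s w \<and> conn W \<omega>' x w"
  define V0 where "V0 = {w. conn V \<omega> s w}"
  define W0 where "W0 = {w. conn W \<omega>' x w}"
  have V0: "V0 \<subseteq> V" "s \<in> V0" "t \<in> V0"
    using conn_in [OF _ assms(3)] assms(1) by (auto simp: V0_def)
  have W0: "W0 \<subseteq> W" "x \<in> W0" "y \<in> W0"
    using conn_in [OF _ assms(7)] assms(5) by (auto simp: W0_def)
  \<comment> \<open>One extra step beyond each end brings the rows of \<open>s\<close> and
    \<open>t\<close> themselves into the open band.\<close>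
  define s' where "s' = (fst s, snd s - 2)"
  define t' where "t' = (fst t, snd t + 2)"
  define V1 where "V1 = insert s' (insert t' V0)"
  have "conn V0 UNIV s t"
    using conn_edges [OF assms(1)] by (rule conn_mono) (auto simp: V0_def)
  then have "conn V1 UNIV s t" by (rule conn_mono) (auto simp: V1_def)
  moreover have "conn V1 UNIV s' s"
    by (rule conn_step) (use V0 in \<open>auto simp: V1_def s'_def adj_def\<close>)
  moreover have "conn V1 UNIV t t'"
    by (rule conn_step) (use V0 in \<open>auto simp: V1_def t'_def adj_def\<close>)
  ultimately have c: "conn V1 UNIV s' t'" by (meson conn_trans)
  have "s \<in> cls i" "t \<in> cls i" using V0 assms(2) by auto
  then have V1: "V1 \<subseteq> cls i" "s' \<in> V1" "snd s' < snd t'"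
    using V0 assms(2,4) by (auto simp: V1_def s'_def t'_def cls_def)
  have dj: "W0 \<subseteq> (cls i - V1) \<inter> band s' t'"
  proof
    fix w assume w: "w \<in> W0"
    then have "w \<in> W" "w \<notin> V0" using no W0(1) unfolding V0_def W0_def by blast+
    then show "w \<in> (cls i - V1) \<inter> band s' t'"
      using assms(6) assms(8) [of w] by (auto simp: V1_def s'_def t'_def band_def)
  qed
  show False
  proof (rule walk_separation [OF c V1])
    fix \<psi>
    assume 2: "\<And>x a b. x \<in> cls i \<Longrightarrow> x \<notin> V1 \<Longrightarrow> x \<in> band s' t' \<Longrightarrow> \<bar>a\<bar> = 1 \<Longrightarrow> \<bar>b\<bar> = 1 \<Longrightarrow>
         \<psi> (fst x + a, snd x + b) = \<psi> (fst x + 1, snd x + 1)"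
      and 3: "\<And>W \<omega>' x y. conn W \<omega>' x y \<Longrightarrow> W \<subseteq> (cls i - V1) \<inter> band s' t' \<Longrightarrow>
         \<psi> (fst x + 1, snd x + 1) = \<psi> (fst y + 1, snd y + 1)"
      and l: "\<And>f. (\<forall>w\<in>V1. fst f < fst w) \<Longrightarrow> \<not> \<psi> f"
      and r: "\<And>f. f \<in> cls (i + 1) \<Longrightarrow> f \<in> band s' t' \<Longrightarrow> (\<forall>w\<in>V1. fst w < fst f) \<Longrightarrow> \<psi> f"
    have "conn W0 UNIV x y"
      using conn_edges [OF assms(5)] by (rule conn_mono) (auto simp: W0_def)
    then have e: "\<psi> (fst x + 1, snd x + 1) = \<psi> (fst y + 1, snd y + 1)"
      using dj by (rule 3)
    have b: "fst x \<le> fst w" "fst w \<le> fst y" if "w \<in> V1" for w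
    proof -
      have "\<exists>w'\<in>V. fst w = fst w'" using that V0 unfolding V1_def s'_def t'_def by auto
      then show "fst x \<le> fst w" "fst w \<le> fst y" using assms(9,10) by auto
    qed
    have x: "x \<in> cls i" "x \<notin> V1" "x \<in> band s' t'" and y: "y \<in> cls i" "y \<notin> V1" "y \<in> band s' t'"
      using dj W0 by auto
    have "\<not> \<psi> (fst x - 1, snd x + 1)"
      by (rule l) (use b in force)
    then have "\<not> \<psi> (fst x + 1, snd x + 1)" using 2 [OF x, of "-1" 1] by simp
    moreover have "\<psi> (fst y + 1, snd y + 1)"
    proof (rule r)
      have "snd y \<le> snd t" using assms(8) [of y] W0 by blast
      then show "(fst y + 1, snd y + 1) \<in> band s' t'" using y by (auto simp: band_def t'_def)
    qed (use b y in \<open>force simp: cls_def\<close>)+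
    ultimately show False using e by simp
  qed
qed

section \<open>Crossings of rectangles and planar duality\<close>

primrec xor_upto :: "(nat \<Rightarrow> bool) \<Rightarrow> nat \<Rightarrow> bool" where
  "xor_upto p 0 = False"
| "xor_upto p (Suc k) = (xor_upto p k \<noteq> p k)"

lemma xor_upto_cong: "(\<And>x. x < k \<Longrightarrow> p x = q x) \<Longrightarrow> xor_upto p k = xor_upto q k"
  by (induction k) auto

lemma xor_upto_telescope:
  fixes l :: "nat \<Rightarrow> bool"
  shows "xor_upto (\<lambda>x. l x \<noteq> l (Suc x)) k \<longleftrightarrow> l 0 \<noteq> l k"
  by (induction k) auto

text \<open>Consider the parity of the places in a row where \<open>l\<close> changes next to a face
  with \<open>b\<close>. By \<open>hor\<close> it does not matter whether the face below or above is
  used, and by \<open>ver\<close> the parity is passed on to the next row. It is odd at the bottom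
  and even at the top. Here \<open>l\<close> colours vertices and \<open>b\<close> faces, as in the
  game of Hex.\<close>

lemma colour_boundaries_cross:
  fixes l b :: "nat \<Rightarrow> nat \<Rightarrow> bool"
  assumes left: "\<And>y. y \<le> h \<Longrightarrow> l 0 y" and right: "\<And>y. y \<le> h \<Longrightarrow> \<not> l w y"
    and bottom: "\<And>x. x < w \<Longrightarrow> b x 0" and top: "\<And>x. x < w \<Longrightarrow> \<not> b x (Suc h)"
    and hor: "\<And>x y. x < w \<Longrightarrow> y \<le> h \<Longrightarrow> l x y \<noteq> l (Suc x) y \<Longrightarrow> b x y = b x (Suc y)"
    and ver: "\<And>x y. Suc x < w \<Longrightarrow> y < h \<Longrightarrow> l (Suc x) y \<noteq> l (Suc x) (Suc y) \<Longrightarrow>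
        b x (Suc y) = b (Suc x) (Suc y)"
  shows False
proof -
  define Q where "Q y = xor_upto (\<lambda>x. b x y \<and> l x y \<noteq> l (Suc x) y) w" for y
  have alt: "Q y = xor_upto (\<lambda>x. b x (Suc y) \<and> l x y \<noteq> l (Suc x) y) w" if "y \<le> h" for y
    unfolding Q_def by (rule xor_upto_cong) (use hor that in auto)
  have "Q y" if "y \<le> h" for y
    using that
  proof (induction y)
    case 0
    have "Q 0 = xor_upto (\<lambda>x. l x 0 \<noteq> l (Suc x) 0) w"
      unfolding Q_def by (rule xor_upto_cong) (use bottom in auto)
    then show ?case using left [of 0] right [of 0] xor_upto_telescope [of "\<lambda>x. l x 0" w] by simp
  next
    case (Suc y)
    \<comment> \<open>Up to column \<open>k\<close> the two rows differ by one boundary term at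
      column \<open>k\<close>; at \<open>k = w\<close> it vanishes because \<open>l\<close> is false
      on the whole right side.\<close>
    have "(xor_upto (\<lambda>x. b x (Suc y) \<and> l x y \<noteq> l (Suc x) y) k \<noteq>
        xor_upto (\<lambda>x. b x (Suc y) \<and> l x (Suc y) \<noteq> l (Suc x) (Suc y)) k) =
        (k > 0 \<and> b (k - 1) (Suc y) \<and> l k y \<noteq> l k (Suc y))" if "k \<le> w" for k
      using that
    proof (induction k)
      case (Suc k)
      show ?case
      proof (cases k)
        case 0
        then show ?thesis using left [of y] left [of "Suc y"] \<open>Suc y \<le> h\<close> by auto
      next
        case (Suc j)
        then show ?thesis
          using Suc.IH Suc.prems ver [of j y] \<open>Suc y \<le> h\<close> by auto
      qed
    qed simp
    from this [of w] have "Q y = Q (Suc y)"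
      using alt [of y] Suc.prems right [of y] right [of "Suc y"] by (auto simp: Q_def)
    then show ?case using Suc by simp
  qed
  moreover have "\<not> xor_upto (\<lambda>x. b x (Suc h) \<and> l x h \<noteq> l (Suc x) h) k" if "k \<le> w" for k
    using that by (induction k) (use top in auto)
  ultimately show False using alt [of h] by blast
qed

definition rect :: "int \<Rightarrow> int \<Rightarrow> int \<Rightarrow> int \<Rightarrow> int \<Rightarrow> site set" where
  "rect i a b c d = {(x, y). (x, y) \<in> cls i \<and> a \<le> x \<and> x \<le> b \<and> c \<le> y \<and> y \<le> d}"

definition hcross :: "int \<Rightarrow> int \<Rightarrow> int \<Rightarrow> int \<Rightarrow> int \<Rightarrow> site set \<Rightarrow> bool" where
  "hcross i a b c d \<omega> \<longleftrightarrow> (\<exists>u\<in>rect i a b c d. \<exists>v. fst u = a \<and> fst v = b \<and> conn (rect i a b c d) \<omega> u v)"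

definition vcross :: "int \<Rightarrow> int \<Rightarrow> int \<Rightarrow> int \<Rightarrow> int \<Rightarrow> site set \<Rightarrow> bool" where
  "vcross i a b c d \<omega> \<longleftrightarrow> (\<exists>u\<in>rect i a b c d. \<exists>v. snd u = c \<and> snd v = d \<and> conn (rect i a b c d) \<omega> u v)"

lemma rect_cls: "rect i a b c d \<subseteq> cls i"
  by (auto simp: rect_def)

lemma mem_rect: "u \<in> rect i a b c d \<longleftrightarrow>
    even (fst u + i) \<and> even (snd u + i) \<and> a \<le> fst u \<and> fst u \<le> b \<and> c \<le> snd u \<and> snd u \<le> d"
  by (cases u) (auto simp: rect_def cls_def)

lemma rect_mono: "a' \<le> a \<Longrightarrow> b \<le> b' \<Longrightarrow> c' \<le> c \<Longrightarrow> d \<le> d' \<Longrightarrow> rect i a b c d \<subseteq> rect i a' b' c' d'"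
  by (auto simp: mem_rect)

lemma hcross_mono: "hcross i a b c d \<omega> \<Longrightarrow> \<omega> \<subseteq> \<omega>' \<Longrightarrow> c' \<le> c \<Longrightarrow> d \<le> d' \<Longrightarrow> hcross i a b c' d' \<omega>'"
  unfolding hcross_def
  using rect_mono [of a a b b c' c d d' i] conn_mono [of "rect i a b c d" \<omega> _ _ "rect i a b c' d'"
      \<omega>'] by (meson order_refl subsetD)

lemma vcross_mono: "vcross i a b c d \<omega> \<Longrightarrow> \<omega> \<subseteq> \<omega>' \<Longrightarrow> a' \<le> a \<Longrightarrow> b \<le> b' \<Longrightarrow> vcross i a' b' c d \<omega>'"
  unfolding vcross_def
  using rect_mono [of a' a b b' c c d d i] conn_mono [of "rect i a b c d" \<omega> _ _ "rect i a' b' c d"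
      \<omega>'] by (meson order_refl subsetD)

text \<open>An edge leaving the cluster of the left side is closed, so the closed dual cluster of
  the bottom continues across it. If neither crossing existed, the two clusters would be colourings
  ruled out by \<open>colour_boundaries_cross\<close>.\<close>

lemma hcross_or_dual:
  assumes par: "even (a + i)" "even (b + i)" "even (c + i)" "even (d + i)" and "a < b" "c \<le> d"
    and no: "\<not> hcross i a b c d \<omega>"
  shows "vcross (i + 1) (a + 1) (b - 1) (c - 1) (d + 1) (- \<omega>)"
proof (rule ccontr)
  assume no': "\<not> vcross (i + 1) (a + 1) (b - 1) (c - 1) (d + 1) (- \<omega>)"
  define R where "R = rect i a b c d"
  define D where "D = rect (i + 1) (a + 1) (b - 1) (c - 1) (d + 1)"
  define L where "L = {v. \<exists>u\<in>R. fst u = a \<and> conn R \<omega> u v}"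
  define B where "B = {v. \<exists>u\<in>D. snd u = c - 1 \<and> conn D (- \<omega>) u v}"
  define w where "w = nat ((b - a) div 2)"
  define h where "h = nat ((d - c) div 2)"
  have w: "b = a + 2 * int w" and h: "d = c + 2 * int h"
    using par \<open>a < b\<close> \<open>c \<le> d\<close> by (auto simp: w_def h_def; presburger)+
  define l where "l x y \<longleftrightarrow> (a + 2 * int x, c + 2 * int y) \<in> L" for x y
  define \<beta> where "\<beta> x y \<longleftrightarrow> (a + 1 + 2 * int x, c - 1 + 2 * int y) \<in> B" for x y
  have inR: "(a + 2 * int x, c + 2 * int y) \<in> R \<longleftrightarrow> x \<le> w \<and> y \<le> h" for x y
    using par by (auto simp: R_def mem_rect w h)
  have inD: "(a + 1 + 2 * int x, c - 1 + 2 * int y) \<in> D \<longleftrightarrow> x < w \<and> y \<le> Suc h" for x y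
    using par by (auto simp: D_def mem_rect w h)
  have L: "mid u v \<notin> \<omega>" if "u \<in> R" "v \<in> R" "adj u v" "(u \<in> L) \<noteq> (v \<in> L)" for u v
    using that conn_step [of u R v \<omega>] conn_step [of v R u \<omega>] conn_trans
    unfolding L_def mem_Collect_eq mid_sym [of v u] adj_sym [of v u] by blast
  have B: "mid u v \<in> \<omega>" if "u \<in> D" "v \<in> D" "adj u v" "(u \<in> B) \<noteq> (v \<in> B)" for u v
    using that conn_step [of u D v "- \<omega>"] conn_step [of v D u "- \<omega>"] conn_trans
    unfolding B_def mem_Collect_eq mid_sym [of v u] adj_sym [of v u] Compl_iff by blast
  show False
  proof (rule colour_boundaries_cross [of h l w \<beta>])
    fix y assume y: "y \<le> h"
    show "l 0 y" using inR [of 0 y] y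
        by (auto simp: l_def L_def intro!: bexI [of _ "(a, c + 2 * int y)"])
    show "\<not> l w y"
      using no unfolding l_def L_def hcross_def R_def [symmetric] by (auto simp: w)
  next
    fix x assume x: "x < w"
    show "\<beta> x 0" using inD [of x 0] x
      by (auto simp: \<beta>_def B_def intro!: bexI [of _ "(a + 1 + 2 * int x, c - 1)"])
    have "snd (a + 1 + 2 * int x, c - 1 + 2 * int (Suc h)) = d + 1" using h by simp
    then show "\<not> \<beta> x (Suc h)"
      using no' unfolding \<beta>_def B_def vcross_def D_def [symmetric] mem_Collect_eq by blast
  next
    fix x y assume xy: "x < w" "y \<le> h" "l x y \<noteq> l (Suc x) y"
    have "mid (a + 2 * int x, c + 2 * int y) (a + 2 * int (Suc x), c + 2 * int y) \<notin> \<omega>"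
      by (rule L) (use xy inR [of x y] inR [of "Suc x" y] in \<open>auto simp: l_def adj_def\<close>)
    then have "(a + 2 * int x + 1, c + 2 * int y) \<notin> \<omega>" by (simp add: mid_def algebra_simps)
    moreover have "mid (a + 1 + 2 * int x, c - 1 + 2 * int y) (a + 1 + 2 * int x,
        c - 1 + 2 * int (Suc y)) =
       (a + 2 * int x + 1, c + 2 * int y)" by (simp add: mid_def)
    ultimately show "\<beta> x y = \<beta> x (Suc y)"
      using B [of "(a + 1 + 2 * int x, c - 1 + 2 * int y)"
          "(a + 1 + 2 * int x, c - 1 + 2 * int (Suc y))"]
        inD [of x y] inD [of x "Suc y"] xy by (auto simp: \<beta>_def adj_def)
  next
    fix x y assume xy: "Suc x < w" "y < h" "l (Suc x) y \<noteq> l (Suc x) (Suc y)"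
    have "mid (a + 2 * int (Suc x), c + 2 * int y) (a + 2 * int (Suc x), c + 2 * int (Suc y)) \<notin> \<omega>"
      by (rule L) (use xy inR [of "Suc x" y] inR [of "Suc x" "Suc y"] in \<open>auto simp: l_def adj_def\<close>)
    then have "(a + 2 * int x + 2, c + 2 * int y + 1) \<notin> \<omega>" by (simp add: mid_def algebra_simps)
    moreover have "mid (a + 1 + 2 * int x, c - 1 + 2 * int (Suc y)) (a + 1 + 2 * int (Suc x),
        c - 1 + 2 * int (Suc y)) =
       (a + 2 * int x + 2, c + 2 * int y + 1)" by (simp add: mid_def)
    ultimately show "\<beta> x (Suc y) = \<beta> (Suc x) (Suc y)"
      using B [of "(a + 1 + 2 * int x, c - 1 + 2 * int (Suc y))"
          "(a + 1 + 2 * int (Suc x), c - 1 + 2 * int (Suc y))"]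
        inD [of x "Suc y"] inD [of "Suc x" "Suc y"] xy by (auto simp: \<beta>_def adj_def)
  qed
qed

section \<open>Symmetries of the lattice and their action on crossings\<close>

definition lattice_sym :: "(site \<Rightarrow> site) \<Rightarrow> bool" where
  "lattice_sym \<pi> \<longleftrightarrow> inj \<pi> \<and> (\<forall>u v. adj u v \<longrightarrow> adj (\<pi> u) (\<pi> v) \<and> mid (\<pi> u) (\<pi> v) = \<pi> (mid u v))"

lemma conn_image:
  assumes "lattice_sym \<pi>" "conn V (\<pi> -` \<omega>) u v"
  shows "conn (\<pi> ` V) \<omega> (\<pi> u) (\<pi> v)"
  using assms(2)
proof (induction rule: conn_induct)
  case (step v w)
  have "adj (\<pi> v) (\<pi> w)" "mid (\<pi> v) (\<pi> w) = \<pi> (mid v w)"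
    using assms(1) step(4) unfolding lattice_sym_def by blast+
  then show ?case
    using step by (intro conn_trans [OF step(6) conn_step]) auto
qed simp

definition shift :: "int \<Rightarrow> int \<Rightarrow> site \<Rightarrow> site" where
  "shift p q u = (fst u + p, snd u + q)"

definition hflip :: "int \<Rightarrow> site \<Rightarrow> site" where
  "hflip m u = (m - fst u, snd u)"

definition vflip :: "int \<Rightarrow> site \<Rightarrow> site" where
  "vflip m u = (fst u, m - snd u)"

lemma lattice_sym_shift: "lattice_sym (shift p q)"
  unfolding lattice_sym_def
  by (auto simp: inj_def shift_def prod_eq_iff elim!: adj_cases) (auto simp: adj_def mid_def)

lemma lattice_sym_hflip: "lattice_sym (hflip m)"
  unfolding lattice_sym_def
  by (auto simp: inj_def hflip_def prod_eq_iff elim!: adj_cases) (auto simp: adj_def mid_def)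

lemma lattice_sym_vflip: "lattice_sym (vflip m)"
  unfolding lattice_sym_def
  by (auto simp: inj_def vflip_def prod_eq_iff elim!: adj_cases) (auto simp: adj_def mid_def)

lemma lattice_sym_swap: "lattice_sym prod.swap"
  unfolding lattice_sym_def by (auto simp: adj_def mid_def)


lemma shift_image_rect:
  assumes "even (i + j + p)" "even (i + j + q)"
  shows "shift p q ` rect i a b c d \<subseteq> rect j (a + p) (b + p) (c + q) (d + q)"
  using assms by (auto simp: mem_rect shift_def)

lemma hcross_shift_imp:
  assumes "even (i + j + p)" "even (i + j + q)" "hcross i a b c d (shift p q -` \<omega>)"
  shows "hcross j (a + p) (b + p) (c + q) (d + q) \<omega>"
proof -
  obtain u v where u: "u \<in> rect i a b c d" "fst u = a" "fst v = b"
      "conn (rect i a b c d) (shift p q -` \<omega>) u v"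
    using assms(3) unfolding hcross_def by blast
  have "conn (rect j (a + p) (b + p) (c + q) (d + q)) \<omega> (shift p q u) (shift p q v)"
    using conn_image [OF lattice_sym_shift u(4)] shift_image_rect [OF assms(1,2)]
    by (rule conn_mono) auto
  moreover have "shift p q u \<in> rect j (a + p) (b + p) (c + q) (d + q)"
    using shift_image_rect [OF assms(1,2)] u(1) by blast
  ultimately show ?thesis
    using u(2,3) unfolding hcross_def
    by (intro bexI [of _ "shift p q u"] exI [of _ "shift p q v"]) (simp_all add: shift_def)
qed

text \<open>A shift by two odd numbers exchanges the lattice with its dual, hence the two classes
  \<open>i\<close> and \<open>j\<close>.\<close>

lemma hcross_shift:
  assumes "even (i + j + p)" "even (i + j + q)"
  shows "hcross i a b c d (shift p q -` \<omega>) \<longleftrightarrow> hcross j (a + p) (b + p) (c + q) (d + q) \<omega>"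
proof
  assume *: "hcross j (a + p) (b + p) (c + q) (d + q) \<omega>"
  have "shift (- p) (- q) -` (shift p q -` \<omega>) = \<omega>"
    by (auto simp: shift_def)
  then have "hcross i (a + p + - p) (b + p + - p) (c + q + - q) (d + q + - q) (shift p q -` \<omega>)"
    using assms * by (intro hcross_shift_imp [of j i "- p" "- q" "a + p" "b + p" "c + q" "d + q"])
      (simp_all add: add.commute)
  then show "hcross i a b c d (shift p q -` \<omega>)" by simp
qed (use assms hcross_shift_imp in blast)

lemma swap_image_rect: "prod.swap ` rect i a b c d = rect i c d a b"
proof -
  have "x \<in> prod.swap ` rect i a b c d" if "x \<in> rect i c d a b" for x
    using that by (intro image_eqI [of _ _ "prod.swap x"]) (auto simp: mem_rect)
  then show ?thesis by (auto simp: mem_rect)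
qed

lemma hcross_swap: "hcross i a b c d (prod.swap -` \<omega>) \<longleftrightarrow> vcross i c d a b \<omega>"
proof
  assume "hcross i a b c d (prod.swap -` \<omega>)"
  then obtain u v where "u \<in> rect i a b c d" "fst u = a" "fst v = b"
      "conn (rect i a b c d) (prod.swap -` \<omega>) u v"
    unfolding hcross_def by blast
  then show "vcross i c d a b \<omega>"
    using conn_image [OF lattice_sym_swap, of "rect i a b c d" \<omega> u v] unfolding vcross_def
    by (intro bexI [of _ "prod.swap u"] exI [of _ "prod.swap v"]) (auto simp: swap_image_rect mem_rect)
next
  assume "vcross i c d a b \<omega>"
  then obtain u v where "u \<in> rect i c d a b" "snd u = a" "snd v = b" "conn (rect i c d a b) \<omega> u v"
    unfolding vcross_def by blast
  moreover have "prod.swap -` (prod.swap -` \<omega>) = \<omega>" by auto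
  ultimately show "hcross i a b c d (prod.swap -` \<omega>)"
    using conn_image [OF lattice_sym_swap, of "rect i c d a b" "prod.swap -` \<omega>" u v] unfolding hcross_def
    by (intro bexI [of _ "prod.swap u"] exI [of _ "prod.swap v"]) (auto simp: swap_image_rect mem_rect)
qed

section \<open>Exact duality and its consequences\<close>

lemma not_hcross_and_dual:
  assumes "c \<le> d" "a \<le> b" "vcross i (a + 1) (b - 1) (c - 1) (d + 1) (- \<omega>)"
  shows "\<not> hcross (i + 1) a b c d \<omega>"
proof
  assume "hcross (i + 1) a b c d \<omega>"
  then obtain u v where u: "u \<in> rect (i + 1) a b c d" "fst u = a" "fst v = b"
      "conn (rect (i + 1) a b c d) (- (- \<omega>)) u v"
    unfolding hcross_def by auto
  obtain s t where s: "s \<in> rect i (a + 1) (b - 1) (c - 1) (d + 1)" "snd s = c - 1" "snd t = d + 1"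
      "conn (rect i (a + 1) (b - 1) (c - 1) (d + 1)) (- \<omega>) s t"
    using assms(3) unfolding vcross_def by blast
  show False
    by (rule no_dual_crossing [OF s(4) rect_cls s(1) _ u(4) _ u(1)])
      (use s u assms in \<open>auto simp: rect_def band_def\<close>)
qed

lemma rect_parity: "even (i + j) \<Longrightarrow> rect i a b c d = rect j a b c d"
  by (auto simp: mem_rect)

lemma hcross_dual:
  assumes "even (a + i)" "even (b + i)" "even (c + i)" "even (d + i)" "a < b" "c \<le> d"
  shows "hcross i a b c d \<omega> \<longleftrightarrow> \<not> vcross (i + 1) (a + 1) (b - 1) (c - 1) (d + 1) (- \<omega>)"
proof
  show "\<not> vcross (i + 1) (a + 1) (b - 1) (c - 1) (d + 1) (- \<omega>)" if "hcross i a b c d \<omega>"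
  proof
    assume "vcross (i + 1) (a + 1) (b - 1) (c - 1) (d + 1) (- \<omega>)"
    then have "\<not> hcross (i + 1 + 1) a b c d \<omega>"
      using assms by (intro not_hcross_and_dual) auto
    moreover have "rect (i + 1 + 1) a b c d = rect i a b c d" by (rule rect_parity) auto
    ultimately show False using that by (simp only: hcross_def)
  qed
qed (use hcross_or_dual [OF assms] in blast)

text \<open>Duality avoids cutting a walk at its visits to the sides: a closed dual crossing of the
  narrow rectangle is also one of the wide rectangle, and would block it.\<close>

lemma hcross_narrow:
  assumes par: "even (a + i)" "even (b + i)" "even (a' + i)" "even (b' + i)" "even (c + i)"
      "even (d + i)"
    and "a \<le> a'" "a' < b'" "b' \<le> b" "c \<le> d" "hcross i a b c d \<omega>"
  shows "hcross i a' b' c d \<omega>"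
proof (rule ccontr)
  assume "\<not> hcross i a' b' c d \<omega>"
  then have "vcross (i + 1) (a' + 1) (b' - 1) (c - 1) (d + 1) (- \<omega>)"
    using assms by (intro hcross_or_dual) auto
  then have "vcross (i + 1) (a + 1) (b - 1) (c - 1) (d + 1) (- \<omega>)"
    using assms by (elim vcross_mono) auto
  then show False using assms hcross_dual [of a i b c d \<omega>] by auto
qed

definition depends_on :: "'a set \<Rightarrow> ('a set \<Rightarrow> 'b) \<Rightarrow> bool" where
  "depends_on F f \<longleftrightarrow> (\<forall>\<omega>. f (\<omega> \<inter> F) = f \<omega>)"

lemma mid_rect: "u \<in> rect i a b c d \<Longrightarrow> v \<in> rect i a b c d \<Longrightarrow> adj u v \<Longrightarrow> mid u v \<in> {a..b} \<times> {c..d}"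
  by (elim adj_cases) (auto simp: mem_rect)

lemma conn_rect_restrict:
  assumes "{a..b} \<times> {c..d} \<subseteq> F"
  shows "conn (rect i a b c d) (\<omega> \<inter> F) = conn (rect i a b c d) \<omega>"
  unfolding conn_def
  by (rule arg_cong [of _ _ rtranclp]) (use assms mid_rect in blast)

lemma depends_on_hcross: "{a..b} \<times> {c..d} \<subseteq> F \<Longrightarrow> depends_on F (hcross i a b c d)"
  by (simp add: depends_on_def hcross_def conn_rect_restrict)

lemma depends_on_vcross: "{a..b} \<times> {c..d} \<subseteq> F \<Longrightarrow> depends_on F (vcross i a b c d)"
  by (simp add: depends_on_def vcross_def conn_rect_restrict)

section \<open>Correlation inequalities on the discrete cube\<close>

definition mean :: "'a set \<Rightarrow> ('a set \<Rightarrow> real) \<Rightarrow> real" where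
  "mean E f = (\<Sum>\<omega>\<in>Pow E. f \<omega>) / 2 ^ card E"

definition Pr :: "'a set \<Rightarrow> ('a set \<Rightarrow> bool) \<Rightarrow> real" where
  "Pr E A = mean E (\<lambda>\<omega>. of_bool (A \<omega>))"

lemma mean_empty [simp]: "mean {} f = f {}"
  by (simp add: mean_def)

lemma mean_insert:
  assumes "finite E" "x \<notin> E"
  shows "mean (insert x E) f = (mean E f + mean E (\<lambda>\<omega>. f (insert x \<omega>))) / 2"
proof -
  have "inj_on (insert x) (Pow E)" using assms(2) by (auto simp: inj_on_def)
  then have "sum f (insert x ` Pow E) = (\<Sum>\<omega>\<in>Pow E. f (insert x \<omega>))"
    by (simp add: sum.reindex)
  moreover have "sum f (Pow (insert x E)) = sum f (Pow E) + sum f (insert x ` Pow E)"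
    unfolding Pow_insert by (rule sum.union_disjoint) (use assms in auto)
  ultimately show ?thesis
    using assms by (simp add: mean_def field_simps)
qed

lemma mean_add: "mean E (\<lambda>\<omega>. f \<omega> + g \<omega>) = mean E f + mean E g"
  by (simp add: mean_def sum.distrib add_divide_distrib)

lemma mean_diff: "mean E (\<lambda>\<omega>. f \<omega> - g \<omega>) = mean E f - mean E g"
  by (simp add: mean_def sum_subtractf diff_divide_distrib)

lemma mean_cmult: "mean E (\<lambda>\<omega>. c * f \<omega>) = c * mean E f"
  by (simp add: mean_def sum_distrib_left)

lemma mean_sum: "mean E (\<lambda>\<omega>. \<Sum>i\<in>I. f i \<omega>) = (\<Sum>i\<in>I. mean E (f i))"
  unfolding mean_def by (subst sum.swap) (simp add: sum_divide_distrib)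

lemma mean_const [simp]: "finite E \<Longrightarrow> mean E (\<lambda>_. c) = c"
  by (simp add: mean_def card_Pow)

lemma mean_mono: "(\<And>\<omega>. \<omega> \<subseteq> E \<Longrightarrow> f \<omega> \<le> g \<omega>) \<Longrightarrow> mean E f \<le> mean E g"
  unfolding mean_def by (intro divide_right_mono sum_mono) auto

lemma mean_cong: "(\<And>\<omega>. \<omega> \<subseteq> E \<Longrightarrow> f \<omega> = g \<omega>) \<Longrightarrow> mean E f = mean E g"
  unfolding mean_def by (intro arg_cong2 [of _ _ _ _ "(/)"] sum.cong) auto

lemma mean_nonneg: "(\<And>\<omega>. \<omega> \<subseteq> E \<Longrightarrow> 0 \<le> f \<omega>) \<Longrightarrow> 0 \<le> mean E f"
  unfolding mean_def by (intro divide_nonneg_nonneg sum_nonneg) auto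

text \<open>Each coordinate that \<open>f\<close> ignores averages two equal values. The ambient
  edge set can thus be enlarged freely, for instance to hold translates and reflections.\<close>

lemma mean_restrict:
  assumes "depends_on F f" "finite E" "F \<subseteq> E"
  shows "mean E f = mean F f"
proof -
  have "mean (F \<union> G) f = mean F f" if "finite G" "F \<inter> G = {}" for G
    using that
  proof (induction G)
    case (insert x G)
    have "f (insert x \<omega>) = f \<omega>" for \<omega>
      using assms(1) insert.prems unfolding depends_on_def by (metis Int_insert_left disjoint_insert(1))
    moreover have "finite (F \<union> G)" "x \<notin> F \<union> G"
      using insert assms finite_subset by auto
    ultimately show ?case using insert by (simp add: mean_insert)
  qed simp
  from this [of "E - F"] show ?thesis
    using assms by (simp add: Un_absorb1)
qed

lemma mean_image:
  assumes "inj_on \<pi> E"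
  shows "mean (\<pi> ` E) f = mean E (\<lambda>\<omega>. f (\<pi> ` \<omega>))"
proof -
  have "bij_betw (image \<pi>) (Pow E) (Pow (\<pi> ` E))"
    using assms by (simp add: bij_betw_Pow inj_on_imp_bij_betw)
  then show ?thesis
    using assms by (simp add: mean_def card_image sum.reindex_bij_betw)
qed

text \<open>Only the coordinates that \<open>f\<close> reads have to stay inside \<open>E\<close>,
  so no finite box has to be invariant under \<open>\<pi>\<close>.\<close>

lemma mean_vimage:
  assumes "depends_on F f" "finite E" "F \<subseteq> E" "\<pi> ` F \<subseteq> E" "inj \<pi>"
  shows "mean E (\<lambda>\<omega>. f (\<pi> -` \<omega>)) = mean E f"
proof -
  have "f (\<pi> -` (\<omega> \<inter> \<pi> ` F)) = f (\<pi> -` \<omega>)" for \<omega>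
  proof -
    have "\<pi> -` (\<omega> \<inter> \<pi> ` F) = (\<pi> -` \<omega>) \<inter> F" using assms(5) by (auto dest: injD)
    then show ?thesis using assms(1) by (simp add: depends_on_def)
  qed
  then have "mean E (\<lambda>\<omega>. f (\<pi> -` \<omega>)) = mean (\<pi> ` F) (\<lambda>\<omega>. f (\<pi> -` \<omega>))"
    using assms by (intro mean_restrict) (auto simp: depends_on_def)
  also have "\<dots> = mean F f"
    using assms(5) by (subst mean_image) (auto intro: inj_on_subset simp: inj_vimage_image_eq)
  also have "\<dots> = mean E f"
    using assms by (simp add: mean_restrict)
  finally show ?thesis .
qed

text \<open>Duality produces the complement in the whole grid. On the coordinates that
  \<open>f\<close> reads it agrees with \<open>E - \<omega>\<close>, and exchanging open and closed
  preserves the uniform measure.\<close>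

lemma mean_Compl:
  assumes "depends_on F f" "finite E" "F \<subseteq> E"
  shows "mean E (\<lambda>\<omega>. f (- \<omega>)) = mean E f"
proof -
  have *: "f (- \<omega>) = f (E - \<omega>)" for \<omega>
  proof -
    have "(- \<omega>) \<inter> F = (E - \<omega>) \<inter> F" using assms(3) by auto
    then show ?thesis using assms(1) unfolding depends_on_def by metis
  qed
  have "bij_betw (\<lambda>\<omega>. E - \<omega>) (Pow E) (Pow E)"
    by (rule bij_betwI [of _ _ _ "\<lambda>\<omega>. E - \<omega>"]) auto
  then have "(\<Sum>\<omega>\<in>Pow E. f (E - \<omega>)) = (\<Sum>\<omega>\<in>Pow E. f \<omega>)"
    by (rule sum.reindex_bij_betw)
  then show ?thesis by (simp add: mean_def *)
qed

lemma Pr_insert: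
  assumes "finite E" "x \<notin> E"
  shows "Pr (insert x E) A = (Pr E A + Pr E (\<lambda>\<omega>. A (insert x \<omega>))) / 2"
  using assms by (simp add: Pr_def mean_insert)

lemma Pr_mono: "(\<And>\<omega>. \<omega> \<subseteq> E \<Longrightarrow> A \<omega> \<Longrightarrow> B \<omega>) \<Longrightarrow> Pr E A \<le> Pr E B"
  unfolding Pr_def by (rule mean_mono) (auto simp: of_bool_def)

lemma Pr_nonneg: "0 \<le> Pr E A"
  unfolding Pr_def by (rule mean_nonneg) auto

lemma Pr_le_1: "finite E \<Longrightarrow> Pr E A \<le> 1"
  using mean_mono [of E "\<lambda>\<omega>. of_bool (A \<omega>)" "\<lambda>_. 1"] by (simp add: Pr_def)

lemma Pr_Not: "finite E \<Longrightarrow> Pr E (\<lambda>\<omega>. \<not> A \<omega>) = 1 - Pr E A"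
  using mean_diff [of E "\<lambda>_. 1" "\<lambda>\<omega>. of_bool (A \<omega>)"] by (simp add: Pr_def of_bool_not_iff)

lemma Pr_union_inter: "Pr E (\<lambda>\<omega>. A \<omega> \<or> B \<omega>) + Pr E (\<lambda>\<omega>. A \<omega> \<and> B \<omega>) = Pr E A + Pr E B"
  unfolding Pr_def mean_add [symmetric] by (rule mean_cong) (auto simp: of_bool_def)

lemma Pr_union_le: "Pr E (\<lambda>\<omega>. A \<omega> \<or> B \<omega>) \<le> Pr E A + Pr E B"
  using Pr_union_inter [of E A B] Pr_nonneg [of E "\<lambda>\<omega>. A \<omega> \<and> B \<omega>"] by linarith

section \<open>Increasing events: the Harris and van den Berg-Kesten inequalities\<close>

definition increasing :: "('a set \<Rightarrow> bool) \<Rightarrow> bool" where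
  "increasing A \<longleftrightarrow> (\<forall>\<omega> \<omega>'. A \<omega> \<longrightarrow> \<omega> \<subseteq> \<omega>' \<longrightarrow> A \<omega>')"

lemma increasingD: "increasing A \<Longrightarrow> A \<omega> \<Longrightarrow> \<omega> \<subseteq> \<omega>' \<Longrightarrow> A \<omega>'"
  by (simp add: increasing_def)

lemma increasing_insert: "increasing A \<Longrightarrow> increasing (\<lambda>\<omega>. A (insert x \<omega>))"
  unfolding increasing_def [of "\<lambda>\<omega>. A (insert x \<omega>)"] by (blast intro: increasingD)

lemma Pr_increasing_insert: "increasing A \<Longrightarrow> Pr E A \<le> Pr E (\<lambda>\<omega>. A (insert x \<omega>))"
  by (rule Pr_mono) (blast intro: increasingD)

text \<open>Induction on the edges: opening \<open>x\<close> raises both conditional probabilities,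
  so \<open>(a1 - a0) * (b1 - b0)\<close> is nonnegative, which is Chebyshev's inequality for two
  values.\<close>

lemma harris:
  assumes "finite E" "increasing A" "increasing B"
  shows "Pr E A * Pr E B \<le> Pr E (\<lambda>\<omega>. A \<omega> \<and> B \<omega>)"
  using assms
proof (induction E arbitrary: A B)
  case empty
  then show ?case by (simp add: Pr_def)
next
  case (insert x E)
  define a0 b0 a1 b1 where "a0 = Pr E A" and "b0 = Pr E B"
    and "a1 = Pr E (\<lambda>\<omega>. A (insert x \<omega>))" and "b1 = Pr E (\<lambda>\<omega>. B (insert x \<omega>))"
  have "0 \<le> (a1 - a0) * (b1 - b0)"
    unfolding a0_def a1_def b0_def b1_def
    by (intro mult_nonneg_nonneg) (use Pr_increasing_insert insert.prems in auto)
  then have "(a0 + a1) / 2 * ((b0 + b1) / 2) \<le> (a0 * b0 + a1 * b1) / 2"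
    by (simp add: field_simps)
  also have "\<dots> \<le> (Pr E (\<lambda>\<omega>. A \<omega> \<and> B \<omega>) + Pr E (\<lambda>\<omega>. A (insert x \<omega>) \<and> B (insert x \<omega>))) / 2"
    unfolding a0_def a1_def b0_def b1_def
    by (intro divide_right_mono add_mono insert.IH) (use insert.prems increasing_insert in auto)
  finally show ?case
    using insert.hyps by (simp add: Pr_insert a0_def a1_def b0_def b1_def)
qed

text \<open>Disjoint occurrence. For increasing events a set of open edges already certifies the
  event, so subsets of \<open>\<omega>\<close> serve as witnesses.\<close>

definition disjointly :: "('a set \<Rightarrow> bool) \<Rightarrow> ('a set \<Rightarrow> bool) \<Rightarrow> 'a set \<Rightarrow> bool" where
  "disjointly A B \<omega> \<longleftrightarrow> (\<exists>K L. K \<union> L \<subseteq> \<omega> \<and> K \<inter> L = {} \<and> A K \<and> B L)"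

lemma increasing_disjointly: "increasing (disjointly A B)"
  unfolding increasing_def disjointly_def by (meson subset_trans)

lemma disjointly_insert:
  assumes "increasing A" "increasing B" "x \<notin> \<omega>"
  shows "disjointly A B (insert x \<omega>) \<longleftrightarrow>
    disjointly A (\<lambda>\<omega>. B (insert x \<omega>)) \<omega> \<or> disjointly (\<lambda>\<omega>. A (insert x \<omega>)) B \<omega>" (is "?l \<longleftrightarrow> ?r")
proof
  assume ?l
  then obtain K L where KL: "K \<union> L \<subseteq> insert x \<omega>" "K \<inter> L = {}" "A K" "B L"
    unfolding disjointly_def by blast
  show ?r
  proof (cases "x \<in> K")
    case True
    have "A (insert x (K - {x}))" using KL True by (simp add: insert_absorb)
    moreover have "(K - {x}) \<union> L \<subseteq> \<omega>" using KL True by auto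
    moreover have "(K - {x}) \<inter> L = {}" using KL by auto
    ultimately show ?thesis using KL(4) unfolding disjointly_def by blast
  next
    case False
    have "B (insert x (L - {x}))" by (rule increasingD [OF assms(2) KL(4)]) auto
    moreover have "K \<union> (L - {x}) \<subseteq> \<omega>" using KL False by auto
    moreover have "K \<inter> (L - {x}) = {}" using KL by auto
    ultimately show ?thesis using KL(3) unfolding disjointly_def by blast
  qed
next
  assume ?r
  then show ?l
  proof
    assume "disjointly A (\<lambda>\<omega>. B (insert x \<omega>)) \<omega>"
    then obtain K L where KL: "K \<union> L \<subseteq> \<omega>" "K \<inter> L = {}" "A K" "B (insert x L)"
      unfolding disjointly_def by blast
    moreover have "K \<union> insert x L \<subseteq> insert x \<omega>" "K \<inter> insert x L = {}" using KL assms(3) by auto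
    ultimately show ?l unfolding disjointly_def by blast
  next
    assume "disjointly (\<lambda>\<omega>. A (insert x \<omega>)) B \<omega>"
    then obtain K L where KL: "K \<union> L \<subseteq> \<omega>" "K \<inter> L = {}" "A (insert x K)" "B L"
      unfolding disjointly_def by blast
    moreover have "insert x K \<union> L \<subseteq> insert x \<omega>" "insert x K \<inter> L = {}" using KL assms(3) by auto
    ultimately show ?l unfolding disjointly_def by blast
  qed
qed

text \<open>Condition on the new edge \<open>x\<close>. If it is open, it helps at most one of the
  two witnesses, which gives a union of two events; if it is closed, both of these events hold.
  Inclusion-exclusion then bounds the sum of both cases by \<open>a0 * b1 + a1 * b0\<close>, and
  monotonicity in \<open>x\<close> does the rest.\<close>

lemma van_den_berg_kesten:
  assumes "finite E" "increasing A" "increasing B"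
  shows "Pr E (disjointly A B) \<le> Pr E A * Pr E B"
  using assms
proof (induction E arbitrary: A B)
  case empty
  have "A {} \<and> B {}" if "disjointly A B {}"
    using that unfolding disjointly_def by auto
  then show ?case by (auto simp: Pr_def)
next
  case (insert x E)
  define A1 B1 where "A1 = (\<lambda>\<omega>. A (insert x \<omega>))" and "B1 = (\<lambda>\<omega>. B (insert x \<omega>))"
  define a0 b0 a1 b1 where "a0 = Pr E A" and "b0 = Pr E B" and "a1 = Pr E A1" and "b1 = Pr E B1"
  have inc: "increasing A1" "increasing B1"
    unfolding A1_def B1_def by (intro increasing_insert insert.prems)+
  have "0 \<le> (a1 - a0) * (b1 - b0)"
    unfolding a0_def a1_def b0_def b1_def A1_def B1_def
    by (intro mult_nonneg_nonneg) (use Pr_increasing_insert insert.prems in auto)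
  then have le: "(a0 * b1 + a1 * b0) / 2 \<le> (a0 + a1) / 2 * ((b0 + b1) / 2)"
    by (simp add: field_simps)
  have "Pr E (\<lambda>\<omega>. disjointly A B (insert x \<omega>)) = Pr E (\<lambda>\<omega>. disjointly A B1 \<omega> \<or> disjointly A1 B \<omega>)"
    unfolding Pr_def A1_def B1_def
    by (rule mean_cong) (use disjointly_insert [OF insert.prems] insert.hyps(2) in \<open>auto dest!: subsetD\<close>)
  moreover have "Pr E (disjointly A B) \<le> Pr E (\<lambda>\<omega>. disjointly A B1 \<omega> \<and> disjointly A1 B \<omega>)"
  proof (rule Pr_mono)
    fix \<omega> assume "disjointly A B \<omega>"
    then obtain K L where "K \<union> L \<subseteq> \<omega>" "K \<inter> L = {}" "A K" "B L"
      unfolding disjointly_def by blast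
    moreover have "A1 K" "B1 L"
      using \<open>A K\<close> \<open>B L\<close> insert.prems unfolding A1_def B1_def by (blast intro: increasingD)+
    ultimately show "disjointly A B1 \<omega> \<and> disjointly A1 B \<omega>"
      unfolding disjointly_def by blast
  qed
  ultimately have "Pr E (disjointly A B) + Pr E (\<lambda>\<omega>. disjointly A B (insert x \<omega>)) \<le>
      Pr E (disjointly A B1) + Pr E (disjointly A1 B)"
    using Pr_union_inter [of E "disjointly A B1" "disjointly A1 B"] by linarith
  also have "\<dots> \<le> a0 * b1 + a1 * b0"
    unfolding a0_def a1_def b0_def b1_def
    by (intro add_mono insert.IH insert.prems inc)
  finally have "Pr (insert x E) (disjointly A B) \<le> (a0 * b1 + a1 * b0) / 2"
    using insert.hyps by (simp add: Pr_insert)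
  also note le
  finally show ?case
    unfolding Pr_insert [OF insert.hyps(1,2), of A] Pr_insert [OF insert.hyps(1,2), of B]
      a0_def b0_def a1_def b1_def A1_def B1_def .
qed

text \<open>Exchanging the part of an independent second configuration outside a stopping set of the first
  preserves the joint law.\<close>

lemma mean_resample:
  assumes "finite E" and stop: "\<And>\<omega> \<omega>'. \<omega>' \<inter> X \<omega> = \<omega> \<inter> X \<omega> \<Longrightarrow> X \<omega>' = X \<omega>"
  shows "mean E (\<lambda>\<omega>. mean E (\<lambda>\<omega>'. f ((\<omega> \<inter> X \<omega>) \<union> (\<omega>' - X \<omega>)))) = mean E f"
proof -
  \<comment> \<open>\<open>\<Phi>\<close> is an involution: it changes the first configuration only
    outside \<open>X \<omega>\<close>, so the stopping set, and with it the rule of exchange, stays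
    the same.\<close>
  define \<Phi> where "\<Phi> = (\<lambda>(\<omega>, \<omega>'). ((\<omega> \<inter> X \<omega>) \<union> (\<omega>' - X \<omega>), (\<omega>' \<inter> X \<omega>) \<union> (\<omega> - X \<omega>)))"
  have X: "X ((\<omega> \<inter> X \<omega>) \<union> (\<omega>' - X \<omega>)) = X \<omega>" for \<omega> \<omega>'
    by (rule stop) auto
  have "bij_betw \<Phi> (Pow E \<times> Pow E) (Pow E \<times> Pow E)"
    by (rule bij_betwI [of _ _ _ \<Phi>]) (auto simp: \<Phi>_def X)
  then have "(\<Sum>p\<in>Pow E \<times> Pow E. f (fst (\<Phi> p))) = (\<Sum>p\<in>Pow E \<times> Pow E. f (fst p))"
    by (rule sum.reindex_bij_betw)
  then have "(\<Sum>\<omega>\<in>Pow E. \<Sum>\<omega>'\<in>Pow E. f ((\<omega> \<inter> X \<omega>) \<union> (\<omega>' - X \<omega>))) = (\<Sum>\<omega>\<in>Pow E. \<Sum>\<omega>'\<in>Pow E. f \<omega>)"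
    by (simp add: sum.cartesian_product \<Phi>_def split_beta del: sum_constant)
  also have "\<dots> = (\<Sum>\<omega>\<in>Pow E. f \<omega>) * 2 ^ card E"
    using assms(1) by (simp add: card_Pow sum_distrib_right mult.commute)
  finally have "(\<Sum>\<omega>\<in>Pow E. \<Sum>\<omega>'\<in>Pow E. f ((\<omega> \<inter> X \<omega>) \<union> (\<omega>' - X \<omega>))) / 2 ^ card E =
      (\<Sum>\<omega>\<in>Pow E. f \<omega>)" by simp
  then show ?thesis
    unfolding mean_def sum_divide_distrib [symmetric] by simp
qed

section \<open>The Russo--Seymour--Welsh bound\<close>

lemma increasing_hcross: "increasing (hcross i a b c d)"
  unfolding increasing_def by (blast intro: hcross_mono)

lemma Pr_restrict: "depends_on F A \<Longrightarrow> finite E \<Longrightarrow> F \<subseteq> E \<Longrightarrow> Pr E A = Pr F A"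
  unfolding Pr_def by (rule mean_restrict) (auto simp: depends_on_def)

lemma Pr_vimage:
  "depends_on F A \<Longrightarrow> finite E \<Longrightarrow> F \<subseteq> E \<Longrightarrow> \<pi> ` F \<subseteq> E \<Longrightarrow> inj \<pi> \<Longrightarrow> Pr E (\<lambda>\<omega>. A (\<pi> -` \<omega>)) = Pr E A"
  unfolding Pr_def using mean_vimage [of F "\<lambda>\<omega>. of_bool (A \<omega>)" E \<pi>] by (auto simp: depends_on_def)

lemma Pr_Compl: "depends_on F A \<Longrightarrow> finite E \<Longrightarrow> F \<subseteq> E \<Longrightarrow> Pr E (\<lambda>\<omega>. A (- \<omega>)) = Pr E A"
  unfolding Pr_def using mean_Compl [of F "\<lambda>\<omega>. of_bool (A \<omega>)" E] by (auto simp: depends_on_def)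

lemma inj_shift: "inj (shift p q)" and inj_hflip: "inj (hflip m)" and inj_vflip: "inj (vflip m)"
  using lattice_sym_shift lattice_sym_hflip lattice_sym_vflip by (auto simp: lattice_sym_def)

lemma Pr_hcross_shift:
  assumes "even (i + j + p)" "even (i + j + q)" "finite E"
    "{a..b} \<times> {c..d} \<subseteq> E" "{a + p..b + p} \<times> {c + q..d + q} \<subseteq> E"
  shows "Pr E (hcross j (a + p) (b + p) (c + q) (d + q)) = Pr E (hcross i a b c d)"
proof -
  have "shift p q ` ({a..b} \<times> {c..d}) \<subseteq> E"
    using assms(5) by (auto simp: shift_def)
  then have "Pr E (\<lambda>\<omega>. hcross i a b c d (shift p q -` \<omega>)) = Pr E (hcross i a b c d)"
    by (intro Pr_vimage [OF depends_on_hcross [OF order_refl] assms(3,4) _ inj_shift])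
  then show ?thesis using assms by (simp add: hcross_shift)
qed

lemma Pr_vcross_hcross:
  assumes "finite E" "{a..b} \<times> {c..d} \<subseteq> E" "{c..d} \<times> {a..b} \<subseteq> E"
  shows "Pr E (vcross i a b c d) = Pr E (hcross i c d a b)"
proof -
  have "prod.swap ` ({c..d} \<times> {a..b}) \<subseteq> E" using assms(2) by auto
  then have "Pr E (\<lambda>\<omega>. hcross i c d a b (prod.swap -` \<omega>)) = Pr E (hcross i c d a b)"
    by (intro Pr_vimage [OF depends_on_hcross [OF order_refl] assms(1,3)]) auto
  then show ?thesis by (simp add: hcross_swap)
qed

lemma Pr_hcross_dual:
  assumes "even (a + i)" "even (b + i)" "even (c + i)" "even (d + i)" "a < b" "c \<le> d"
    and "finite E" "{a + 1..b - 1} \<times> {c - 1..d + 1} \<subseteq> E"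
  shows "Pr E (hcross i a b c d) = 1 - Pr E (vcross (i + 1) (a + 1) (b - 1) (c - 1) (d + 1))"
proof -
  have "Pr E (hcross i a b c d) = Pr E (\<lambda>\<omega>. \<not> vcross (i + 1) (a + 1) (b - 1) (c - 1) (d + 1) (- \<omega>))"
    using hcross_dual [OF assms(1-6)] by (intro arg_cong [of _ _ "Pr E"] ext) simp
  also have "\<dots> = 1 - Pr E (\<lambda>\<omega>. vcross (i + 1) (a + 1) (b - 1) (c - 1) (d + 1) (- \<omega>))"
    by (rule Pr_Not) (use assms in simp)
  also have "\<dots> = 1 - Pr E (vcross (i + 1) (a + 1) (b - 1) (c - 1) (d + 1))"
    using Pr_Compl [OF depends_on_vcross [OF order_refl] assms(7,8)] by simp
  finally show ?thesis .
qed

text \<open>The dual rectangle is this rectangle with the axes exchanged and moved by an odd vector,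
  so its crossing probability p satisfies p = 1 - p. The box \<open>B\<close> is chosen large enough
  for all copies that occur.\<close>

lemma Pr_hcross_half:
  assumes "even b" "b \<ge> 2" "finite E" "{0..b} \<times> {0..b - 2} \<subseteq> E"
  shows "Pr E (hcross 0 0 b 0 (b - 2)) = 1 / 2"
proof -
  define B where "B = {-b..2 * b} \<times> {-b..2 * b}"
  have B: "finite B" "{0..b} \<times> {0..b - 2} \<subseteq> B" "{0..b - 2} \<times> {0..b} \<subseteq> B"
      "{0 + 1..b - 1} \<times> {0 - 1..b - 2 + 1} \<subseteq> B"
    "{-1..b - 1} \<times> {1..b - 1} \<subseteq> B" "{1..b - 1} \<times> {-1..b - 1} \<subseteq> B"
    using assms(2) by (auto simp: B_def)
  have "Pr B (hcross 0 0 b 0 (b - 2)) = 1 - Pr B (vcross (0 + 1) (0 + 1) (b - 1) (0 - 1) (b - 2 + 1))"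
    by (rule Pr_hcross_dual) (use assms B in auto)
  also have "Pr B (vcross (0 + 1) (0 + 1) (b - 1) (0 - 1) (b - 2 + 1)) =
      Pr B (hcross 1 (-1) (b - 1) 1 (b - 1))"
    using B by (simp add: Pr_vcross_hcross)
  also have "\<dots> = Pr B (hcross 0 (-1 + 1) (b - 1 + 1) (1 + -1) (b - 1 + -1))"
    by (rule Pr_hcross_shift [symmetric]) (use B in auto)
  finally have "Pr B (hcross 0 0 b 0 (b - 2)) = 1 / 2" by simp
  then show ?thesis
    using Pr_restrict [OF depends_on_hcross [OF order_refl], of B 0 b 0 "b - 2" 0]
      Pr_restrict [OF depends_on_hcross [OF order_refl], of E 0 b 0 "b - 2" 0] B assms by simp
qed

lemma Pr_hcross_square:
  assumes "even b" "b \<ge> 2" "finite E" "{0..b} \<times> {0..b} \<subseteq> E"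
  shows "Pr E (hcross 0 0 b 0 b) \<ge> 1 / 2"
proof -
  have "{0..b} \<times> {0..b - 2} \<subseteq> E" using assms(4) by auto
  then have "1 / 2 = Pr E (hcross 0 0 b 0 (b - 2))" using assms by (simp add: Pr_hcross_half)
  also have "\<dots> \<le> Pr E (hcross 0 0 b 0 b)" by (rule Pr_mono) (auto elim: hcross_mono)
  finally show ?thesis .
qed

lemma Pr_vcross_square:
  assumes "even b" "b \<ge> 2" "finite E" "{0..b} \<times> {0..b} \<subseteq> E"
  shows "Pr E (vcross 0 0 b 0 b) \<ge> 1 / 2"
  using Pr_hcross_square [OF assms] Pr_vcross_hcross [OF assms(3,4,4)] by simp

section \<open>Gluing crossings by exploring a dual cluster\<close>

lemma conn_restrict:
  assumes "V \<subseteq> rect i a b c d" "{a..b} \<times> {c..d} \<subseteq> F"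
  shows "conn V (\<omega> \<inter> F) = conn V \<omega>"
  unfolding conn_def
  by (rule arg_cong [of _ _ rtranclp]) (use assms mid_rect in blast)

lemma conn_first_hit:
  assumes "conn V \<omega> r w" "r \<in> V - T" "w \<in> T"
  shows "\<exists>x t. x \<in> V - T \<and> conn (V - T) \<omega> r x \<and> t \<in> T \<and> adj x t \<and> mid x t \<in> \<omega>"
proof -
  have "conn (V - T) \<omega> r w \<and> w \<in> V - T \<or> (\<exists>x t. x \<in> V - T \<and> conn (V - T) \<omega> r x \<and> t \<in> T \<and> adj x t \<and>
      mid x t \<in> \<omega>)"
    using assms(1)
  proof (induction rule: conn_induct)
    case (step v w)
    then show ?case
      using conn_trans [OF _ conn_step [of v "V - T" w \<omega>]] by blast
  qed (use assms(2) in simp)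
  with assms(3) show ?thesis by blast
qed

text \<open>\<open>S\<close> is the square in the lower left corner of the square \<open>R\<close>.
  Since \<open>M - m = m + 2\<close>, the mirror image of \<open>S\<close> under
  \<open>vflip M\<close> lies directly above \<open>S\<close>, one row of vertical edges apart, and
  the two fill the left part of \<open>R\<close> from bottom to top. \<open>D\<close> holds the dual
  sites whose closed horizontal crossings block the vertical crossings of \<open>S\<close>.\<close>

locale rsw =
  fixes m M :: int
  assumes m: "even m" "m \<ge> 2" and M: "M = 2 * m + 2"
begin

abbreviation "S \<equiv> rect 0 0 m 0 m"
abbreviation "R \<equiv> rect 0 0 M 0 M"
abbreviation "D \<equiv> rect 1 (-1) (m + 1) 1 (m - 1)"

text \<open>This replaces a leftmost vertical crossing of \<open>S\<close>: the cluster decides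
  whether there is a crossing at all, and the edges that it reveals contain one.\<close>

definition cluster :: "site set \<Rightarrow> site set" where
  "cluster \<omega> = {f. \<exists>u\<in>D. fst u = -1 \<and> conn D (- \<omega>) u f}"

text \<open>The edges revealed by exploring the dual cluster of the left side; they form a stopping set.\<close>

definition explored :: "site set \<Rightarrow> site set" where
  "explored \<omega> = {mid f g | f g. f \<in> cluster \<omega> \<and> g \<in> D \<and> adj f g}"

lemma cluster_D: "cluster \<omega> \<subseteq> D"
  using conn_in unfolding cluster_def by blast

lemma cluster_cong:
  assumes "\<omega>' \<inter> explored \<omega> = \<omega> \<inter> explored \<omega>"
  shows "cluster \<omega>' = cluster \<omega>"
proof
  show "cluster \<omega>' \<subseteq> cluster \<omega>"
  proof
    fix f assume "f \<in> cluster \<omega>'"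
    then obtain u where u: "u \<in> D" "fst u = -1" "conn D (- \<omega>') u f" unfolding cluster_def by blast
    from u(3) show "f \<in> cluster \<omega>"
    proof (induction rule: conn_induct)
      case refl
      show ?case using u by (auto simp: cluster_def)
    next
      case (step v w)
      then have "mid v w \<in> explored \<omega>" unfolding explored_def by blast
      with step assms have "mid v w \<in> - \<omega>" by blast
      with step show ?case unfolding cluster_def using conn_trans conn_step by blast
    qed
  qed
  show "cluster \<omega> \<subseteq> cluster \<omega>'"
  proof
    fix f assume "f \<in> cluster \<omega>"
    then obtain u where u: "u \<in> D" "fst u = -1" "conn D (- \<omega>) u f" unfolding cluster_def by blast
    from u(3) show "f \<in> cluster \<omega>'"
    proof (induction rule: conn_induct)
      case refl
      show ?case using u by (auto simp: cluster_def)
    next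
      case (step v w)
      have "v \<in> cluster \<omega>" using u step(1) by (auto simp: cluster_def)
      then have "mid v w \<in> explored \<omega>" using step unfolding explored_def by blast
      with step assms have "mid v w \<in> - \<omega>'" by blast
      with step show ?case unfolding cluster_def using conn_trans conn_step by blast
    qed
  qed
qed

lemma explored_cong:
  assumes "\<omega>' \<inter> explored \<omega> = \<omega> \<inter> explored \<omega>"
  shows "explored \<omega>' = explored \<omega>"
proof -
  have "cluster \<omega>' = cluster \<omega>" using assms by (rule cluster_cong)
  then show ?thesis by (simp add: explored_def)
qed

lemma vcross_iff_cluster: "vcross 0 0 m 0 m \<omega> \<longleftrightarrow> (\<forall>f\<in>cluster \<omega>. fst f \<noteq> m + 1)"
proof -
  have "rect (1 + 1) (-1 + 1) (m + 1 - 1) (1 - 1) (m - 1 + 1) = S"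
    using rect_parity [of "1 + 1" 0 0 m 0 m] by simp
  then have "vcross (1 + 1) (-1 + 1) (m + 1 - 1) (1 - 1) (m - 1 + 1) \<omega> = vcross 0 0 m 0 m \<omega>"
    unfolding vcross_def by (simp only:) simp
  moreover have "hcross 1 (-1) (m + 1) 1 (m - 1) (- \<omega>) =
      (\<not> vcross (1 + 1) (-1 + 1) (m + 1 - 1) (1 - 1) (m - 1 + 1) (- (- \<omega>)))"
    by (rule hcross_dual) (use m in auto)
  moreover have "hcross 1 (-1) (m + 1) 1 (m - 1) (- \<omega>) \<longleftrightarrow> (\<exists>f\<in>cluster \<omega>. fst f = m + 1)"
    unfolding hcross_def cluster_def by blast
  ultimately show ?thesis by auto
qed

text \<open>Closing all unexplored edges leaves the cluster unchanged, and the cluster alone decides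
  whether \<open>S\<close> is crossed.\<close>

lemma vcross_explored: "vcross 0 0 m 0 m \<omega> \<Longrightarrow> vcross 0 0 m 0 m (\<omega> \<inter> explored \<omega>)"
proof -
  have "cluster (\<omega> \<inter> explored \<omega>) = cluster \<omega>" by (rule cluster_cong) blast
  then show "vcross 0 0 m 0 m \<omega> \<Longrightarrow> vcross 0 0 m 0 m (\<omega> \<inter> explored \<omega>)"
    by (simp only: vcross_iff_cluster)
qed

definition comp :: "site set \<Rightarrow> site \<Rightarrow> site set" where
  "comp \<omega> u = {w. conn S (\<omega> \<inter> explored \<omega>) u w}"

text \<open>The mirrored half is fictitious, its edges may be closed. It completes a barrier through
  the full height of \<open>R\<close>, which every horizontal crossing of \<open>R\<close> has to
  meet; by symmetry the genuine half gets at least half of the probability.\<close>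

definition doubled :: "site set \<Rightarrow> site \<Rightarrow> site set" where
  "doubled \<omega> u = comp \<omega> u \<union> vflip M ` comp \<omega> u"

definition spans :: "site set \<Rightarrow> site \<Rightarrow> site \<Rightarrow> bool" where
  "spans \<omega> u v \<longleftrightarrow> u \<in> S \<and> snd u = 0 \<and> snd v = m \<and> v \<in> comp \<omega> u"

definition touches :: "site set \<Rightarrow> site \<Rightarrow> site set \<Rightarrow> bool" where
  "touches \<omega> u \<omega>' \<longleftrightarrow> (\<exists>r x t. r \<in> R - doubled \<omega> u \<and> fst r = M \<and> conn (R - doubled \<omega> u) \<omega>' r x \<and>
     t \<in> comp \<omega> u \<and> adj x t \<and> mid x t \<in> \<omega>')"

lemma comp_S: "u \<in> S \<Longrightarrow> comp \<omega> u \<subseteq> S"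
  using conn_in unfolding comp_def by blast

lemma vflip_R: "vflip M ` R = R"
proof -
  have "x \<in> vflip M ` R" if "x \<in> R" for x
    using that m M by (intro image_eqI [of _ _ "vflip M x"]) (auto simp: vflip_def mem_rect)
  then show ?thesis using m M by (auto simp: vflip_def mem_rect)
qed

lemma vflip_vflip [simp]: "vflip M (vflip M x) = x"
  by (simp add: vflip_def)

lemma doubled_R: "u \<in> S \<Longrightarrow> doubled \<omega> u \<subseteq> rect 0 0 m 0 M"
proof
  fix x assume "u \<in> S" "x \<in> doubled \<omega> u"
  then obtain y where "y \<in> S" "x = y \<or> x = vflip M y"
    using comp_S [of u \<omega>] unfolding doubled_def by blast
  then show "x \<in> rect 0 0 m 0 M"
    using m M by (elim disjE) (simp_all add: vflip_def mem_rect)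
qed

lemma vflip_doubled: "vflip M ` doubled \<omega> u = doubled \<omega> u"
  by (auto simp: doubled_def image_Un image_image)

text \<open>Admitting every edge above row \<open>m\<close> makes the mirrored half and the link
  between the halves available. This is harmless for the separation argument, because the sites of
  \<open>D\<close>, and so the explored edges, lie below row \<open>m\<close>.\<close>

lemma doubled_walk:
  assumes "spans \<omega> u v"
  shows "conn (doubled \<omega> u) ((\<omega> \<inter> explored \<omega>) \<union> {e. m < snd e}) u (vflip M u)"
proof -
  let ?Op = "(\<omega> \<inter> explored \<omega>) \<union> {e. m < snd e}"
  have u: "u \<in> S" "snd u = 0" "snd v = m" "conn S (\<omega> \<inter> explored \<omega>) u v" "v \<in> comp \<omega> u" "v \<in> S"
    using assms comp_S [of u \<omega>] by (auto simp: spans_def comp_def)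
  have "conn (comp \<omega> u) ((\<omega> \<inter> explored \<omega>) \<inter> {mid a b | a b. a \<in> S \<and> b \<in> S \<and> adj a b \<and>
      conn S (\<omega> \<inter> explored \<omega>) u a \<and> conn S (\<omega> \<inter> explored \<omega>) u b}) u v"
    using conn_edges [OF u(4)] by (simp add: comp_def)
  then have c: "conn (comp \<omega> u) ((\<omega> \<inter> explored \<omega>) \<inter> {e. snd e \<le> m}) u v"
    by (rule conn_mono) (use mid_rect [of _ 0 0 m 0 m] in force)+
  then have 1: "conn (doubled \<omega> u) ?Op u v"
    by (rule conn_mono) (auto simp: doubled_def)
  have "conn (comp \<omega> u) (vflip M -` ?Op) v u"
    using conn_sym [OF c] by (rule conn_mono) (use m M in \<open>auto simp: vflip_def\<close>)
  then have "conn (vflip M ` comp \<omega> u) ?Op (vflip M v) (vflip M u)"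
    by (rule conn_image [OF lattice_sym_vflip])
  then have 2: "conn (doubled \<omega> u) ?Op (vflip M v) (vflip M u)"
    by (rule conn_mono) (auto simp: doubled_def)
  have "conn (doubled \<omega> u) ?Op v (vflip M v)"
  proof (rule conn_step)
    show "adj v (vflip M v)" using u(3) M by (simp add: adj_def vflip_def)
    show "mid v (vflip M v) \<in> ?Op" using u(3) M by (simp add: mid_def vflip_def)
  qed (use u(5) in \<open>auto simp: doubled_def\<close>)
  with 1 2 show ?thesis by (meson conn_trans)
qed

lemma corner_of_common_mid:
  assumes "adj x y" "adj f g" "mid x y = mid f g" "x \<in> cls 0" "f \<in> cls 1"
  shows "\<bar>fst f - fst x\<bar> = 1 \<and> \<bar>snd f - snd x\<bar> = 1"
proof -
  have p: "even (fst x)" "even (snd x)" "odd (fst f)" "odd (snd f)"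
    using assms(4,5) by (auto simp: mem_cls)
  show ?thesis
    using assms(1)
  proof (cases rule: adj_cases)
    case 1 then show ?thesis using p assms(3) by (cases rule: adj_cases [OF assms(2)]) auto
  next
    case 2 then show ?thesis using p assms(3) by (cases rule: adj_cases [OF assms(2)]) auto
  next
    case 3 then show ?thesis using p assms(3) by (cases rule: adj_cases [OF assms(2)]) auto
  next
    case 4 then show ?thesis using p assms(3) by (cases rule: adj_cases [OF assms(2)]) auto
  qed
qed

text \<open>The explored crossing and its mirror image together separate the explored dual cluster from
  everything that can be reached from the right side.\<close>

lemma unexplored_from_right:
  assumes sp: "spans \<omega> u v" and r: "r \<in> R - doubled \<omega> u" "fst r = M"
    and x: "conn (R - doubled \<omega> u) UNIV r x" and y: "adj x y"
  shows "mid x y \<notin> explored \<omega>"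
proof
  assume "mid x y \<in> explored \<omega>"
  then obtain f g where f: "mid x y = mid f g" "f \<in> cluster \<omega>" "g \<in> D" "adj f g"
    unfolding explored_def by blast
  have u: "u \<in> S" "snd u = 0" using sp by (auto simp: spans_def)
  \<comment> \<open>The barrier is prolonged by one step below and above \<open>R\<close>, so that
    all rows of \<open>R\<close> lie in the band; the added edges are again away from the rows of
    \<open>D\<close>.\<close>
  define s where "s = (fst u, -2 :: int)"
  define t where "t = (fst u, M + 2)"
  define V where "V = insert s (insert t (doubled \<omega> u))"
  define Op where "Op = (\<omega> \<inter> explored \<omega>) \<union> {e. m < snd e \<or> snd e < 1}"
  have doubled: "doubled \<omega> u \<subseteq> rect 0 0 m 0 M" using u(1) by (rule doubled_R)
  have uh: "u \<in> doubled \<omega> u" "vflip M u \<in> doubled \<omega> u"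
    by (auto simp: doubled_def comp_def)
  have "conn V Op u (vflip M u)"
    using doubled_walk [OF sp] by (rule conn_mono) (auto simp: V_def Op_def)
  moreover have "conn V Op s u"
    by (rule conn_step) (use u uh in \<open>auto simp: V_def Op_def s_def adj_def mid_def\<close>)
  moreover have "conn V Op (vflip M u) t"
    by (rule conn_step) (use u uh m M in \<open>auto simp: V_def Op_def t_def adj_def mid_def vflip_def\<close>)
  ultimately have c: "conn V Op s t" by (meson conn_trans)
  have V: "V \<subseteq> cls 0" "s \<in> V" "snd s < snd t"
    using u(1) doubled rect_cls [of 0 0 m 0 M] m M by (auto simp: V_def s_def t_def mem_rect mem_cls)
  have Vx: "0 \<le> fst w \<and> fst w \<le> m" if "w \<in> V" for w
    using that doubled u(1) by (auto simp: V_def s_def t_def mem_rect)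
  have dj: "R - doubled \<omega> u \<subseteq> (cls 0 - V) \<inter> band s t"
    by (auto simp: V_def s_def t_def band_def mem_rect mem_cls)
  show False
  proof (rule walk_separation [OF c V])
    fix \<psi>
    assume 1: "\<And>f g. f \<in> cls (0 + 1) \<Longrightarrow> f \<in> band s t \<Longrightarrow> g \<in> band s t \<Longrightarrow> adj f g \<Longrightarrow>
         mid f g \<notin> Op \<or> (\<forall>u\<in>V. \<forall>v\<in>V. adj u v \<longrightarrow> mid u v \<noteq> mid f g) \<Longrightarrow> \<psi> f = \<psi> g"
      and 2: "\<And>x a b. x \<in> cls 0 \<Longrightarrow> x \<notin> V \<Longrightarrow> x \<in> band s t \<Longrightarrow> \<bar>a\<bar> = 1 \<Longrightarrow> \<bar>b\<bar> = 1 \<Longrightarrow>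
         \<psi> (fst x + a, snd x + b) = \<psi> (fst x + 1, snd x + 1)"
      and 3: "\<And>W \<omega>' x y. conn W \<omega>' x y \<Longrightarrow> W \<subseteq> (cls 0 - V) \<inter> band s t \<Longrightarrow>
         \<psi> (fst x + 1, snd x + 1) = \<psi> (fst y + 1, snd y + 1)"
      and 4: "\<And>f. (\<forall>w\<in>V. fst f < fst w) \<Longrightarrow> \<not> \<psi> f"
      and 5: "\<And>f. f \<in> cls (0 + 1) \<Longrightarrow> f \<in> band s t \<Longrightarrow> (\<forall>w\<in>V. fst w < fst f) \<Longrightarrow> \<psi> f"
    obtain w where w: "w \<in> D" "fst w = -1" "conn D (- \<omega>) w f"
      using f(2) unfolding cluster_def by blast
    have "\<psi> w = \<psi> f"
      using w(3)
    proof (induction rule: conn_induct)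
      case (step a b)
      have "\<psi> a = \<psi> b"
      proof (rule 1)
        show "mid a b \<notin> Op \<or> (\<forall>u\<in>V. \<forall>v\<in>V. adj u v \<longrightarrow> mid u v \<noteq> mid a b)"
          using mid_rect [OF step(2,3,4)] step(5) by (auto simp: Op_def)
      qed (use step M m in \<open>auto simp: mem_cls band_def mem_rect s_def t_def\<close>)
      with step(6) show ?case by simp
    qed simp
    moreover have "\<not> \<psi> w" by (rule 4) (use Vx w(2) in force)
    ultimately have "\<not> \<psi> f" by simp
    have xR: "x \<in> R - doubled \<omega> u" using conn_in [OF x r(1)] .
    have "\<psi> (fst r + 1, snd r + 1) = \<psi> (fst x + 1, snd x + 1)"
      using x dj by (rule 3)
    moreover have "\<psi> (fst r + 1, snd r + 1)"
      by (rule 5) (use r Vx m M in \<open>force simp: mem_cls band_def mem_rect s_def t_def\<close>)+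
    \<comment> \<open>A common midpoint makes \<open>f\<close> a corner face of \<open>x\<close>. So
      the value false, coming from the left with the dual cluster, meets the value true, coming from
      the right with the walk.\<close>
    moreover have "\<psi> (fst x + (fst f - fst x), snd x + (snd f - snd x)) = \<psi> (fst x + 1, snd x + 1)"
    proof -
      have "x \<in> cls 0" "f \<in> cls 1" using xR cluster_D f(2) rect_cls by blast+
      with corner_of_common_mid [OF y f(4) f(1)] show ?thesis
        using xR dj by (intro 2) auto
    qed
    ultimately show False using \<open>\<not> \<psi> f\<close> by simp
  qed
qed

text \<open>The crossing meets the barrier. Coming from the right side, its first contact is either
  with the genuine half or with the mirrored one, and in the second case reflecting
  \<open>\<omega>'\<close> moves the contact to the genuine half.\<close>

lemma hcross_touches:
  assumes sp: "spans \<omega> u v" and h: "hcross 0 0 M 0 M \<omega>'"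
  shows "touches \<omega> u \<omega>' \<or> touches \<omega> u (vflip M -` \<omega>')"
proof -
  obtain l r where l: "l \<in> R" "fst l = 0" "fst r = M" "conn R \<omega>' l r"
    using h unfolding hcross_def by blast
  have r: "r \<in> R" using conn_in l by blast
  have u: "u \<in> S" "snd u = 0" using sp by (auto simp: spans_def)
  have doubled: "doubled \<omega> u \<subseteq> rect 0 0 m 0 M" using u(1) by (rule doubled_R)
  have uh: "u \<in> doubled \<omega> u" by (auto simp: doubled_def comp_def)
  have "\<exists>w. conn (doubled \<omega> u) (\<omega> \<inter> explored \<omega> \<union> {e. m < snd e}) u w \<and> conn R \<omega>' l w"
    by (rule crossings_meet [OF doubled_walk [OF sp] _ uh _ l(4) rect_cls l(1)])
      (use doubled rect_cls [of 0 0 m 0 M] u l m M in \<open>auto simp: mem_rect vflip_def dest!: subsetD\<close>)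
  then obtain w where w: "w \<in> doubled \<omega> u" "conn R \<omega>' l w" using conn_in uh by blast
  have "conn R \<omega>' r w" using conn_trans [OF conn_sym [OF l(4)] w(2)] .
  moreover have rT: "r \<in> R - doubled \<omega> u"
      using r l(3) doubled m M by (auto simp: mem_rect dest!: subsetD)
  ultimately obtain x t where x: "x \<in> R - doubled \<omega> u" "conn (R - doubled \<omega> u) \<omega>' r x"
      "t \<in> doubled \<omega> u" "adj x t" "mid x t \<in> \<omega>'"
    using conn_first_hit w(1) by blast
  show ?thesis
  proof (cases "t \<in> comp \<omega> u")
    case True
    then have "touches \<omega> u \<omega>'" unfolding touches_def using rT l(3) x by blast
    then show ?thesis ..
  next
    case False
    then obtain t' where t': "t' \<in> comp \<omega> u" "t = vflip M t'" using x(3) by (auto simp: doubled_def)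
    have flip: "vflip M -` (vflip M -` \<omega>') = \<omega>'" by (simp add: vimage_def)
    have "vflip M ` (R - doubled \<omega> u) = R - doubled \<omega> u"
      using inj_vflip [of M] by (simp add: image_set_diff vflip_R vflip_doubled)
    then have "conn (R - doubled \<omega> u) (vflip M -` \<omega>') (vflip M r) (vflip M x)"
        "vflip M r \<in> R - doubled \<omega> u"
      using conn_image [OF lattice_sym_vflip, of "R - doubled \<omega> u" M "vflip M -` \<omega>'" r x] x(2) rT
      by (auto simp: flip)
    moreover have "adj (vflip M x) (vflip M t)" "mid (vflip M x) (vflip M t) = vflip M (mid x t)"
      using lattice_sym_vflip [of M] x(4) unfolding lattice_sym_def by blast+
    moreover have "fst (vflip M r) = M" using l(3) by (simp add: vflip_def)
    ultimately have "touches \<omega> u (vflip M -` \<omega>')"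
      unfolding touches_def using t' x(5)
      by (intro exI [of _ "vflip M r"] exI [of _ "vflip M x"] exI [of _ t']) auto
    then show ?thesis ..
  qed
qed

lemma Pr_touches:
  assumes sp: "spans \<omega> u v" and E: "finite E" "{0..M} \<times> {0..M} \<subseteq> E"
  shows "Pr E (hcross 0 0 M 0 M) \<le> 2 * Pr E (touches \<omega> u)"
proof -
  have R: "R - doubled \<omega> u \<subseteq> R" by blast
  have doubled: "doubled \<omega> u \<subseteq> R"
  proof (rule subset_trans)
    show "doubled \<omega> u \<subseteq> rect 0 0 m 0 M" using sp by (intro doubled_R) (simp add: spans_def)
    show "rect 0 0 m 0 M \<subseteq> R" using m M by (intro rect_mono) auto
  qed
  have mids: "mid x t \<in> {0..M} \<times> {0..M}"
      if "r \<in> R - doubled \<omega> u" "conn (R - doubled \<omega> u) \<omega>' r x" "t \<in> comp \<omega> u" "adj x t" for r x t \<omega>'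
    using mid_rect [of x 0 0 M 0 M t] conn_in [OF that(2,1)] that(3,4) doubled
        by (auto simp: doubled_def)
  have dep: "depends_on ({0..M} \<times> {0..M}) (touches \<omega> u)"
    unfolding depends_on_def touches_def conn_restrict [OF R order_refl] using mids by blast
  have "Pr E (hcross 0 0 M 0 M) \<le> Pr E (\<lambda>\<omega>'. touches \<omega> u \<omega>' \<or> touches \<omega> u (vflip M -` \<omega>'))"
    by (rule Pr_mono) (rule hcross_touches [OF sp])
  also have "\<dots> \<le> Pr E (touches \<omega> u) + Pr E (\<lambda>\<omega>'. touches \<omega> u (vflip M -` \<omega>'))"
    by (rule Pr_union_le)
  also have "Pr E (\<lambda>\<omega>'. touches \<omega> u (vflip M -` \<omega>')) = Pr E (touches \<omega> u)"
    by (rule Pr_vimage [OF dep E _ inj_vflip]) (use E in \<open>auto simp: vflip_def\<close>)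
  finally show ?thesis by simp
qed

definition joined :: "site set \<Rightarrow> bool" where
  "joined \<omega> \<longleftrightarrow> (\<exists>u\<in>S. \<exists>v. snd u = 0 \<and> snd v = m \<and> conn S \<omega> u v \<and> (\<exists>r. fst r = M \<and> conn R \<omega> u r))"

text \<open>A walk from the right side that has not yet hit the barrier, its final step included,
  uses unexplored edges only. It is therefore not affected when \<open>\<omega>\<close> replaces
  \<open>\<omega>'\<close> on the explored edges.\<close>

lemma touches_joined:
  assumes sp: "spans \<omega> u v" and t: "touches \<omega> u \<omega>'"
  shows "joined (\<omega> \<inter> explored \<omega> \<union> (\<omega>' - explored \<omega>))" (is "joined ?\<omega>")
proof -
  obtain r x t where r: "r \<in> R - doubled \<omega> u" "fst r = M" "conn (R - doubled \<omega> u) \<omega>' r x"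
     "t \<in> comp \<omega> u" "adj x t" "mid x t \<in> \<omega>'"
    using t unfolding touches_def by blast
  have u: "u \<in> S" "snd u = 0" "snd v = m" "conn S (\<omega> \<inter> explored \<omega>) u v" "conn S (\<omega> \<inter> explored \<omega>) u t"
    using sp r(4) by (auto simp: spans_def comp_def)
  have SR: "S \<subseteq> R" by (rule rect_mono) (use m M in auto)
  have "x \<in> R" "t \<in> R" using conn_in [OF r(3,1)] comp_S [OF u(1)] r(4) SR by auto
  have un: "mid a b \<notin> explored \<omega>" if "adj a b" "conn (R - doubled \<omega> u) \<omega>' r a" for a b
    using unexplored_from_right [OF sp r(1,2) conn_mono [OF that(2)] that(1)] by blast
  have "conn R ?\<omega> r x"
    using conn_edges [OF r(3)]
    by (rule conn_mono) (use un conn_in r(1) in blast)+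
  moreover have "conn R ?\<omega> x t"
    by (rule conn_step) (use \<open>x \<in> R\<close> \<open>t \<in> R\<close> r un in auto)
  moreover have "conn R ?\<omega> u t" using u(5) by (rule conn_mono) (use SR in auto)
  ultimately have "conn R ?\<omega> u r" by (meson conn_trans conn_sym)
  moreover have "conn S ?\<omega> u v" using u(4) by (rule conn_mono) auto
  ultimately show ?thesis unfolding joined_def using u r(2) by blast
qed

text \<open>With probability at least 1/2 the explored edges contain a vertical crossing of
  \<open>S\<close>; given it, a fresh configuration touches it with probability at least 1/4, half
  of that of crossing the square \<open>R\<close>. Resampling outside the explored edges merges the
  two configurations into one.\<close>

lemma Pr_joined:
  assumes E: "finite E" "{0..M} \<times> {0..M} \<subseteq> E"
  shows "Pr E joined \<ge> 1 / 8"
proof -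
  have sub: "{0..m} \<times> {0..m} \<subseteq> E" using E m M by auto
  have "1 / 8 \<le> Pr E (vcross 0 0 m 0 m) * (Pr E (hcross 0 0 M 0 M) / 2)"
    using mult_mono [of "1/2" "Pr E (vcross 0 0 m 0 m)" "1/4" "Pr E (hcross 0 0 M 0 M) / 2"]
      Pr_vcross_square [OF m E(1) sub] Pr_hcross_square [of M E] m M E by simp
  also have "\<dots> = mean E (\<lambda>\<omega>. of_bool (vcross 0 0 m 0 m \<omega>) * (Pr E (hcross 0 0 M 0 M) / 2))"
    using mean_cmult [of E "Pr E (hcross 0 0 M 0 M) / 2" "\<lambda>\<omega>. of_bool (vcross 0 0 m 0 m \<omega>)"]
    by (simp add: Pr_def mult.commute)
  also have "\<dots> \<le> mean E (\<lambda>\<omega>. mean E (\<lambda>\<omega>'. of_bool (joined (\<omega> \<inter> explored \<omega> \<union> (\<omega>' - explored \<omega>)))))"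
  proof (rule mean_mono)
    fix \<omega>
    show "of_bool (vcross 0 0 m 0 m \<omega>) * (Pr E (hcross 0 0 M 0 M) / 2) \<le>
        mean E (\<lambda>\<omega>'. of_bool (joined (\<omega> \<inter> explored \<omega> \<union> (\<omega>' - explored \<omega>))))"
    proof (cases "vcross 0 0 m 0 m \<omega>")
      case True
      then obtain u v where sp: "spans \<omega> u v"
        using vcross_explored [OF True] unfolding vcross_def spans_def comp_def by blast
      have "Pr E (hcross 0 0 M 0 M) / 2 \<le> Pr E (touches \<omega> u)"
        using Pr_touches [OF sp E] by simp
      also have "\<dots> \<le> Pr E (\<lambda>\<omega>'. joined (\<omega> \<inter> explored \<omega> \<union> (\<omega>' - explored \<omega>)))"
        by (rule Pr_mono) (rule touches_joined [OF sp])
      finally show ?thesis using True by (simp add: Pr_def)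
    next
      case False
      then show ?thesis by (simp add: mean_nonneg)
    qed
  qed
  also have "\<dots> = Pr E joined"
    unfolding Pr_def by (rule mean_resample [OF E(1)]) (rule explored_cong)
  finally show ?thesis .
qed

lemma increasing_joined: "increasing joined"
  unfolding increasing_def joined_def using conn_mono [OF _ order_refl] by blast

lemma hflip_S: "hflip m ` S = S"
proof -
  have "x \<in> hflip m ` S" if "x \<in> S" for x
    using that m by (intro image_eqI [of _ _ "hflip m x"]) (auto simp: hflip_def mem_rect)
  then show ?thesis using m by (auto simp: hflip_def mem_rect)
qed

lemma hflip_R: "hflip m ` R \<subseteq> rect 0 (m - M) M 0 M"
  using m M by (auto simp: hflip_def mem_rect)

text \<open>\<open>hflip m\<close> preserves \<open>S\<close> and moves the right side of
  \<open>R\<close> to column \<open>m - M\<close>. The two vertical crossings of \<open>S\<close>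
  both meet its horizontal crossing, which links the left end to the right end.\<close>

lemma joined_joined_hcross:
  assumes "joined \<omega>" "joined (hflip m -` \<omega>)" "hcross 0 0 m 0 m \<omega>"
  shows "hcross 0 (m - M) M 0 M \<omega>"
proof -
  let ?W = "rect 0 (m - M) M 0 M"
  obtain u v r where u: "u \<in> S" "snd u = 0" "snd v = m" "conn S \<omega> u v" "fst r = M" "conn R \<omega> u r"
    using assms(1) unfolding joined_def by blast
  obtain u' v' r' where u': "u' \<in> S" "snd u' = 0" "snd v' = m" "conn S (hflip m -` \<omega>) u' v'"
     "fst r' = M" "conn R (hflip m -` \<omega>) u' r'"
    using assms(2) unfolding joined_def by blast
  obtain l k where l: "l \<in> S" "fst l = 0" "fst k = m" "conn S \<omega> l k"
    using assms(3) unfolding hcross_def by blast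
  have SW: "S \<subseteq> ?W" and RW: "R \<subseteq> ?W" using m M by (auto simp: mem_rect)
  define u2 v2 r2 where "u2 = hflip m u'" and "v2 = hflip m v'" and "r2 = hflip m r'"
  have c2: "conn S \<omega> u2 v2" "u2 \<in> S" "snd u2 = 0" "snd v2 = m" "fst r2 = m - M" "conn ?W \<omega> u2 r2"
    using conn_image [OF lattice_sym_hflip u'(4)] u'(1-3,5) hflip_S
      conn_mono [OF conn_image [OF lattice_sym_hflip u'(6)] hflip_R order_refl]
    by (auto simp: u2_def v2_def r2_def hflip_def)
  have "\<exists>w. conn S \<omega> u w \<and> conn S \<omega> l w"
    by (rule crossings_meet [OF u(4) rect_cls u(1) _ l(4) rect_cls l(1)]) (use u l m in
        \<open>auto simp: mem_rect\<close>)
  moreover have "\<exists>w. conn S \<omega> u2 w \<and> conn S \<omega> l w"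
    by (rule crossings_meet [OF c2(1) rect_cls c2(2) _ l(4) rect_cls l(1)]) (use c2 l m in
        \<open>auto simp: mem_rect\<close>)
  ultimately have "conn S \<omega> u2 u" by (meson conn_trans conn_sym)
  then have "conn ?W \<omega> u2 u" by (rule conn_mono) (use SW in auto)
  moreover have "conn ?W \<omega> u r" using u(6) by (rule conn_mono) (use RW in auto)
  ultimately have "conn ?W \<omega> r2 r" using c2(6) by (meson conn_trans conn_sym)
  moreover have "r2 \<in> ?W" using conn_in [OF c2(6)] c2(2) SW by blast
  ultimately show ?thesis unfolding hcross_def using c2(5) u(5) by blast
qed

lemma depends_on_joined: "depends_on ({0..M} \<times> {0..M}) joined"
proof -
  have "{0..m} \<times> {0..m} \<subseteq> {0..M} \<times> {0..M}" using m M by auto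
  then show ?thesis
    unfolding depends_on_def joined_def by (simp add: conn_rect_restrict)
qed

text \<open>Harris' inequality applied to the three events of \<open>joined_joined_hcross\<close>
  gives \<open>1 / 8 * (1 / 8) * (1 / 2)\<close>. The rectangle has width \<open>3 * m + 4\<close>
  and height \<open>2 * m + 2\<close>.\<close>

lemma russo_seymour_welsh:
  assumes E: "finite E" "{m - M..M} \<times> {0..M} \<subseteq> E"
  shows "Pr E (hcross 0 (m - M) M 0 M) \<ge> 1 / 128"
proof -
  have E2: "{0..M} \<times> {0..M} \<subseteq> E" and E3: "{0..m} \<times> {0..m} \<subseteq> E"
    using E(2) m M by auto
  have "hflip m ` ({0..M} \<times> {0..M}) \<subseteq> E" using E(2) m M by (auto simp: hflip_def)
  then have j: "Pr E (\<lambda>\<omega>. joined (hflip m -` \<omega>)) = Pr E joined"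
    by (intro Pr_vimage [OF depends_on_joined E(1) E2 _ inj_hflip])
  have inc: "increasing (\<lambda>\<omega>. joined (hflip m -` \<omega>))"
    unfolding increasing_def by (meson increasingD increasing_joined vimage_mono)
  have "1 / 8 * (1 / 8) \<le> Pr E joined * Pr E joined"
    using Pr_joined [OF E(1) E2] by (intro mult_mono) auto
  also have "\<dots> \<le> Pr E (\<lambda>\<omega>. joined \<omega> \<and> joined (hflip m -` \<omega>))"
    using harris [OF E(1) increasing_joined inc] j by simp
  finally have a: "1 / 64 \<le> Pr E (\<lambda>\<omega>. joined \<omega> \<and> joined (hflip m -` \<omega>))" by simp
  have inc2: "increasing (\<lambda>\<omega>. joined \<omega> \<and> joined (hflip m -` \<omega>))"
    using inc increasing_joined unfolding increasing_def by blast
  have "1 / 64 * (1 / 2) \<le> Pr E (\<lambda>\<omega>. joined \<omega> \<and> joined (hflip m -` \<omega>)) * Pr E (hcross 0 0 m 0 m)"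
    using a Pr_hcross_square [OF m E(1) E3] by (intro mult_mono) auto
  also have "\<dots> \<le> Pr E (\<lambda>\<omega>. (joined \<omega> \<and> joined (hflip m -` \<omega>)) \<and> hcross 0 0 m 0 m \<omega>)"
    by (rule harris [OF E(1) inc2 increasing_hcross])
  also have "\<dots> \<le> Pr E (hcross 0 (m - M) M 0 M)"
    by (rule Pr_mono) (use joined_joined_hcross in blast)
  finally show ?thesis by simp
qed

end

section \<open>Stability of crossings under translation\<close>

primrec disjoint_power :: "nat \<Rightarrow> ('a set \<Rightarrow> bool) \<Rightarrow> 'a set \<Rightarrow> bool" where
  "disjoint_power 0 A = (\<lambda>_. True)"
| "disjoint_power (Suc k) A = disjointly A (disjoint_power k A)"

lemma increasing_disjoint_power: "increasing (disjoint_power k A)"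
  by (cases k) (simp_all add: increasing_disjointly, simp add: increasing_def)

lemma Pr_disjoint_power:
  assumes "finite E" "increasing A"
  shows "Pr E (disjoint_power k A) \<le> Pr E A ^ k"
proof (induction k)
  case 0
  then show ?case using assms by (simp add: Pr_le_1)
next
  case (Suc k)
  have "Pr E (disjointly A (disjoint_power k A)) \<le> Pr E A * Pr E (disjoint_power k A)"
    by (rule van_den_berg_kesten [OF assms increasing_disjoint_power])
  also have "\<dots> \<le> Pr E A * Pr E A ^ k" using Suc by (intro mult_left_mono Pr_nonneg)
  finally show ?case by simp
qed

lemma disjoint_powerI:
  assumes "finite J" "\<And>j. j \<in> J \<Longrightarrow> A (F j)" "disjoint_family_on F J"
  shows "disjoint_power (card J) A (\<Union>(F ` J))"
  using assms
proof (induction J)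
  case (insert j J)
  have "disjoint_power (card J) A (\<Union>(F ` J))"
    using insert by (auto simp: disjoint_family_on_def)
  moreover have "F j \<inter> \<Union>(F ` J) = {}"
    using insert by (auto simp: disjoint_family_on_def)
  ultimately have "disjointly A (disjoint_power (card J) A) (F j \<union> \<Union>(F ` J))"
    unfolding disjointly_def using insert.prems(1) [of j] by blast
  then show ?case using insert.hyps by simp
qed simp

section \<open>Transitions of the translated crossings\<close>

lemma mid_eq_mid:
  assumes "adj a b" "adj a' b'" "a \<in> cls i" "a' \<in> cls i" "mid a b = mid a' b'"
  shows "a = a' \<or> b = a'"
  using assms(2)
proof (cases rule: adj_cases)
  case 1 then show ?thesis using mid_eq_cases [OF assms(1,3,4), of 0 1] assms(5) by simp
next
  case 2 then show ?thesis using mid_eq_cases [OF assms(1,3,4), of 0 "-1"] assms(5) by simp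
next
  case 3 then show ?thesis using mid_eq_cases [OF assms(1,3,4), of 1 0] assms(5) by simp
next
  case 4 then show ?thesis using mid_eq_cases [OF assms(1,3,4), of "-1" 0] assms(5) by simp
qed

text \<open>The uncrossed rectangle contains a closed vertical dual crossing. Its potential is
  constant along open walks of the same height, false up to column \<open>x\<close> and true from
  column \<open>x + N\<close> on, so walks started on the two sides have no common end
  \<open>w\<close>.\<close>

lemma dual_crossing_separates:
  assumes par: "even x" "even N" "even H" "N > 0" "H \<ge> 0" and no: "\<not> hcross 0 x (x + N) 0 H \<omega>"
    and w: "conn (rect 0 a b 0 H) \<omega> u w" "u \<in> rect 0 a b 0 H" "fst u \<le> x"
    and w': "conn (rect 0 a' b' 0 H) \<omega> u' w" "u' \<in> rect 0 a' b' 0 H" "x + N \<le> fst u'"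
  shows False
proof -
  have "vcross (0 + 1) (x + 1) (x + N - 1) (0 - 1) (H + 1) (- \<omega>)"
    by (rule hcross_or_dual) (use par no in auto)
  then obtain s t where s: "s \<in> rect 1 (x + 1) (x + N - 1) (-1) (H + 1)" "snd s = -1" "snd t = H + 1"
     "conn (rect 1 (x + 1) (x + N - 1) (-1) (H + 1)) (- \<omega>) s t"
    unfolding vcross_def by auto
  show False
  proof (rule walk_separation [OF s(4) rect_cls s(1)])
    show "snd s < snd t" using s par by simp
    fix \<psi>
    assume 1: "\<And>f g. f \<in> cls (1 + 1) \<Longrightarrow> f \<in> band s t \<Longrightarrow> g \<in> band s t \<Longrightarrow> adj f g \<Longrightarrow>
         mid f g \<notin> - \<omega> \<or> (\<forall>u\<in>rect 1 (x + 1) (x + N - 1) (-1) (H + 1). \<forall>v\<in>rect 1 (x + 1) (x + N - 1)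
             (-1) (H + 1).
           adj u v \<longrightarrow> mid u v \<noteq> mid f g) \<Longrightarrow> \<psi> f = \<psi> g"
      and 4: "\<And>f. (\<forall>w\<in>rect 1 (x + 1) (x + N - 1) (-1) (H + 1). fst f < fst w) \<Longrightarrow> \<not> \<psi> f"
      and 5: "\<And>f. f \<in> cls (1 + 1) \<Longrightarrow> f \<in> band s t \<Longrightarrow>
         (\<forall>w\<in>rect 1 (x + 1) (x + N - 1) (-1) (H + 1). fst w < fst f) \<Longrightarrow> \<psi> f"
    have const: "\<psi> u = \<psi> w" if "conn (rect 0 a b 0 H) \<omega> u w" for a b u w
      using that
    proof (induction rule: conn_induct)
      case (step v w)
      have "\<psi> v = \<psi> w"
        by (rule 1) (use step s par in \<open>auto simp: mem_cls band_def mem_rect\<close>)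
      with step(6) show ?case by simp
    qed simp
    have "\<not> \<psi> u" by (rule 4) (use w in \<open>auto simp: mem_rect\<close>)
    moreover have "\<psi> u'" by (rule 5) (use w' s in \<open>auto simp: mem_rect mem_cls band_def\<close>)
    ultimately show False using const [OF w(1)] const [OF w'(1)] by simp
  qed
qed

text \<open>Every down-transition of the family of translated crossings contributes a crossing of the
  common part, and dual crossings keep these crossings apart.\<close>

lemma transitions_disjoint_power:
  fixes k N H K :: int
  assumes par: "even k" "even N" "even H" "even K" and k: "k > 0" "K < N" "H \<ge> 0"
    and J: "finite J" "\<And>j. j \<in> J \<Longrightarrow> int j * k \<le> K"
      "\<And>j. j \<in> J \<Longrightarrow> hcross 0 (int j * k) (int j * k + N) 0 H \<omega>"
      "\<And>j. j \<in> J \<Longrightarrow> \<not> hcross 0 (int (Suc j) * k) (int (Suc j) * k + N) 0 H \<omega>"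
  shows "disjoint_power (card J) (hcross 0 K N 0 H) \<omega>"
proof -
  define V where "V j = rect 0 (int j * k) (int j * k + N) 0 H" for j
  have "\<exists>u v. u \<in> V j \<and> fst u = int j * k \<and> fst v = int j * k + N \<and> conn (V j) \<omega> u v" if "j \<in> J" for j
    using J(3) [OF that] unfolding hcross_def V_def by blast
  then obtain u v where uv: "\<And>j. j \<in> J \<Longrightarrow> u j \<in> V j" "\<And>j. j \<in> J \<Longrightarrow> fst (u j) = int j * k"
     "\<And>j. j \<in> J \<Longrightarrow> fst (v j) = int j * k + N" "\<And>j. j \<in> J \<Longrightarrow> conn (V j) \<omega> (u j) (v j)"
    by metis
  \<comment> \<open>The witness is the whole cluster of the crossing within its translate, so that
    every vertex of a witness is connected to both ends of the crossing.\<close>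
  define F where "F j = \<omega> \<inter> {mid a b | a b. a \<in> V j \<and> b \<in> V j \<and> adj a b \<and> conn (V j) \<omega> (u j) a \<and>
      conn (V j) \<omega> (u j) b}" for j
  \<comment> \<open>The columns from \<open>K\<close> to \<open>N\<close> belong to every translate
    because \<open>int j * k\<close> is at most \<open>K\<close>; there all crossings become
    crossings of one and the same rectangle.\<close>
  have A: "hcross 0 K N 0 H (F j)" if j: "j \<in> J" for j
  proof -
    have "conn (V j) (F j) (u j) (v j)"
      using conn_edges [OF uv(4) [OF j]] unfolding F_def
      by (rule conn_mono) (use conn_in uv(1) [OF j] in blast)+
    then have "hcross 0 (int j * k) (int j * k + N) 0 H (F j)"
      unfolding hcross_def using uv(1-3) [OF j] unfolding V_def by blast
    then show ?thesis
      by (rule hcross_narrow [rotated -1]) (use par k J(2) [OF j] in auto)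
  qed
  \<comment> \<open>A shared edge would give a vertex connected to the left end of crossing
    \<open>i\<close> and to the right end of crossing \<open>j\<close>. As \<open>i < j\<close>,
    these ends lie on opposite sides of translate \<open>Suc i\<close>, which is not
    crossed.\<close>
  have sep: "F i \<inter> F j = {}" if ij: "i \<in> J" "j \<in> J" "i < j" for i j
  proof (rule ccontr)
    assume "F i \<inter> F j \<noteq> {}"
    then obtain e where "e \<in> F i" "e \<in> F j" by blast
    obtain a b where ab: "a \<in> V i" "adj a b" "conn (V i) \<omega> (u i) a" "conn (V i) \<omega> (u i) b" "e = mid a b"
      using \<open>e \<in> F i\<close> unfolding F_def by blast
    obtain a' b' where ab': "a' \<in> V j" "adj a' b'" "conn (V j) \<omega> (u j) a'" "e = mid a' b'"
      using \<open>e \<in> F j\<close> unfolding F_def by blast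
    have "a \<in> cls 0" "a' \<in> cls 0" using ab(1) ab'(1) rect_cls unfolding V_def by blast+
    then have "conn (V i) \<omega> (u i) a'" using mid_eq_mid [of a b a' b' 0] ab ab' by auto
    moreover have "conn (V j) \<omega> (v j) a'" using conn_trans [OF conn_sym [OF uv(4) [OF ij(2)]] ab'(3)] .
    moreover have "v j \<in> V j" using conn_in [OF uv(4) [OF ij(2)] uv(1) [OF ij(2)]] .
    moreover have "0 < N"
      using J(2) [OF ij(1)] k(1,2) mult_nonneg_nonneg [of "int i" k] by linarith
    moreover have "int (Suc i) * k \<le> int j * k" using ij(3) k(1) by (intro mult_right_mono) auto
    moreover have "int i * k \<le> int (Suc i) * k" using k(1) by (intro mult_right_mono) auto
    ultimately show False
      using dual_crossing_separates [of "int (Suc i) * k" N H \<omega> "int i * k" "int i * k + N" "u i" a'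
          "int j * k" "int j * k + N" "v j"] uv(1,2,3) ij par k J(4) [OF ij(1)]
      by (simp add: V_def)
  qed
  have "disjoint_family_on F J"
    unfolding disjoint_family_on_def using sep by (metis Int_commute linorder_neqE_nat)
  then have "disjoint_power (card J) (hcross 0 K N 0 H) (\<Union>(F ` J))"
    using J(1) A by (intro disjoint_powerI)
  then show ?thesis
    by (rule increasingD [OF increasing_disjoint_power]) (auto simp: F_def)
qed

text \<open>The expected count is the sum over \<open>t \<ge> 1\<close> of the probabilities of at
  least \<open>t\<close> occurrences, here dominated by a geometric series.\<close>

lemma mean_card_le:
  fixes P :: "nat \<Rightarrow> 'a set \<Rightarrow> bool" and l :: nat
  assumes "finite E" "\<And>\<omega> t. \<omega> \<subseteq> E \<Longrightarrow> Pr E (\<lambda>\<omega>. t \<le> card {j. j < l \<and> P j \<omega>}) \<le> s ^ t" "0 \<le> s" "s < 1"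
  shows "(\<Sum>j<l. Pr E (P j)) \<le> 1 / (1 - s)"
proof -
  let ?c = "\<lambda>\<omega>. card {j. j < l \<and> P j \<omega>}"
  have le: "?c \<omega> \<le> l" for \<omega> using card_mono [of "{..<l}" "{j. j < l \<and> P j \<omega>}"] by auto
  have "(\<Sum>j<l. Pr E (P j)) = mean E (\<lambda>\<omega>. \<Sum>j<l. of_bool (P j \<omega>))"
    unfolding Pr_def by (rule mean_sum [symmetric])
  also have "\<dots> = mean E (\<lambda>\<omega>. real (?c \<omega>))"
    by (rule mean_cong) (simp add: sum_of_bool_eq Int_def)
  also have "\<dots> = mean E (\<lambda>\<omega>. \<Sum>t = 1..l. of_bool (t \<le> ?c \<omega>))"
  proof (rule mean_cong)
    fix \<omega>
    have "{1..l} \<inter> {t. t \<le> ?c \<omega>} = {1..?c \<omega>}" using le [of \<omega>] by auto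
    then show "real (?c \<omega>) = (\<Sum>t = 1..l. of_bool (t \<le> ?c \<omega>))"
      by (simp add: sum_of_bool_eq)
  qed
  also have "\<dots> = (\<Sum>t = 1..l. Pr E (\<lambda>\<omega>. t \<le> ?c \<omega>))"
    unfolding Pr_def by (rule mean_sum)
  also have "\<dots> \<le> (\<Sum>t = 1..l. s ^ t)"
    using assms(2) by (intro sum_mono) auto
  also have "\<dots> \<le> (\<Sum>t<Suc l. s ^ t)"
    using assms(3) by (intro sum_mono2) auto
  also have "\<dots> = (1 - s ^ Suc l) / (1 - s)"
    using sum_gp_strict [of s "Suc l"] assms(4) by simp
  also have "\<dots> \<le> 1 / (1 - s)"
    using assms(3,4) by (intro divide_right_mono) auto
  finally show ?thesis .
qed

text \<open>By translation invariance all \<open>l\<close> transitions have the same probability, so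
  \<open>l\<close> times it is the expected number of disappearances. At least \<open>t\<close> of
  them force \<open>t\<close> disjoint crossings of the common rectangle, which has probability at
  most \<open>s ^ t\<close>.\<close>

lemma Pr_transition:
  fixes k N H K :: int
  assumes par: "even k" "even N" "even H" "even K" and k: "k > 0" "K < N" "H \<ge> 0"
    and l: "int l * k \<le> K" and E: "finite E" "{0..K + N} \<times> {0..H} \<subseteq> E"
    and s: "Pr E (hcross 0 K N 0 H) \<le> s" "s < 1"
  shows "real l * Pr E (\<lambda>\<omega>. hcross 0 0 N 0 H \<omega> \<and> \<not> hcross 0 k (k + N) 0 H \<omega>) \<le> 1 / (1 - s)"
proof -
  define P where "P j \<omega> \<longleftrightarrow> hcross 0 (int j * k) (int j * k + N) 0 H \<omega> \<and>
    \<not> hcross 0 (int (Suc j) * k) (int (Suc j) * k + N) 0 H \<omega>" for j \<omega>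
  have s0: "0 \<le> s" using s(1) Pr_nonneg order_trans by blast
  have bd: "int j * k \<le> K" if "j \<le> l" for j
    using mult_right_mono [of "int j" "int l" k] that l k(1) by linarith
  have "(\<Sum>j<l. Pr E (P j)) \<le> 1 / (1 - s)"
  proof (rule mean_card_le [OF E(1) _ s0 s(2)])
    fix t
    have "Pr E (\<lambda>\<omega>. t \<le> card {j. j < l \<and> P j \<omega>}) \<le> Pr E (disjoint_power t (hcross 0 K N 0 H))"
    proof (rule Pr_mono)
      fix \<omega> assume "t \<le> card {j. j < l \<and> P j \<omega>}"
      then obtain J where J: "J \<subseteq> {j. j < l \<and> P j \<omega>}" "card J = t" "finite J"
        by (rule obtain_subset_with_card_n)
      have "disjoint_power (card J) (hcross 0 K N 0 H) \<omega>"
        by (rule transitions_disjoint_power [OF par k J(3)]) (use J(1) bd in \<open>auto simp: P_def\<close>)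
      then show "disjoint_power t (hcross 0 K N 0 H) \<omega>" using J(2) by simp
    qed
    also have "\<dots> \<le> Pr E (hcross 0 K N 0 H) ^ t"
      by (rule Pr_disjoint_power [OF E(1) increasing_hcross])
    also have "\<dots> \<le> s ^ t" using s(1) by (intro power_mono Pr_nonneg)
    finally show "Pr E (\<lambda>\<omega>. t \<le> card {j. j < l \<and> P j \<omega>}) \<le> s ^ t" .
  qed
  moreover have "Pr E (P j) = Pr E (\<lambda>\<omega>. hcross 0 0 N 0 H \<omega> \<and> \<not> hcross 0 k (k + N) 0 H \<omega>)"
      if j: "j < l" for j
  proof -
    let ?F = "{0..k + N} \<times> {0..H}"
    have jk: "0 \<le> int j * k" "int j * k + k \<le> K"
      using bd [of "Suc j"] j k(1) by (auto simp: algebra_simps)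
    have "depends_on ?F (hcross 0 0 N 0 H)" "depends_on ?F (hcross 0 k (k + N) 0 H)"
      using k by (auto intro!: depends_on_hcross)
    then have dep: "depends_on ?F (\<lambda>\<omega>. hcross 0 0 N 0 H \<omega> \<and> \<not> hcross 0 k (k + N) 0 H \<omega>)"
      by (simp add: depends_on_def)
    have F: "?F \<subseteq> E" "shift (int j * k) 0 ` ?F \<subseteq> E"
      using E(2) jk by (auto simp: shift_def)
    have "Pr E (\<lambda>\<omega>. hcross 0 0 N 0 H (shift (int j * k) 0 -` \<omega>) \<and>
        \<not> hcross 0 k (k + N) 0 H (shift (int j * k) 0 -` \<omega>)) =
        Pr E (\<lambda>\<omega>. hcross 0 0 N 0 H \<omega> \<and> \<not> hcross 0 k (k + N) 0 H \<omega>)"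
      by (rule Pr_vimage [OF dep E(1) F inj_shift])
    moreover have "hcross 0 0 N 0 H (shift (int j * k) 0 -` \<omega>) =
        hcross 0 (int j * k) (int j * k + N) 0 H \<omega>"
      "hcross 0 k (k + N) 0 H (shift (int j * k) 0 -` \<omega>) =
          hcross 0 (int (Suc j) * k) (int (Suc j) * k + N) 0 H \<omega>" for \<omega>
      using par by (subst hcross_shift [of 0 0]; simp add: algebra_simps)+
    ultimately show ?thesis by (simp add: P_def [abs_def])
  qed
  ultimately show ?thesis by simp
qed

section \<open>Horizontal and vertical shifts of the self-dual rectangle\<close>

text \<open>A long crossing of the dual rectangle, which exists with probability at least 1/128,
  prevents the crossing.\<close>

lemma Pr_narrow_crossing:
  fixes n :: nat
  assumes n: "n \<ge> 14" and N: "N = 2 * (int n - 1)" and K: "K = N - 4 * ((int n - 1) div 3) - 4"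
    and E: "finite E" "{0..N} \<times> {0..N - 2} \<subseteq> E"
  shows "Pr E (hcross 0 K N 0 (N - 2)) \<le> 127 / 128"
proof -
  \<comment> \<open>Rounding down still gives \<open>3 * m + 4 \<ge> N\<close>, so the long
    rectangle of \<open>russo_seymour_welsh\<close> covers the length of the dual rectangle, and
    \<open>K = N - 2 * m - 4\<close> makes the width of the latter exactly \<open>M\<close>.\<close>
  define m where "m = 2 * ((int n - 1) div 3)"
  define M where "M = 2 * m + 2"
  have mf: "even m" "m \<ge> 2" "N \<le> 3 * m + 4" "even N" "K = N - 2 * m - 4" "0 \<le> K"
    using n unfolding m_def N K by presburger+
  interpret rsw m M by unfold_locales (use mf M_def in auto)
  define B where "B = {- (4 * N)..4 * N} \<times> {- (4 * N)..4 * N}"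
  have mN: "m \<le> N" using mf(2,5,6) by linarith
  have B: "finite B" by (simp add: B_def)
  have ends: "m - M + (M - m - 1) = -1" "M + (M - m - 1) = 3 * m + 3" "0 + (K + 1) = K + 1"
      "M + (K + 1) = N - 1"
    using mf by (simp_all add: M_def)
  have "1 / 128 \<le> Pr B (hcross 0 (m - M) M 0 M)"
    by (rule russo_seymour_welsh [OF B]) (use mf mN in \<open>auto simp: B_def M_def\<close>)
  also have "\<dots> = Pr B (hcross 1 (m - M + (M - m - 1)) (M + (M - m - 1)) (0 + (K + 1)) (M + (K + 1)))"
    by (rule Pr_hcross_shift [OF _ _ B, symmetric]) (use mf mN in \<open>auto simp: B_def M_def\<close>)
  also have "\<dots> = Pr B (hcross 1 (-1) (3 * m + 3) (K + 1) (N - 1))"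
    by (simp only: ends)
  also have "\<dots> \<le> Pr B (hcross 1 (-1) (N - 1) (K + 1) (N - 1))"
    by (rule Pr_mono) (rule hcross_narrow [rotated -1], assumption, use mf in auto)
  also have "\<dots> = Pr B (vcross 1 (K + 1) (N - 1) (-1) (N - 1))"
    by (rule Pr_vcross_hcross [OF B, symmetric]) (use mf in \<open>auto simp: B_def\<close>)
  also have "\<dots> = 1 - Pr B (hcross 0 K N 0 (N - 2))"
    by (subst Pr_hcross_dual) (use mf B in \<open>auto simp: B_def\<close>)
  also have "Pr B (hcross 0 K N 0 (N - 2)) = Pr ({0..N} \<times> {0..N - 2}) (hcross 0 K N 0 (N - 2))"
    by (rule Pr_restrict [OF depends_on_hcross B]) (use mf in \<open>auto simp: B_def\<close>)
  also have "\<dots> = Pr E (hcross 0 K N 0 (N - 2))"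
    by (rule Pr_restrict [OF depends_on_hcross E, symmetric]) (use mf in auto)
  finally show ?thesis by simp
qed

text \<open>For events of equal probability, such as translates of one event, the first two terms
  cancel and only the disappearance of \<open>B\<close> has to be estimated.\<close>

lemma Pr_differ_swap: "Pr E (\<lambda>\<omega>. A \<omega> \<noteq> B \<omega>) = Pr E A - Pr E B + 2 * Pr E (\<lambda>\<omega>. B \<omega> \<and> \<not> A \<omega>)"
proof -
  have "mean E (\<lambda>\<omega>. of_bool (A \<omega> \<noteq> B \<omega>)) =
      mean E (\<lambda>\<omega>. (of_bool (A \<omega>) - of_bool (B \<omega>)) + 2 * of_bool (B \<omega> \<and> \<not> A \<omega>))"
    by (rule mean_cong) (auto simp: of_bool_def)
  then show ?thesis unfolding Pr_def mean_add mean_diff mean_cmult .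
qed

text \<open>If \<open>l\<close> steps of length \<open>2 * j\<close> fit into \<open>K\<close>, a
  disappearance has probability at most \<open>128 / l\<close>. Doubling for the appearances and
  inserting \<open>n \<le> 3 * K\<close> and \<open>K < 4 * l * j\<close> gives 2 * 128 * 12 = 3072.
  If no step fits, the bound exceeds 1.\<close>

lemma Pr_hshift:
  fixes n j :: nat
  assumes n: "n \<ge> 14" and N: "N = 2 * (int n - 1)"
    and E: "finite E" "{0..2 * int j + N} \<times> {0..N - 2} \<subseteq> E"
  shows "Pr E (\<lambda>\<omega>. hcross 0 (2 * int j) (2 * int j + N) 0 (N - 2) \<omega> \<noteq> hcross 0 0 N 0 (N - 2) \<omega>) \<le>
      3072 * real j / real n"
proof (cases "j = 0")
  case True
  then show ?thesis using E(1) by (simp add: Pr_def)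
next
  case False
  define c where "c = (int n - 1) div 3"
  define K where "K = N - 4 * c - 4"
  \<comment> \<open>The last inequality is the source of the bound 14 on \<open>n\<close>: it fails
    for \<open>n = 13\<close>.\<close>
  have c: "3 * c \<le> int n - 1" "even N" "even K" "K < N" "N \<ge> 2" "K \<ge> 0" "int n \<le> 3 * K"
    using n unfolding K_def N c_def by presburger+
  define l where "l = nat (K div (2 * int j))"
  define B where "B = {0..K + N + 2 * int j} \<times> {0..N - 2} \<union> E"
  have B: "finite B" "{0..2 * int j + N} \<times> {0..N - 2} \<subseteq> B" "{0..K + N} \<times> {0..N - 2} \<subseteq> B"
      "{0..N} \<times> {0..N - 2} \<subseteq> B"
    using E c by (auto simp: B_def)
  let ?d = "Pr B (\<lambda>\<omega>. hcross 0 (2 * int j) (2 * int j + N) 0 (N - 2) \<omega> \<noteq> hcross 0 0 N 0 (N - 2) \<omega>)"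
  have dep: "depends_on ({0..2 * int j + N} \<times> {0..N - 2}) (hcross 0 (2 * int j) (2 * int j + N)
      0 (N - 2))"
    "depends_on ({0..2 * int j + N} \<times> {0..N - 2}) (hcross 0 0 N 0 (N - 2))"
    by (auto intro!: depends_on_hcross)
  have "Pr B (hcross 0 (0 + 2 * int j) (N + 2 * int j) (0 + 0) (N - 2 + 0)) =
      Pr B (hcross 0 0 N 0 (N - 2))"
    by (rule Pr_hcross_shift [OF _ _ B(1)]) (use B in auto)
  then have d: "?d = 2 * Pr B (\<lambda>\<omega>. hcross 0 0 N 0 (N - 2) \<omega> \<and>
      \<not> hcross 0 (2 * int j) (2 * int j + N) 0 (N - 2) \<omega>)"
    unfolding Pr_differ_swap by (simp add: add.commute)
  have q: "K div (2 * int j) * (2 * int j) + K mod (2 * int j) = K" by (rule div_mult_mod_eq)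
  have r: "0 \<le> K mod (2 * int j)" "K mod (2 * int j) < 2 * int j" using False by simp_all
  have "0 \<le> K div (2 * int j)" using c False by (simp add: pos_imp_zdiv_nonneg_iff)
  then have l: "int l = K div (2 * int j)" by (simp add: l_def)
  have lj: "int l * (2 * int j) \<le> K" using q r unfolding l by linarith
  have s: "Pr B (hcross 0 K N 0 (N - 2)) \<le> 127 / 128"
    by (rule Pr_narrow_crossing [OF n N _ B(1,4)]) (simp add: K_def c_def)
  have "real l * Pr B (\<lambda>\<omega>. hcross 0 0 N 0 (N - 2) \<omega> \<and>
      \<not> hcross 0 (2 * int j) (2 * int j + N) 0 (N - 2) \<omega>) \<le> 1 / (1 - 127 / 128)"
    by (rule Pr_transition [OF _ _ _ _ _ _ _ lj B(1,3) s]) (use c False in auto)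
  then have ld: "real l * ?d \<le> 256"
    unfolding d mult.left_commute [of "real l" 2] by simp
  have "?d \<le> 3072 * real j / real n"
  proof (cases "K \<ge> 2 * int j")
    case True
    have "K < int l * (2 * int j) + 2 * int j" using q r unfolding l by linarith
    moreover have "1 \<le> l"
    proof (rule ccontr)
      assume "\<not> 1 \<le> l"
      then have "K div (2 * int j) = 0" using l by simp
      then show False using q r(2) True by simp
    qed
    ultimately have "K < 2 * (int l * (2 * int j))"
      using mult_right_mono [of 1 "int l" "2 * int j"] by linarith
    then have "int n < 12 * int l * int j" using c by linarith
    then have "real_of_int (int n) \<le> real_of_int (12 * int l * int j)" by linarith
    then have "real n \<le> 12 * real l * real j" by simp
    then have "?d * real n \<le> ?d * (12 * real l * real j)" by (intro mult_left_mono Pr_nonneg)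
    also have "\<dots> = (real l * ?d) * (12 * real j)" by simp
    also have "\<dots> \<le> 256 * (12 * real j)" using ld by (intro mult_right_mono) auto
    finally show ?thesis using n by (simp add: field_simps)
  next
    case False
    then have "int n \<le> 6 * int j" using c by linarith
    then have "real n \<le> 3072 * real j" by linarith
    then have "1 \<le> 3072 * real j / real n" using n by (simp add: field_simps)
    then show ?thesis using Pr_le_1 [OF B(1)] order_trans by blast
  qed
  moreover have "Pr E (\<lambda>\<omega>. hcross 0 (2 * int j) (2 * int j + N) 0 (N - 2) \<omega> \<noteq> hcross 0 0 N 0 (N -
      2) \<omega>) = ?d"
  proof -
    have dd: "depends_on ({0..2 * int j + N} \<times> {0..N - 2}) (\<lambda>\<omega>. hcross 0 (2 * int j) (2 * int j +
        N) 0 (N - 2) \<omega> \<noteq> hcross 0 0 N 0 (N - 2) \<omega>)"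
      using dep by (simp add: depends_on_def)
    show ?thesis using Pr_restrict [OF dd E] Pr_restrict [OF dd B(1,2)] by simp
  qed
  ultimately show ?thesis by simp
qed

lemma depends_on_vimage:
  assumes "depends_on F f" "inj \<pi>"
  shows "depends_on (\<pi> ` F) (\<lambda>\<omega>. f (\<pi> -` \<omega>))"
  unfolding depends_on_def
proof
  fix \<omega>
  have "\<pi> -` (\<omega> \<inter> \<pi> ` F) = (\<pi> -` \<omega>) \<inter> F" using assms(2) by (auto dest: injD)
  then show "f (\<pi> -` (\<omega> \<inter> \<pi> ` F)) = f (\<pi> -` \<omega>)" using assms(1) by (simp add: depends_on_def)
qed

lemma depends_on_mono: "depends_on F f \<Longrightarrow> F \<subseteq> F' \<Longrightarrow> depends_on F' f"
  unfolding depends_on_def by (metis inf.absorb_iff2 inf.assoc inf_commute)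

text \<open>The complement of the crossing at height \<open>c\<close> is a closed vertical dual
  crossing. Exchanging the axes and moving by an odd vector, which is \<open>\<tau>\<close>, turns
  it into the horizontal crossing of the original rectangle shifted by \<open>c\<close> to the
  right, so a vertical shift becomes a horizontal one.\<close>

lemma Pr_vshift:
  fixes n j :: nat
  assumes n: "n \<ge> 14" and N: "N = 2 * (int n - 1)"
    and E: "finite E" "{0..N} \<times> {0..2 * int j + N - 2} \<subseteq> E"
  shows "Pr E (\<lambda>\<omega>. hcross 0 0 N (2 * int j) (2 * int j + N - 2) \<omega> \<noteq> hcross 0 0 N 0 (N - 2) \<omega>) \<le>
      3072 * real j / real n"
proof -
  define B where "B = {-1..2 * int j + N + 1} \<times> {-1..2 * int j + N + 1}"
  define \<tau> where "\<tau> = prod.swap \<circ> shift (-1) 1"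
  define G where "G c = hcross 0 c (c + N) 0 (N - 2)" for c
  have N2: "even N" "N > 2" using n N by auto
  have B: "finite B" "{0..2 * int j + N} \<times> {0..N - 2} \<subseteq> B" "{0..N} \<times> {0..2 * int j + N - 2} \<subseteq> B"
    by (auto simp: B_def)
  have G: "hcross 0 0 N c (c + N - 2) \<omega> \<longleftrightarrow> \<not> G c (\<tau> -` (- \<omega>))" if c: "even c" for c \<omega>
  proof -
    have "hcross 0 0 N c (c + N - 2) \<omega> \<longleftrightarrow> \<not> vcross (0 + 1) (0 + 1) (N - 1) (c - 1) (c + N - 2 + 1) (- \<omega>)"
      by (rule hcross_dual) (use c N2 in auto)
    also have "\<dots> \<longleftrightarrow> \<not> hcross 1 (c + -1) (c + N + -1) (0 + 1) (N - 2 + 1) (prod.swap -` (- \<omega>))"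
      by (simp add: hcross_swap)
    also have "\<dots> \<longleftrightarrow> \<not> G c (shift (-1) 1 -` (prod.swap -` (- \<omega>)))"
      unfolding G_def by (subst hcross_shift [of 0 1]) auto
    finally show ?thesis by (simp add: \<tau>_def vimage_comp)
  qed
  have inj: "inj \<tau>" unfolding \<tau>_def by (intro inj_compose inj_shift) simp
  have dep: "depends_on ({0..2 * int j + N} \<times> {0..N - 2}) (\<lambda>\<omega>. G (2 * int j) \<omega> \<noteq> G 0 \<omega>)"
  proof -
    have "depends_on ({0..2 * int j + N} \<times> {0..N - 2}) (G (2 * int j))"
      "depends_on ({0..2 * int j + N} \<times> {0..N - 2}) (G 0)"
      unfolding G_def by (auto intro!: depends_on_hcross)
    then show ?thesis by (simp add: depends_on_def)
  qed
  have \<tau>B: "\<tau> ` ({0..2 * int j + N} \<times> {0..N - 2}) \<subseteq> B"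
    using N2 by (auto simp: \<tau>_def shift_def B_def)
  have e: "(\<lambda>\<omega>. hcross 0 0 N (2 * int j) (2 * int j + N - 2) \<omega> \<noteq> hcross 0 0 N 0 (N - 2) \<omega>) =
      (\<lambda>\<omega>. G (2 * int j) (\<tau> -` (- \<omega>)) \<noteq> G 0 (\<tau> -` (- \<omega>)))"
    using G [of "2 * int j"] G [of 0] by auto
  have "depends_on ({0..N} \<times> {0..2 * int j + N - 2})
      (\<lambda>\<omega>. hcross 0 0 N (2 * int j) (2 * int j + N - 2) \<omega> \<noteq> hcross 0 0 N 0 (N - 2) \<omega>)"
  proof -
    have "depends_on ({0..N} \<times> {0..2 * int j + N - 2}) (hcross 0 0 N (2 * int j) (2 * int j + N - 2))"
      "depends_on ({0..N} \<times> {0..2 * int j + N - 2}) (hcross 0 0 N 0 (N - 2))"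
      by (auto intro!: depends_on_hcross)
    then show ?thesis by (simp add: depends_on_def)
  qed
  then have "Pr E (\<lambda>\<omega>. hcross 0 0 N (2 * int j) (2 * int j + N - 2) \<omega> \<noteq> hcross 0 0 N 0 (N - 2) \<omega>) =
      Pr B (\<lambda>\<omega>. hcross 0 0 N (2 * int j) (2 * int j + N - 2) \<omega> \<noteq> hcross 0 0 N 0 (N - 2) \<omega>)"
    using Pr_restrict [OF _ E] Pr_restrict [OF _ B(1,3)] by simp
  also have "\<dots> = Pr B (\<lambda>\<omega>. G (2 * int j) (\<tau> -` \<omega>) \<noteq> G 0 (\<tau> -` \<omega>))"
    unfolding e by (rule Pr_Compl [OF depends_on_vimage [OF dep inj] B(1) \<tau>B])
  also have "\<dots> = Pr B (\<lambda>\<omega>. G (2 * int j) \<omega> \<noteq> G 0 \<omega>)"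
    by (rule Pr_vimage [OF dep B(1,2) \<tau>B inj])
  also have "\<dots> \<le> 3072 * real j / real n"
    using Pr_hshift [OF n N B(1,2)] by (simp add: G_def)
  finally show ?thesis .
qed

section \<open>Walsh expansion and averaging over translates\<close>

definition cross_at :: "nat \<Rightarrow> nat \<times> nat \<Rightarrow> site set \<Rightarrow> bool" where
  "cross_at n p = hcross 0 (2 * int (fst p)) (2 * int (fst p) + 2 * (int n - 1))
     (2 * int (snd p)) (2 * int (snd p) + 2 * (int n - 1) - 2)"

definition move :: "nat \<times> nat \<Rightarrow> site \<Rightarrow> site" where
  "move p = shift (2 * int (fst p)) (2 * int (snd p))"

text \<open>All integer sites are taken, vertices and faces along with midpoints. The additional
  coordinates are not read by crossing events and do not change their means.\<close>

definition site_box :: "nat \<Rightarrow> nat \<Rightarrow> site set" where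
  "site_box n k = {0..2 * int k + 2 * (int n - 1)} \<times> {0..2 * int k + 2 * (int n - 1) - 2}"

lemma finite_site_box: "finite (site_box n k)"
  by (simp add: site_box_def)

lemma site_box_mono: "j \<le> k \<Longrightarrow> site_box n j \<subseteq> site_box n k"
  by (auto simp: site_box_def)

lemma depends_on_cross_at: "fst p \<le> k \<Longrightarrow> snd p \<le> k \<Longrightarrow> depends_on (site_box n k) (cross_at n p)"
  unfolding cross_at_def site_box_def by (rule depends_on_hcross) auto

lemma inj_move: "inj (move p)"
  by (simp add: move_def inj_shift)

lemma cross_at_move: "cross_at n q (move p -` \<omega>) \<longleftrightarrow> cross_at n (fst p + fst q, snd p + snd q) \<omega>"
  unfolding cross_at_def move_def by (subst hcross_shift [of 0 0]; simp add: algebra_simps)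

lemma move_site_box: "fst p + j \<le> k \<Longrightarrow> snd p + j \<le> k \<Longrightarrow> move p ` site_box n j \<subseteq> site_box n k"
  by (auto simp: move_def shift_def site_box_def)

lemma Pr_cross_at_translate:
  assumes "fst p \<le> k" "snd p \<le> k" "fst q \<le> k" "snd q \<le> k" and E: "finite E" "site_box n (2 * k) \<subseteq> E"
  shows "Pr E (\<lambda>\<omega>. cross_at n (fst p + fst q, snd p + snd q) \<omega> \<noteq> cross_at n p \<omega>) =
    Pr E (\<lambda>\<omega>. cross_at n q \<omega> \<noteq> cross_at n (0, 0) \<omega>)"
proof -
  have "depends_on (site_box n k) (cross_at n q)" "depends_on (site_box n k) (cross_at n (0, 0))"
    using assms by (auto intro!: depends_on_cross_at)
  then have dep: "depends_on (site_box n k) (\<lambda>\<omega>. cross_at n q \<omega> \<noteq> cross_at n (0, 0) \<omega>)"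
    by (simp add: depends_on_def)
  have sub: "site_box n k \<subseteq> E" "move p ` site_box n k \<subseteq> E"
    using move_site_box [of p k "2 * k" n] site_box_mono [of k "2 * k" n] assms by auto
  have "Pr E (\<lambda>\<omega>. cross_at n q (move p -` \<omega>) \<noteq> cross_at n (0, 0) (move p -` \<omega>)) =
      Pr E (\<lambda>\<omega>. cross_at n q \<omega> \<noteq> cross_at n (0, 0) \<omega>)"
    by (rule Pr_vimage [OF dep E(1) sub inj_move])
  then show ?thesis by (simp only: cross_at_move) simp
qed

lemma Pr_cross_at_hdiff:
  assumes n: "n \<ge> 14" and "a \<le> k" "a' \<le> k" "b \<le> k" and E: "finite E" "site_box n (2 * k) \<subseteq> E"
  shows "Pr E (\<lambda>\<omega>. cross_at n (a, b) \<omega> \<noteq> cross_at n (a', b) \<omega>) \<le> 3072 * real k / real n"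
proof -
  have *: "Pr E (\<lambda>\<omega>. cross_at n (a + j, b) \<omega> \<noteq> cross_at n (a, b) \<omega>) \<le> 3072 * real k / real n"
    if "a + j \<le> k" for a j
  proof -
    have "Pr E (\<lambda>\<omega>. cross_at n (a + j, b) \<omega> \<noteq> cross_at n (a, b) \<omega>) =
        Pr E (\<lambda>\<omega>. cross_at n (j, 0) \<omega> \<noteq> cross_at n (0, 0) \<omega>)"
      using Pr_cross_at_translate [of "(a, b)" k "(j, 0)" E n] that assms by simp
    also have "\<dots> \<le> 3072 * real j / real n"
    proof -
      have "{0..2 * int j + 2 * (int n - 1)} \<times> {0..2 * (int n - 1) - 2} \<subseteq> E"
        using E(2) that by (auto simp: site_box_def subset_iff)
      from Pr_hshift [OF n refl E(1) this] show ?thesis by (simp add: cross_at_def)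
    qed
    also have "\<dots> \<le> 3072 * real k / real n" using that by (simp add: divide_right_mono)
    finally show ?thesis .
  qed
  show ?thesis
    using *[of a' "a - a'"] *[of a "a' - a"] assms(2,3) by (cases "a' \<le> a") (simp_all add: eq_commute)
qed

lemma Pr_cross_at_vdiff:
  assumes n: "n \<ge> 14" and "a \<le> k" "b \<le> k" "b' \<le> k" and E: "finite E" "site_box n (2 * k) \<subseteq> E"
  shows "Pr E (\<lambda>\<omega>. cross_at n (a, b) \<omega> \<noteq> cross_at n (a, b') \<omega>) \<le> 3072 * real k / real n"
proof -
  have *: "Pr E (\<lambda>\<omega>. cross_at n (a, b + j) \<omega> \<noteq> cross_at n (a, b) \<omega>) \<le> 3072 * real k / real n"
    if "b + j \<le> k" for b j
  proof -
    have "Pr E (\<lambda>\<omega>. cross_at n (a, b + j) \<omega> \<noteq> cross_at n (a, b) \<omega>) =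
        Pr E (\<lambda>\<omega>. cross_at n (0, j) \<omega> \<noteq> cross_at n (0, 0) \<omega>)"
      using Pr_cross_at_translate [of "(a, b)" k "(0, j)" E n] that assms by simp
    also have "\<dots> \<le> 3072 * real j / real n"
    proof -
      have "{0..2 * (int n - 1)} \<times> {0..2 * int j + 2 * (int n - 1) - 2} \<subseteq> E"
        using E(2) that by (auto simp: site_box_def subset_iff)
      from Pr_vshift [OF n refl E(1) this] show ?thesis by (simp add: cross_at_def)
    qed
    also have "\<dots> \<le> 3072 * real k / real n" using that by (simp add: divide_right_mono)
    finally show ?thesis .
  qed
  show ?thesis
    using *[of b' "b - b'"] *[of b "b' - b"] assms(3,4) by (cases "b' \<le> b") (simp_all add: eq_commute)
qed

lemma Pr_cross_at_diff:
  assumes n: "n \<ge> 14" and "fst p \<le> k" "snd p \<le> k" "fst q \<le> k" "snd q \<le> k"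
    and E: "finite E" "site_box n (2 * k) \<subseteq> E"
  shows "Pr E (\<lambda>\<omega>. cross_at n p \<omega> \<noteq> cross_at n q \<omega>) \<le> 6144 * real k / real n"
proof -
  obtain a b a' b' where pq: "p = (a, b)" "q = (a', b')" by (cases p; cases q)
  have "Pr E (\<lambda>\<omega>. cross_at n p \<omega> \<noteq> cross_at n q \<omega>) \<le>
      Pr E (\<lambda>\<omega>. cross_at n (a, b) \<omega> \<noteq> cross_at n (a', b) \<omega> \<or>
          cross_at n (a', b) \<omega> \<noteq> cross_at n (a', b') \<omega>)"
    unfolding pq by (rule Pr_mono) auto
  also have "\<dots> \<le> Pr E (\<lambda>\<omega>. cross_at n (a, b) \<omega> \<noteq> cross_at n (a', b) \<omega>) +
      Pr E (\<lambda>\<omega>. cross_at n (a', b) \<omega> \<noteq> cross_at n (a', b') \<omega>)"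
    by (rule Pr_union_le)
  also have "\<dots> \<le> 3072 * real k / real n + 3072 * real k / real n"
    by (rule add_mono [OF Pr_cross_at_hdiff Pr_cross_at_vdiff]) (use assms pq in auto)
  finally show ?thesis by simp
qed

section \<open>Walsh coefficients and sums of translates\<close>

definition walsh :: "'a set \<Rightarrow> 'a set \<Rightarrow> real" where
  "walsh S \<omega> = (-1) ^ card (S \<inter> \<omega>)"

definition fourier :: "'a set \<Rightarrow> ('a set \<Rightarrow> real) \<Rightarrow> 'a set \<Rightarrow> real" where
  "fourier E f S = mean E (\<lambda>\<omega>. f \<omega> * walsh S \<omega>)"

lemma fourier_empty: "fourier E f {} = mean E f"
  by (simp add: fourier_def walsh_def)

lemma fourier_sum: "fourier E (\<lambda>\<omega>. \<Sum>i\<in>I. f i \<omega>) S = (\<Sum>i\<in>I. fourier E (f i) S)"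
  by (simp add: fourier_def sum_distrib_right mean_sum)

lemma fourier_insert:
  assumes "finite E" "x \<notin> E" "S \<subseteq> E"
  shows "fourier (insert x E) f S = (fourier E f S + fourier E (\<lambda>\<omega>. f (insert x \<omega>)) S) / 2"
    and "fourier (insert x E) f (insert x S) = (fourier E f S - fourier E (\<lambda>\<omega>. f (insert x \<omega>)) S) / 2"
proof -
  have x: "x \<notin> S" and S: "finite S" using assms finite_subset by auto
  have 1: "walsh S (insert x \<omega>) = walsh S \<omega>" for \<omega>
    using x by (simp add: walsh_def)
  have 2: "walsh (insert x S) \<omega> = walsh S \<omega>" if "\<omega> \<subseteq> E" for \<omega>
  proof -
    have "insert x S \<inter> \<omega> = S \<inter> \<omega>" using that assms(2) by auto
    then show ?thesis by (simp add: walsh_def)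
  qed
  have 3: "walsh (insert x S) (insert x \<omega>) = - walsh S \<omega>" if "\<omega> \<subseteq> E" for \<omega>
  proof -
    have "insert x S \<inter> insert x \<omega> = insert x (S \<inter> \<omega>)" by auto
    then show ?thesis using x S by (simp add: walsh_def)
  qed
  show "fourier (insert x E) f S = (fourier E f S + fourier E (\<lambda>\<omega>. f (insert x \<omega>)) S) / 2"
    using assms by (simp add: fourier_def mean_insert 1)
  have "mean E (\<lambda>\<omega>. f \<omega> * walsh (insert x S) \<omega>) = fourier E f S"
    unfolding fourier_def by (rule mean_cong) (simp add: 2)
  moreover have "mean E (\<lambda>\<omega>. f (insert x \<omega>) * walsh (insert x S) (insert x \<omega>)) =
      - fourier E (\<lambda>\<omega>. f (insert x \<omega>)) S"
    unfolding fourier_def using mean_cmult [of E "-1" "\<lambda>\<omega>. f (insert x \<omega>) * walsh S \<omega>"]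
    by (simp add: 3 cong: mean_cong)
  ultimately show "fourier (insert x E) f (insert x S) =
      (fourier E f S - fourier E (\<lambda>\<omega>. f (insert x \<omega>)) S) / 2"
    using assms by (simp add: fourier_def [of "insert x E"] mean_insert)
qed

lemma parseval:
  assumes "finite E"
  shows "mean E (\<lambda>\<omega>. (f \<omega>)\<^sup>2) = (\<Sum>S\<in>Pow E. (fourier E f S)\<^sup>2)"
  using assms
proof (induction E arbitrary: f)
  case empty
  then show ?case by (simp add: fourier_empty)
next
  case (insert x E)
  let ?f = "\<lambda>\<omega>. f (insert x \<omega>)"
  have inj: "inj_on (insert x) (Pow E)" using insert.hyps by (auto simp: inj_on_def)
  have "(\<Sum>S\<in>Pow (insert x E). (fourier (insert x E) f S)\<^sup>2) =
      (\<Sum>S\<in>Pow E. (fourier (insert x E) f S)\<^sup>2) + (\<Sum>S\<in>insert x ` Pow E. (fourier (insert x E) f S)\<^sup>2)"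
    unfolding Pow_insert by (rule sum.union_disjoint) (use insert.hyps in auto)
  also have "\<dots> = (\<Sum>S\<in>Pow E. (fourier (insert x E) f S)\<^sup>2 + (fourier (insert x E) f (insert x S))\<^sup>2)"
    by (simp add: sum.reindex [OF inj] sum.distrib)
  also have "\<dots> = (\<Sum>S\<in>Pow E. ((fourier E f S)\<^sup>2 + (fourier E ?f S)\<^sup>2) / 2)"
    using insert.hyps by (intro sum.cong refl) (simp add: fourier_insert power2_eq_square field_simps)
  also have "\<dots> = (mean E (\<lambda>\<omega>. (f \<omega>)\<^sup>2) + mean E (\<lambda>\<omega>. (?f \<omega>)\<^sup>2)) / 2"
    by (simp add: insert.IH sum.distrib sum_divide_distrib [symmetric])
  also have "\<dots> = mean (insert x E) (\<lambda>\<omega>. (f \<omega>)\<^sup>2)"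
    using insert.hyps by (simp add: mean_insert)
  finally show ?case by simp
qed

lemma fourier_eq_0:
  assumes "depends_on U f" "finite E" "S \<subseteq> E" "\<not> S \<subseteq> U"
  shows "fourier E f S = 0"
proof -
  obtain x where x: "x \<in> S" "x \<notin> U" using assms(4) by blast
  have f: "f (insert x \<omega>) = f \<omega>" for \<omega>
    using assms(1) x(2) unfolding depends_on_def by (metis Int_insert_left)
  have "fourier (insert x (E - {x})) f (insert x (S - {x})) = 0"
    using assms by (subst fourier_insert) (auto simp: f)
  then show ?thesis using x(1) assms(3) by (simp add: insert_absorb subsetD)
qed

text \<open>Fix a nonempty \<open>S\<close> and some \<open>e\<close> in it. Only those
  \<open>h i\<close> with \<open>e \<in> U i\<close> have a coefficient at \<open>S\<close>, so
  Cauchy-Schwarz costs a factor \<open>C\<close> instead of the size of \<open>I\<close>. The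
  coefficient at the empty set vanishes by \<open>zero\<close>.\<close>

lemma mean_sum_square_le:
  assumes E: "finite E" and I: "finite I"
    and dep: "\<And>i. i \<in> I \<Longrightarrow> depends_on (U i) (h i)" and zero: "\<And>i. i \<in> I \<Longrightarrow> mean E (h i) = 0"
    and ov: "\<And>e. card {i\<in>I. e \<in> U i} \<le> C"
  shows "mean E (\<lambda>\<omega>. (\<Sum>i\<in>I. h i \<omega>)\<^sup>2) \<le> real C * (\<Sum>i\<in>I. mean E (\<lambda>\<omega>. (h i \<omega>)\<^sup>2))"
proof -
  have le: "(\<Sum>i\<in>I. fourier E (h i) S)\<^sup>2 \<le> real C * (\<Sum>i\<in>I. (fourier E (h i) S)\<^sup>2)" if S: "S \<in> Pow E" for S
  proof (cases "S = {}")
    case True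
    then show ?thesis using zero by (simp add: fourier_empty)
  next
    case False
    then obtain e where e: "e \<in> S" by blast
    define J where "J = {i\<in>I. e \<in> U i}"
    have J: "finite J" "J \<subseteq> I" using I by (auto simp: J_def)
    have z: "fourier E (h i) S = 0" if "i \<in> I - J" for i
      using that e S by (intro fourier_eq_0 [OF dep E]) (auto simp: J_def)
    have "(\<Sum>i\<in>I. fourier E (h i) S) = (\<Sum>i\<in>J. fourier E (h i) S)"
      using z by (intro sum.mono_neutral_right I J(2)) auto
    moreover have "(\<Sum>i\<in>I. (fourier E (h i) S)\<^sup>2) = (\<Sum>i\<in>J. (fourier E (h i) S)\<^sup>2)"
      using z by (intro sum.mono_neutral_right I J(2)) auto
    moreover have "(\<Sum>i\<in>J. fourier E (h i) S)\<^sup>2 \<le> (\<Sum>i\<in>J. (fourier E (h i) S)\<^sup>2) * real (card J)"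
      by (rule sum_squared_le_sum_of_squares)
    moreover have "(\<Sum>i\<in>J. (fourier E (h i) S)\<^sup>2) * real (card J) \<le>
        (\<Sum>i\<in>J. (fourier E (h i) S)\<^sup>2) * real C"
      using ov [of e] by (intro mult_left_mono sum_nonneg) (auto simp: J_def)
    ultimately show ?thesis by (simp add: mult.commute)
  qed
  have "mean E (\<lambda>\<omega>. (\<Sum>i\<in>I. h i \<omega>)\<^sup>2) = (\<Sum>S\<in>Pow E. (\<Sum>i\<in>I. fourier E (h i) S)\<^sup>2)"
    by (simp add: parseval [OF E] fourier_sum)
  also have "\<dots> \<le> (\<Sum>S\<in>Pow E. real C * (\<Sum>i\<in>I. (fourier E (h i) S)\<^sup>2))"
    by (rule sum_mono) (rule le)
  also have "\<dots> = real C * (\<Sum>i\<in>I. \<Sum>S\<in>Pow E. (fourier E (h i) S)\<^sup>2)"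
    unfolding sum_distrib_left [symmetric] by (subst sum.swap) simp
  also have "\<dots> = real C * (\<Sum>i\<in>I. mean E (\<lambda>\<omega>. (h i \<omega>)\<^sup>2))"
    by (simp add: parseval [OF E])
  finally show ?thesis .
qed

lemma mean_abs_le_sqrt:
  assumes "finite E"
  shows "mean E (\<lambda>\<omega>. \<bar>f \<omega>\<bar>) \<le> sqrt (mean E (\<lambda>\<omega>. (f \<omega>)\<^sup>2))"
proof (rule real_le_rsqrt)
  define \<mu> where "\<mu> = mean E (\<lambda>\<omega>. \<bar>f \<omega>\<bar>)"
  have "0 \<le> mean E (\<lambda>\<omega>. (\<bar>f \<omega>\<bar> - \<mu>)\<^sup>2)" by (rule mean_nonneg) simp
  also have "(\<lambda>\<omega>. (\<bar>f \<omega>\<bar> - \<mu>)\<^sup>2) = (\<lambda>\<omega>. ((f \<omega>)\<^sup>2 - (2 * \<mu>) * \<bar>f \<omega>\<bar>) + \<mu>\<^sup>2)"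
    by (simp add: power2_diff algebra_simps)
  also have "mean E \<dots> = mean E (\<lambda>\<omega>. (f \<omega>)\<^sup>2) - 2 * \<mu> * \<mu> + \<mu>\<^sup>2"
    unfolding mean_add mean_diff mean_cmult using assms by (simp add: \<mu>_def)
  finally show "(mean E (\<lambda>\<omega>. \<bar>f \<omega>\<bar>))\<^sup>2 \<le> mean E (\<lambda>\<omega>. (f \<omega>)\<^sup>2)"
    by (simp add: \<mu>_def power2_eq_square)
qed

definition crossing_sign :: "nat \<Rightarrow> nat \<times> nat \<Rightarrow> site set \<Rightarrow> real" where
  "crossing_sign n p \<omega> = (if cross_at n p \<omega> then 1 else -1)"

text \<open>Averaging over independent shifts \<open>s\<close> and \<open>t\<close> separates the
  sum of the \<open>H s\<close> from the crossing signs, which are bounded by 1. Replacing one sign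
  by another costs twice the probability 6144 k / n that they differ.\<close>

lemma crossing_correlation_bound:
  assumes n: "n \<ge> 14" and k: "k \<ge> 1"
    and U: "U \<subseteq> site_box n 0" and h: "depends_on U h" "\<And>\<omega>. \<bar>h \<omega>\<bar> \<le> 1"
    and zero: "mean (site_box n 0) h = 0"
  shows "mean (site_box n 0) (\<lambda>\<omega>. crossing_sign n (0, 0) \<omega> * h \<omega>) \<le>
    12288 * real k / real n + sqrt (real (card U)) / real k"
proof -
  define E where "E = site_box n (2 * k)"
  have E: "finite E" "site_box n 0 \<subseteq> E" "site_box n k \<subseteq> E"
    using site_box_mono [of 0 "2 * k" n] site_box_mono [of k "2 * k" n]
    by (simp_all add: E_def finite_site_box)
  have finU: "finite U" using U finite_site_box finite_subset by blast
  define v where "v = mean (site_box n 0) (\<lambda>\<omega>. crossing_sign n (0, 0) \<omega> * h \<omega>)"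
  define \<delta> where "\<delta> = 12288 * real k / real n"
  define I where "I = {..<k} \<times> {..<k}"
  have I: "finite I" "card I = k * k" by (auto simp: I_def)
  define H where "H s = (\<lambda>\<omega>. h (move s -` \<omega>))" for s
  have h0: "depends_on (site_box n 0) h" using h(1) U by (rule depends_on_mono)
  have c0: "depends_on (site_box n 0) (crossing_sign n (0, 0))"
    using depends_on_cross_at [of "(0, 0)" 0 n] by (simp add: depends_on_def crossing_sign_def)
  have sub: "move s ` site_box n 0 \<subseteq> E" if "s \<in> I" for s
    using that unfolding E_def by (intro move_site_box) (auto simp: I_def)
  have H0: "mean E (H s) = 0" if s: "s \<in> I" for s
    using mean_vimage [OF h0 E(1,2) sub [OF s] inj_move] mean_restrict [OF h0 E(1,2)] zero
    by (simp add: H_def)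
  have Hs: "mean E (\<lambda>\<omega>. crossing_sign n s \<omega> * H s \<omega>) = v" if s: "s \<in> I" for s
  proof -
    have d: "depends_on (site_box n 0) (\<lambda>\<omega>. crossing_sign n (0, 0) \<omega> * h \<omega>)"
      using h0 c0 by (simp add: depends_on_def)
    have "crossing_sign n s \<omega> * H s \<omega> = crossing_sign n (0, 0) (move s -` \<omega>) * h (move s -` \<omega>)" for \<omega>
      by (simp add: H_def crossing_sign_def cross_at_move)
    then show ?thesis
      using mean_vimage [OF d E(1,2) sub [OF s] inj_move] mean_restrict [OF d E(1,2)]
          by (simp add: v_def)
  qed
  have Hts: "v - \<delta> \<le> mean E (\<lambda>\<omega>. crossing_sign n t \<omega> * H s \<omega>)" if s: "s \<in> I" and t: "t \<in> I" for s t
  proof -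
    have "v - mean E (\<lambda>\<omega>. crossing_sign n t \<omega> * H s \<omega>) =
        mean E (\<lambda>\<omega>. crossing_sign n s \<omega> * H s \<omega> - crossing_sign n t \<omega> * H s \<omega>)"
      by (simp add: mean_diff Hs [OF s])
    also have "\<dots> \<le> mean E (\<lambda>\<omega>. 2 * of_bool (cross_at n s \<omega> \<noteq> cross_at n t \<omega>))"
    proof (rule mean_mono)
      fix \<omega>
      have "\<bar>H s \<omega>\<bar> \<le> 1" by (simp add: H_def h(2))
      then show "crossing_sign n s \<omega> * H s \<omega> - crossing_sign n t \<omega> * H s \<omega> \<le>
          2 * of_bool (cross_at n s \<omega> \<noteq> cross_at n t \<omega>)"
        by (auto simp: crossing_sign_def)
    qed
    also have "\<dots> = 2 * Pr E (\<lambda>\<omega>. cross_at n s \<omega> \<noteq> cross_at n t \<omega>)"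
      by (simp only: mean_cmult Pr_def)
    also have "\<dots> \<le> 2 * (6144 * real k / real n)"
      by (intro mult_left_mono Pr_cross_at_diff n) (use s t E in \<open>auto simp: I_def E_def\<close>)
    finally show ?thesis by (simp add: \<delta>_def)
  qed
  \<comment> \<open>The shift \<open>s\<close> is recovered from the point of \<open>U\<close> that
    it moves to \<open>e\<close>.\<close>
  have ov: "card {s\<in>I. e \<in> move s ` U} \<le> card U" for e
  proof (rule card_inj_on_le [OF _ _ finU])
    show "inj_on (\<lambda>s. (fst e - 2 * int (fst s), snd e - 2 * int (snd s))) {s\<in>I. e \<in> move s ` U}"
      by (auto simp: inj_on_def)
    show "(\<lambda>s. (fst e - 2 * int (fst s), snd e - 2 * int (snd s))) ` {s\<in>I. e \<in> move s ` U} \<subseteq> U"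
      by (auto simp: move_def shift_def)
  qed
  have sq: "mean E (\<lambda>\<omega>. (H s \<omega>)\<^sup>2) \<le> 1" for s
  proof -
    have "mean E (\<lambda>\<omega>. (H s \<omega>)\<^sup>2) \<le> mean E (\<lambda>_. 1)"
    proof (rule mean_mono)
      show "(H s \<omega>)\<^sup>2 \<le> 1" for \<omega>
        using h(2) [of "move s -` \<omega>"] by (simp add: H_def abs_square_le_1)
    qed
    then show ?thesis using E(1) by simp
  qed
  have "mean E (\<lambda>\<omega>. (\<Sum>s\<in>I. H s \<omega>)\<^sup>2) \<le> real (card U) * (\<Sum>s\<in>I. mean E (\<lambda>\<omega>. (H s \<omega>)\<^sup>2))"
  proof (rule mean_sum_square_le [OF E(1) I(1) _ H0 ov])
    show "depends_on (move s ` U) (H s)" for s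
      unfolding H_def by (rule depends_on_vimage [OF h(1) inj_move])
  qed
  also have "\<dots> \<le> real (card U) * (\<Sum>s\<in>I. 1)"
    by (intro mult_left_mono sum_mono sq) auto
  \<comment> \<open>The sum over the \<open>k * k\<close> translates has standard deviation at most
    \<open>k * sqrt (card U)\<close>; dividing by their number leaves
    \<open>sqrt (card U) / k\<close>.\<close>
  also have "\<dots> = real (card U) * (real k)\<^sup>2" using I(2) by (simp add: power2_eq_square)
  finally have "sqrt (mean E (\<lambda>\<omega>. (\<Sum>s\<in>I. H s \<omega>)\<^sup>2)) \<le> sqrt (real (card U)) * real k"
    using real_sqrt_le_mono [of _ "real (card U) * (real k)\<^sup>2"] by (simp add: real_sqrt_mult)
  then have abs: "mean E (\<lambda>\<omega>. \<bar>\<Sum>s\<in>I. H s \<omega>\<bar>) \<le> sqrt (real (card U)) * real k"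
    using mean_abs_le_sqrt [OF E(1), of "\<lambda>\<omega>. \<Sum>s\<in>I. H s \<omega>"] by linarith
  have "real (card I) * (real (card I) * (v - \<delta>)) = (\<Sum>t\<in>I. \<Sum>s\<in>I. v - \<delta>)" by simp
  also have "\<dots> \<le> (\<Sum>t\<in>I. \<Sum>s\<in>I. mean E (\<lambda>\<omega>. crossing_sign n t \<omega> * H s \<omega>))"
    by (intro sum_mono Hts)
  also have "\<dots> = mean E (\<lambda>\<omega>. \<Sum>t\<in>I. \<Sum>s\<in>I. crossing_sign n t \<omega> * H s \<omega>)"
    by (simp only: mean_sum)
  also have "\<dots> \<le> mean E (\<lambda>\<omega>. real (card I) * \<bar>\<Sum>s\<in>I. H s \<omega>\<bar>)"
  proof (rule mean_mono)
    fix \<omega>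
    have "(\<Sum>t\<in>I. \<Sum>s\<in>I. crossing_sign n t \<omega> * H s \<omega>) = (\<Sum>t\<in>I. crossing_sign n t \<omega> * (\<Sum>s\<in>I. H s \<omega>))"
      by (simp add: sum_distrib_left)
    also have "\<dots> \<le> (\<Sum>t\<in>I. \<bar>\<Sum>s\<in>I. H s \<omega>\<bar>)"
      by (intro sum_mono) (auto simp: crossing_sign_def)
    finally show "(\<Sum>t\<in>I. \<Sum>s\<in>I. crossing_sign n t \<omega> * H s \<omega>) \<le> real (card I) * \<bar>\<Sum>s\<in>I. H s \<omega>\<bar>" by simp
  qed
  also have "\<dots> = real (card I) * mean E (\<lambda>\<omega>. \<bar>\<Sum>s\<in>I. H s \<omega>\<bar>)" by (rule mean_cmult)
  also have "\<dots> \<le> real (card I) * (sqrt (real (card U)) * real k)"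
    by (intro mult_left_mono abs) simp
  finally have "real (card I) * (v - \<delta>) \<le> sqrt (real (card U)) * real k"
    using k I(2) by (simp add: mult_le_cancel_left)
  then have "real k * (real k * (v - \<delta>)) \<le> real k * sqrt (real (card U))"
    using I(2) by (simp add: algebra_simps)
  then have "real k * (v - \<delta>) \<le> sqrt (real (card U))"
    using k by (simp add: mult_le_cancel_left)
  then have "v - \<delta> \<le> sqrt (real (card U)) / real k"
    using k by (simp add: field_simps)
  then show ?thesis by (simp add: v_def \<delta>_def)
qed

section \<open>Sparse sets have no clue\<close>

definition dbl :: "vertex \<Rightarrow> site" where
  "dbl u = (2 * fst u, 2 * snd u)"

text \<open>An edge is encoded by its midpoint in the doubled lattice, that is, by the sum of its end points.\<close>

definition enc :: "edge \<Rightarrow> site" where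
  "enc e = (\<Sum>w\<in>e. fst w, \<Sum>w\<in>e. snd w)"

definition open_sites :: "nat \<Rightarrow> (edge \<Rightarrow> int) \<Rightarrow> site set" where
  "open_sites n \<omega> = {enc e | e. e \<in> R_edges n \<and> \<omega> e = 1}"

definition decode :: "nat \<Rightarrow> site set \<Rightarrow> edge \<Rightarrow> int" where
  "decode n A = (\<lambda>e\<in>R_edges n. if enc e \<in> A then 1 else -1)"

abbreviation Rect :: "nat \<Rightarrow> site set" where
  "Rect n \<equiv> rect 0 0 (2 * (int n - 1)) 0 (2 * (int n - 1) - 2)"

lemma dbl_adj: "adj (dbl u) (dbl v) \<longleftrightarrow> Z2_adj u v"
  unfolding adj_def Z2_adj_def dbl_def by simp presburger

lemma dbl_R_verts: "dbl ` R_verts n = Rect n"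
proof
  show "Rect n \<subseteq> dbl ` R_verts n"
  proof
    fix x assume "x \<in> Rect n"
    then have "x = dbl (fst x div 2, snd x div 2)" "(fst x div 2, snd x div 2) \<in> R_verts n"
      by (auto simp: mem_rect dbl_def R_verts_def prod_eq_iff)
    then show "x \<in> dbl ` R_verts n" by blast
  qed
qed (auto simp: mem_rect dbl_def R_verts_def)

lemma inj_dbl: "inj dbl"
  by (auto simp: inj_def dbl_def prod_eq_iff)

lemma enc_pair: "Z2_adj u v \<Longrightarrow> enc {u, v} = mid (dbl u) (dbl v)"
proof -
  assume "Z2_adj u v"
  then have "u \<noteq> v" by (auto simp: Z2_adj_def)
  then show ?thesis by (simp add: enc_def mid_def dbl_def)
qed

lemma R_edges_cases:
  assumes "e \<in> R_edges n"
  obtains u v where "e = {u, v}" "u \<in> R_verts n" "v \<in> R_verts n" "Z2_adj u v"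
  using assms unfolding R_edges_def by blast

lemma dbl_cls: "dbl u \<in> cls 0"
  by (simp add: mem_cls dbl_def)

lemma inj_on_enc: "inj_on enc (R_edges n)"
proof (rule inj_onI)
  fix e e' assume "e \<in> R_edges n" "e' \<in> R_edges n" and eq: "enc e = enc e'"
  then obtain u v u' v' where e: "e = {u, v}" "Z2_adj u v" "e' = {u', v'}" "Z2_adj u' v'"
    by (metis R_edges_cases)
  then have m: "mid (dbl u) (dbl v) = mid (dbl u') (dbl v')" using eq enc_pair by simp
  then have s: "fst u + fst v = fst u' + fst v'" "snd u + snd v = snd u' + snd v'"
    by (simp_all add: mid_def dbl_def)
  have "dbl u = dbl u' \<or> dbl v = dbl u'"
    using mid_eq_mid [OF _ _ dbl_cls dbl_cls m] e by (simp add: dbl_adj)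
  then have "u = u' \<or> v = u'" using inj_dbl by (auto dest: injD)
  then show "e = e'" using s e by (auto simp: prod_eq_iff doubleton_eq_iff)
qed

lemma enc_site_box: "enc ` R_edges n \<subseteq> site_box n 0"
proof
  fix x assume "x \<in> enc ` R_edges n"
  then obtain e where e: "e \<in> R_edges n" "x = enc e" by blast
  obtain u v where uv: "e = {u, v}" "u \<in> R_verts n" "v \<in> R_verts n" "Z2_adj u v"
    using e(1) by (rule R_edges_cases)
  have "x = mid (dbl u) (dbl v)" using e(2) uv(1,4) by (simp add: enc_pair)
  moreover have "dbl u \<in> Rect n" "dbl v \<in> Rect n" using uv(2,3) dbl_R_verts by blast+
  moreover have "adj (dbl u) (dbl v)" using uv(4) by (simp add: dbl_adj)
  ultimately show "x \<in> site_box n 0"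
    using mid_rect [of "dbl u" 0 0 "2 * (int n - 1)" 0 "2 * (int n - 1) - 2" "dbl v"]
    by (simp add: site_box_def)
qed

lemma mid_Rect:
  assumes "a \<in> Rect n" "b \<in> Rect n" "adj a b"
  shows "\<exists>u v. a = dbl u \<and> b = dbl v \<and> u \<in> R_verts n \<and> v \<in> R_verts n \<and> Z2_adj u v \<and>
    {u, v} \<in> R_edges n \<and> mid a b = enc {u, v}"
proof -
  obtain u v where uv: "a = dbl u" "b = dbl v" "u \<in> R_verts n" "v \<in> R_verts n"
    using assms(1,2) dbl_R_verts by (metis imageE)
  then have z: "Z2_adj u v" using assms(3) by (simp add: dbl_adj)
  then have "{u, v} \<in> R_edges n" unfolding R_edges_def using uv by blast
  moreover have "mid a b = enc {u, v}" using enc_pair [OF z] uv(1,2) by simp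
  ultimately show ?thesis using uv z by blast
qed

lemma depends_on_crossing_sign: "depends_on (enc ` R_edges n) (crossing_sign n (0, 0))"
proof -
  have mids: "mid a b \<in> enc ` R_edges n" if ab: "a \<in> Rect n" "b \<in> Rect n" "adj a b" for a b
  proof -
    obtain u v where "{u, v} \<in> R_edges n" "mid a b = enc {u, v}" using mid_Rect [OF ab] by blast
    then show ?thesis by blast
  qed
  have "conn (Rect n) (\<omega> \<inter> enc ` R_edges n) = conn (Rect n) \<omega>" for \<omega>
    unfolding conn_def by (intro arg_cong [of _ _ rtranclp] ext) (metis IntD1 IntI mids)
  then show ?thesis
    by (simp add: depends_on_def crossing_sign_def cross_at_def hcross_def)
qed

section \<open>Open paths as connections of sites\<close>

definition open_step :: "nat \<Rightarrow> (edge \<Rightarrow> int) \<Rightarrow> vertex \<Rightarrow> vertex \<Rightarrow> bool" where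
  "open_step n \<omega> u v \<longleftrightarrow> {u, v} \<in> R_edges n \<and> \<omega> {u, v} = 1"

lemma open_path_altdef:
  "open_path n \<omega> p \<longleftrightarrow> p \<noteq> [] \<and> distinct p \<and> set p \<subseteq> R_verts n \<and> successively (open_step n \<omega>) p"
  by (simp add: open_path_def successively_conv_nth open_step_def)

lemma R_edges_pair: "{u, v} \<in> R_edges n \<Longrightarrow> u \<in> R_verts n \<and> v \<in> R_verts n \<and> Z2_adj u v"
  by (auto simp: R_edges_def doubleton_eq_iff Z2_adj_def)

lemma successively_rtranclp: "successively r p \<Longrightarrow> p \<noteq> [] \<Longrightarrow> r\<^sup>*\<^sup>* (hd p) (last p)"
  by (induction p) (auto simp: successively_Cons intro: converse_rtranclp_into_rtranclp)

lemma rtranclp_open_path: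
  assumes "(open_step n \<omega>)\<^sup>*\<^sup>* u v" "u \<in> R_verts n"
  shows "\<exists>p. open_path n \<omega> p \<and> hd p = u \<and> last p = v"
  using assms(1)
proof (induction rule: rtranclp_induct)
  case base
  show ?case using assms(2) by (intro exI [of _ "[u]"]) (simp add: open_path_altdef)
next
  case (step v w)
  then obtain p where p: "open_path n \<omega> p" "hd p = u" "last p = v" by blast
  show ?case
  proof (cases "w \<in> set p")
    \<comment> \<open>A return to the path is cut off at the earlier visit of \<open>w\<close>,
      which keeps the vertices distinct.\<close>
    case True
    then obtain xs ys where "p = xs @ w # ys" by (meson split_list)
    then show ?thesis
      using p by (intro exI [of _ "xs @ [w]"])
        (auto simp: open_path_altdef successively_append_iff hd_append split: if_splits)
  next
    case False
    have "w \<in> R_verts n" using step(2) R_edges_pair [of v w n] by (simp add: open_step_def)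
    then show ?thesis
      using p False step(2) by (intro exI [of _ "p @ [w]"]) (auto simp: open_path_altdef
          successively_append_iff)
  qed
qed

lemma conn_open_sites:
  assumes "u \<in> R_verts n"
  shows "conn (Rect n) (open_sites n \<omega>) (dbl u) (dbl v) \<longleftrightarrow> (open_step n \<omega>)\<^sup>*\<^sup>* u v"
proof
  assume "(open_step n \<omega>)\<^sup>*\<^sup>* u v"
  then show "conn (Rect n) (open_sites n \<omega>) (dbl u) (dbl v)"
  proof (induction rule: rtranclp_induct)
    case (step v w)
    then have vw: "{v, w} \<in> R_edges n" "\<omega> {v, w} = 1" by (auto simp: open_step_def)
    then have r: "v \<in> R_verts n" "w \<in> R_verts n" "Z2_adj v w" using R_edges_pair by blast+
    have "enc {v, w} \<in> open_sites n \<omega>" using vw unfolding open_sites_def by blast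
    then have "conn (Rect n) (open_sites n \<omega>) (dbl v) (dbl w)"
      using r dbl_R_verts by (intro conn_step) (auto simp: dbl_adj enc_pair)
    with step(3) show ?case by (rule conn_trans)
  qed simp
next
  have *: "\<exists>v. y = dbl v \<and> (open_step n \<omega>)\<^sup>*\<^sup>* u v" if "conn (Rect n) (open_sites n \<omega>) (dbl u) y" for y
    using that
  proof (induction rule: conn_induct)
    case refl
    show ?case by (rule exI [of _ u]) simp
  next
    case (step a b)
    obtain v w where vw: "a = dbl v" "b = dbl w" "{v, w} \<in> R_edges n" "mid a b = enc {v, w}"
      using mid_Rect [OF step(2-4)] by blast
    then obtain e where e: "e \<in> R_edges n" "\<omega> e = 1" "enc {v, w} = enc e"
      using step(5) unfolding open_sites_def by auto
    then have "e = {v, w}" using inj_on_enc vw(3) by (auto dest: inj_onD)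
    then have "open_step n \<omega> v w" using e by (simp add: open_step_def)
    moreover have "(open_step n \<omega>)\<^sup>*\<^sup>* u v" using step(6) vw(1) inj_dbl by (auto dest: injD)
    ultimately have "(open_step n \<omega>)\<^sup>*\<^sup>* u w" by simp
    then show ?case using vw(2) by blast
  qed
  assume "conn (Rect n) (open_sites n \<omega>) (dbl u) (dbl v)"
  from * [OF this] obtain v' where "dbl v = dbl v'" "(open_step n \<omega>)\<^sup>*\<^sup>* u v'" by blast
  then show "(open_step n \<omega>)\<^sup>*\<^sup>* u v" using inj_dbl by (auto dest: injD)
qed

lemma LR_crossing_sign: "LR n \<omega> = crossing_sign n (0, 0) (open_sites n \<omega>)"
proof -
  have "(\<exists>p. open_path n \<omega> p \<and> fst (hd p) = 0 \<and> fst (last p) = int n - 1) \<longleftrightarrow>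
      (\<exists>u\<in>R_verts n. \<exists>v. fst u = 0 \<and> fst v = int n - 1 \<and> (open_step n \<omega>)\<^sup>*\<^sup>* u v)"
  proof
    assume "\<exists>p. open_path n \<omega> p \<and> fst (hd p) = 0 \<and> fst (last p) = int n - 1"
    then obtain p where p: "open_path n \<omega> p" "fst (hd p) = 0" "fst (last p) = int n - 1" by blast
    then have "hd p \<in> R_verts n" "(open_step n \<omega>)\<^sup>*\<^sup>* (hd p) (last p)"
      using successively_rtranclp by (auto simp: open_path_altdef)
    then show "\<exists>u\<in>R_verts n. \<exists>v. fst u = 0 \<and> fst v = int n - 1 \<and> (open_step n \<omega>)\<^sup>*\<^sup>* u v"
      using p by blast
  next
    assume "\<exists>u\<in>R_verts n. \<exists>v. fst u = 0 \<and> fst v = int n - 1 \<and> (open_step n \<omega>)\<^sup>*\<^sup>* u v"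
    then show "\<exists>p. open_path n \<omega> p \<and> fst (hd p) = 0 \<and> fst (last p) = int n - 1"
      using rtranclp_open_path by metis
  qed
  also have "\<dots> \<longleftrightarrow> hcross 0 0 (2 * (int n - 1)) 0 (2 * (int n - 1) - 2) (open_sites n \<omega>)"
  proof
    assume "\<exists>u\<in>R_verts n. \<exists>v. fst u = 0 \<and> fst v = int n - 1 \<and> (open_step n \<omega>)\<^sup>*\<^sup>* u v"
    then obtain u v where u: "u \<in> R_verts n" "fst u = 0" "fst v = int n - 1"
        "(open_step n \<omega>)\<^sup>*\<^sup>* u v" by blast
    then have "conn (Rect n) (open_sites n \<omega>) (dbl u) (dbl v)"
      using conn_open_sites by blast
    moreover have "dbl u \<in> Rect n" using u(1) dbl_R_verts by blast
    moreover have "fst (dbl u) = 0" "fst (dbl v) = 2 * (int n - 1)" using u by (auto simp: dbl_def)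
    ultimately show "hcross 0 0 (2 * (int n - 1)) 0 (2 * (int n - 1) - 2) (open_sites n \<omega>)"
      unfolding hcross_def by blast
  next
    assume "hcross 0 0 (2 * (int n - 1)) 0 (2 * (int n - 1) - 2) (open_sites n \<omega>)"
    then obtain x y where x: "x \<in> Rect n" "fst x = 0" "fst y = 2 * (int n - 1)"
        "conn (Rect n) (open_sites n \<omega>) x y"
      unfolding hcross_def by blast
    have "y \<in> Rect n" using conn_in x by blast
    obtain u where u: "x = dbl u" "u \<in> R_verts n" using x(1) dbl_R_verts by blast
    obtain v where v: "y = dbl v" using \<open>y \<in> Rect n\<close> dbl_R_verts by blast
    have "(open_step n \<omega>)\<^sup>*\<^sup>* u v" using x(4) unfolding u(1) v conn_open_sites [OF u(2)] .
    moreover have "fst u = 0" "fst v = int n - 1" using x u v by (auto simp: dbl_def)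
    ultimately show "\<exists>u\<in>R_verts n. \<exists>v. fst u = 0 \<and> fst v = int n - 1 \<and> (open_step n \<omega>)\<^sup>*\<^sup>* u v"
      using u(2) by blast
  qed
  finally show ?thesis by (simp add: LR_def crossing_sign_def cross_at_def)
qed

section \<open>Expectations, conditional expectations and the clue\<close>

lemma decode_configs: "decode n A \<in> configs (R_edges n)"
  by (auto simp: decode_def configs_def)

lemma open_sites_decode: "open_sites n (decode n A) = A \<inter> enc ` R_edges n"
proof -
  have "decode n A e = 1 \<longleftrightarrow> enc e \<in> A" if "e \<in> R_edges n" for e
    using that by (simp add: decode_def)
  then show ?thesis unfolding open_sites_def by blast
qed

lemma decode_open_sites:
  assumes "\<omega> \<in> configs (R_edges n)"
  shows "decode n (open_sites n \<omega>) = \<omega>"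
proof
  fix e
  show "decode n (open_sites n \<omega>) e = \<omega> e"
  proof (cases "e \<in> R_edges n")
    case True
    then have "enc e \<in> open_sites n \<omega> \<longleftrightarrow> \<omega> e = 1"
      using inj_on_enc [of n] unfolding open_sites_def by (auto dest: inj_onD)
    moreover have "\<omega> e \<in> {-1, 1}" using assms True by (auto simp: configs_def)
    ultimately show ?thesis using True by (auto simp: decode_def)
  qed (use assms in \<open>auto simp: configs_def decode_def\<close>)
qed

lemma finite_configs: "finite (configs (R_edges n))"
  unfolding configs_def by (intro finite_PiE finite_R_edges) auto

lemma expectation_perc: "(\<integral>\<omega>. g \<omega> \<partial>perc n) = mean (enc ` R_edges n) (\<lambda>A. g (decode n A))"
proof -
  have "bij_betw (decode n) (Pow (enc ` R_edges n)) (configs (R_edges n))"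
  proof (rule bij_betwI [of _ _ _ "open_sites n"])
    show "open_sites n \<in> configs (R_edges n) \<rightarrow> Pow (enc ` R_edges n)"
      unfolding open_sites_def by blast
    show "open_sites n (decode n A) = A" if "A \<in> Pow (enc ` R_edges n)" for A
      using that unfolding open_sites_decode by blast
  qed (simp_all add: decode_configs decode_open_sites)
  then have s: "(\<Sum>A\<in>Pow (enc ` R_edges n). g (decode n A)) = (\<Sum>\<omega>\<in>configs (R_edges n). g \<omega>)"
    by (rule sum.reindex_bij_betw)
  have "card (configs (R_edges n)) = 2 ^ card (R_edges n)"
    unfolding configs_def by (simp add: card_PiE finite_R_edges numeral_2_eq_2)
  then show ?thesis
    using s by (simp add: perc_def integral_uniform_count_measure finite_configs mean_def
        card_image inj_on_enc)
qed

lemma integrable_perc: "integrable (perc n) (g :: (edge \<Rightarrow> int) \<Rightarrow> real)"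
  unfolding perc_def uniform_count_measure_def
  by (rule integrable_point_measure_finite) (rule finite_configs)

text \<open>No generator, hence no set of the generated sigma-algebra, separates two configurations
  that agree on \<open>U\<close>; this is applied to the preimage of the value
  \<open>g \<omega>\<close>.\<close>

lemma coord_algebra_measurable_eq:
  assumes "g \<in> borel_measurable (coord_algebra M U)" "\<omega> \<in> space M" "\<omega>' \<in> space M" "\<And>e. e \<in> U \<Longrightarrow>
      \<omega> e = \<omega>' e"
  shows "g \<omega> = (g \<omega>' :: real)"
proof -
  let ?G = "{{\<omega> \<in> space M. \<omega> e \<in> A} | e A. e \<in> U}"
  have sp: "space (coord_algebra M U) = space M"
    and st: "sets (coord_algebra M U) = sigma_sets (space M) ?G"
    unfolding coord_algebra_def by (simp add: space_measure_of_conv, rule sets_measure_of, blast)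
  have iff: "\<omega> \<in> S \<longleftrightarrow> \<omega>' \<in> S" if "S \<in> sigma_sets (space M) ?G" for S
    using that by induction (use assms(2-4) in auto)
  have "g -` {g \<omega>} \<inter> space M \<in> sigma_sets (space M) ?G"
    using measurable_sets [OF assms(1), of "{g \<omega>}"] by (simp add: sp st)
  from iff [OF this] show ?thesis using assms(2,3) by simp
qed

text \<open>Every configuration has positive mass. The almost sure bounds for conditional
  expectations thereby hold at every point.\<close>

lemma AE_perc: "(AE \<omega> in perc n. P \<omega>) \<longleftrightarrow> (\<forall>\<omega>\<in>configs (R_edges n). P \<omega>)"
  using finite_configs [of n] unfolding perc_def uniform_count_measure_def
  by (auto simp: AE_point_measure card_gt_0_iff)

lemma mean_crossing_sign:
  assumes "n \<ge> 2"
  shows "mean (enc ` R_edges n) (crossing_sign n (0, 0)) = 0"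
proof -
  have "mean (enc ` R_edges n) (crossing_sign n (0, 0)) = mean (site_box n 0) (crossing_sign n (0, 0))"
    by (rule mean_restrict [OF depends_on_crossing_sign finite_site_box enc_site_box, symmetric])
  also have "\<dots> = mean (site_box n 0) (\<lambda>\<omega>. 2 * of_bool (cross_at n (0, 0) \<omega>) - 1)"
    by (rule mean_cong) (simp add: crossing_sign_def)
  also have "\<dots> = 2 * Pr (site_box n 0) (cross_at n (0, 0)) - 1"
    unfolding mean_diff mean_cmult by (simp add: Pr_def finite_site_box)
  also have "Pr (site_box n 0) (cross_at n (0, 0)) = 1 / 2"
    using Pr_hcross_half [of "2 * (int n - 1)" "site_box n 0"] assms
    by (simp add: cross_at_def finite_site_box site_box_def)
  finally show ?thesis by simp
qed

text \<open>\<open>LR n\<close> has mean 0 and square 1, hence variance 1. Its conditional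
  expectation \<open>g\<close> also has mean 0 and satisfies E[g g] = E[g LR], so the clue is a
  correlation to which \<open>crossing_correlation_bound\<close> applies.\<close>

lemma clue_LR_bounds:
  assumes n: "n \<ge> 14" and k: "k \<ge> 1" and U: "U \<subseteq> R_edges n"
  shows "0 \<le> clue (perc n) (LR n) U"
    and "clue (perc n) (LR n) U \<le> 12288 * real k / real n + sqrt (real (card U)) / real k"
proof -
  let ?F = "coord_algebra (perc n) U"
  interpret sigma_finite_subalgebra "perc n" ?F
    by (rule sigma_finite_subalgebra_coord_algebra_perc)
  define g where "g = real_cond_exp (perc n) ?F (LR n)"
  define h where "h A = g (decode n A)" for A
  let ?X = "enc ` R_edges n"
  have sp: "space (perc n) = configs (R_edges n)"
    by (simp add: perc_def space_uniform_count_measure)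
  have LR: "LR n (decode n A) = crossing_sign n (0, 0) A" for A
    using depends_on_crossing_sign [of n]
        by (simp add: LR_crossing_sign open_sites_decode depends_on_def)
  have meas [measurable]: "f \<in> borel_measurable (perc n)" for f :: "(edge \<Rightarrow> int) \<Rightarrow> real"
    by (simp add: perc_def measurable_def sets_uniform_count_measure space_uniform_count_measure)
  have gF [measurable]: "g \<in> borel_measurable ?F" by (simp add: g_def)
  have int_g: "(\<integral>\<omega>. g \<omega> \<partial>perc n) = (\<integral>\<omega>. LR n \<omega> \<partial>perc n)"
    unfolding g_def by (rule real_cond_exp_int(2)) (rule integrable_perc)
  have int_gg: "(\<integral>\<omega>. g \<omega> * g \<omega> \<partial>perc n) = (\<integral>\<omega>. g \<omega> * LR n \<omega> \<partial>perc n)"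
    unfolding g_def by (rule real_cond_exp_intg(2)) (auto intro: integrable_perc simp: g_def [symmetric])
  have LR0: "(\<integral>\<omega>. LR n \<omega> \<partial>perc n) = 0"
    using mean_crossing_sign [of n] n by (simp add: expectation_perc LR)
  have LRsq: "LR n \<omega> * LR n \<omega> = 1" for \<omega> by (simp add: LR_def)
  interpret P: prob_space "perc n" by (rule prob_space_perc)
  have "P.variance (LR n) = 1"
    using LR0 by (simp add: power2_eq_square LRsq P.prob_space)
  moreover have "P.variance g = (\<integral>\<omega>. g \<omega> * LR n \<omega> \<partial>perc n)"
    using int_g LR0 int_gg by (simp add: power2_eq_square)
  ultimately have cl: "clue (perc n) (LR n) U = (\<integral>\<omega>. g \<omega> * LR n \<omega> \<partial>perc n)"
    by (simp add: clue_def g_def)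
  show "0 \<le> clue (perc n) (LR n) U"
    unfolding cl int_gg [symmetric] by (rule Bochner_Integration.integral_nonneg) simp
  have "AE \<omega> in perc n. g \<omega> \<le> 1" "AE \<omega> in perc n. -1 \<le> g \<omega>"
    unfolding g_def by (auto intro!: real_cond_exp_le_c real_cond_exp_ge_c integrable_perc simp: LR_def)
  then have "g (decode n A) \<le> 1" "-1 \<le> g (decode n A)" for A
    unfolding AE_perc using decode_configs by blast+
  then have bd: "\<bar>h A\<bar> \<le> 1" for A
    unfolding h_def abs_le_iff by (simp add: minus_le_iff)
  have dep: "depends_on (enc ` U) h"
    unfolding depends_on_def h_def
  proof
    fix A
    show "g (decode n (A \<inter> enc ` U)) = g (decode n A)"
    proof (rule coord_algebra_measurable_eq [OF gF])
      fix e assume "e \<in> U"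
      then show "decode n (A \<inter> enc ` U) e = decode n A e"
        using U by (simp add: decode_def)
    qed (simp_all add: sp decode_configs)
  qed
  then have dep': "depends_on ?X h" by (rule depends_on_mono) (use U in auto)
  then have dep'': "depends_on ?X (\<lambda>\<omega>. crossing_sign n (0, 0) \<omega> * h \<omega>)"
    using depends_on_crossing_sign [of n] by (simp add: depends_on_def)
  have "mean (site_box n 0) h = mean ?X h"
    by (rule mean_restrict [OF dep' finite_site_box enc_site_box])
  also have "\<dots> = 0"
    using int_g LR0 by (simp add: expectation_perc h_def [abs_def])
  finally have zero: "mean (site_box n 0) h = 0" .
  have "clue (perc n) (LR n) U = mean ?X (\<lambda>A. crossing_sign n (0, 0) A * h A)"
    by (simp add: cl expectation_perc LR h_def mult.commute)
  also have "\<dots> = mean (site_box n 0) (\<lambda>A. crossing_sign n (0, 0) A * h A)"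
    by (rule mean_restrict [OF dep'' finite_site_box enc_site_box, symmetric])
  also have "\<dots> \<le> 12288 * real k / real n + sqrt (real (card (enc ` U))) / real k"
    by (rule crossing_correlation_bound [OF n k _ dep bd zero]) (use U enc_site_box in blast)
  also have "card (enc ` U) = card U"
    by (rule card_image [OF inj_on_subset [OF inj_on_enc U]])
  finally show "clue (perc n) (LR n) U \<le> 12288 * real k / real n + sqrt (real (card U)) / real k" .
qed

lemma card_R_edges_le: "real (card (R_edges n)) \<le> 4 * (real n)\<^sup>2"
proof -
  have "card (R_edges n) = card (enc ` R_edges n)" by (simp add: card_image inj_on_enc)
  also have "\<dots> \<le> card (site_box n 0)" by (intro card_mono finite_site_box enc_site_box)
  also have "\<dots> = nat (2 * int n - 1) * nat (2 * int n - 3)"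
    by (simp add: site_box_def)
  also have "\<dots> \<le> (2 * n) * (2 * n)" by (intro mult_mono) auto
  finally have "real (card (R_edges n)) \<le> real ((2 * n) * (2 * n))" by (simp only: of_nat_le_iff)
  then show ?thesis by (simp add: power2_eq_square)
qed

theorem theorem1p3:
  fixes U :: "nat \<Rightarrow> edge set"
  assumes "\<And>n. n \<ge> 2 \<Longrightarrow> U n \<subseteq> R_edges n"
    and "(\<lambda>n. real (card (U n)) / real (card (R_edges n))) \<longlonglongrightarrow> 0"
  shows "(\<lambda>n. clue (perc n) (LR n) (U n)) \<longlonglongrightarrow> 0"
proof -
  define \<rho> where "\<rho> n = real (card (U n)) / real (card (R_edges n))" for n
  have bound: "\<bar>clue (perc n) (LR n) (U n)\<bar> \<le> 12288 * \<epsilon> + (12288 / real n + 2 * sqrt (\<rho> n) / \<epsilon>)"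
    if n: "n \<ge> 14" and \<epsilon>: "\<epsilon> > 0" for n and \<epsilon> :: real
  proof -
    \<comment> \<open>Up to rounding, a shift range of \<open>\<epsilon> * n\<close> turns the first
      term of the bound into a multiple of \<open>\<epsilon>\<close>, while in the second the factor
      \<open>n\<close> in the square root of the number of edges cancels.\<close>
    define k where "k = nat \<lceil>\<epsilon> * real n\<rceil>"
    have pos: "\<epsilon> * real n > 0" using n \<epsilon> by simp
    then have k: "k \<ge> 1" "\<epsilon> * real n \<le> real k" "real k \<le> \<epsilon> * real n + 1"
      unfolding k_def by (auto simp: le_nat_iff; linarith)+
    have U: "U n \<subseteq> R_edges n" using assms(1) n by simp
    have "real (card (U n)) = \<rho> n * real (card (R_edges n))"
    proof (cases "card (R_edges n) = 0")
      \<comment> \<open>Division by zero makes \<open>\<rho> n\<close> equal to 0, which is right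
        since \<open>U n\<close> is then empty.\<close>
      case True
      then show ?thesis using U finite_R_edges [of n] by (simp add: \<rho>_def)
    qed (simp add: \<rho>_def)
    also have "\<dots> \<le> \<rho> n * (4 * (real n)\<^sup>2)"
      by (intro mult_left_mono card_R_edges_le) (simp add: \<rho>_def)
    finally have "sqrt (real (card (U n))) \<le> sqrt (\<rho> n * (4 * (real n)\<^sup>2))" by simp
    also have "\<dots> = 2 * sqrt (\<rho> n) * real n" by (simp add: real_sqrt_mult)
    finally have "sqrt (real (card (U n))) / real k \<le> 2 * sqrt (\<rho> n) * real n / (\<epsilon> * real n)"
      using k pos by (intro frac_le) (auto simp: \<rho>_def)
    also have "\<dots> = 2 * sqrt (\<rho> n) / \<epsilon>" using n by simp
    finally have 1: "sqrt (real (card (U n))) / real k \<le> 2 * sqrt (\<rho> n) / \<epsilon>" .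
    have "12288 * real k / real n \<le> 12288 * (\<epsilon> * real n + 1) / real n"
      using k(3) by (intro divide_right_mono mult_left_mono) auto
    also have "\<dots> = 12288 * \<epsilon> + 12288 / real n" using n by (simp add: field_simps)
    finally show ?thesis
      using clue_LR_bounds [OF n k(1) U] 1 by linarith
  qed
  have lim: "(\<lambda>n. 12288 / real n + 2 * sqrt (\<rho> n) / \<epsilon>) \<longlonglongrightarrow> 0" if "\<epsilon> > 0" for \<epsilon> :: real
  proof -
    have "(\<lambda>n. 12288 / real n) \<longlonglongrightarrow> 0" by (rule lim_const_over_n)
    moreover have "(\<lambda>n. 2 * sqrt (\<rho> n) / \<epsilon>) \<longlonglongrightarrow> 2 * sqrt 0 / \<epsilon>"
      using assms(2) that unfolding \<rho>_def [symmetric] by (intro tendsto_intros) auto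
    ultimately show ?thesis using tendsto_add by fastforce
  qed
  show ?thesis
  proof (rule LIMSEQ_I)
    fix r :: real assume r: "r > 0"
    define \<epsilon> where "\<epsilon> = r / (2 * 12288)"
    have \<epsilon>: "\<epsilon> > 0" using r by (simp add: \<epsilon>_def)
    obtain m where m: "\<And>n. n \<ge> m \<Longrightarrow> norm (12288 / real n + 2 * sqrt (\<rho> n) / \<epsilon> - 0) < r / 2"
      using LIMSEQ_D [OF lim [OF \<epsilon>], of "r / 2"] r by auto
    show "\<exists>no. \<forall>n\<ge>no. norm (clue (perc n) (LR n) (U n) - 0) < r"
    proof (intro exI [of _ "max m 14"] allI impI)
      fix n assume "max m 14 \<le> n"
      then have "\<bar>clue (perc n) (LR n) (U n)\<bar> \<le> 12288 * \<epsilon> + (12288 / real n + 2 * sqrt (\<rho> n) / \<epsilon>)"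
        "norm (12288 / real n + 2 * sqrt (\<rho> n) / \<epsilon> - 0) < r / 2"
        by (intro bound \<epsilon> m; simp)+
      moreover have "12288 * \<epsilon> = r / 2" by (simp add: \<epsilon>_def)
      ultimately show "norm (clue (perc n) (LR n) (U n) - 0) < r"
        unfolding diff_zero real_norm_def by linarith
    qed
  qed
qed

end
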